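(* Let $F$ be a graph on vertex set $[k]$. For every $\varepsilon>0$ there exists $n_0\in\mathbb{N}$ such that the following holds for all $n\ge n_0$. Let $G$ be a graph on $[n]$ and let $G^*$ be the final graph of the $F$-removal flip process started at $G$. Let $W_G$ and $W_{G^*}$ be the graphon representations of $G$ and $G^*$ (with respect to the same partition of $\Omega$). Then with probability at least $1-\varepsilon$ we have $d_\square(\mathrm{dest}(W_G),W_{G^*})<\varepsilon$.
   Context: Let $(\Omega,\pi)$ be an atomless probability space with separable $\sigma$-algebra. A kernel is a bounded symmetric measurable $W:\Omega^2\to\mathbb{R}$ (up to a.e. equality); $\mathcal{W}$ is the Banach space of kernels with $\|\cdot\|_\infty$; graphons are kernels with values in $[0,1]$; $d_\square(U,W)=\sup_{S,T\subseteq\Omega}|\int_{S\times T}(U-W)\,d\pi^2|$. $\mathcal{H}_k$ is the set of graphs on $[k]$. A rule of order $k$ is a matrix $\mathcal{R}\in[0,1]^{\mathcal{H}_k\times\mathcal{H}_k}$ with row sums $1$. The $F$-removal rule: $\mathcal{R}_{H,H-F}=1$ for every $H\in\mathcal{H}_k$ containing $F$ as a labelled subgraph ($H-F$ is $H$ with the edges of $F$ deleted), $\mathcal{R}_{H,H}=1$ for all other $H$; other entries $0$. Flip process on finite graphs: starting from $G_0=G$ on $[n]$ ($n\ge k$), at each step $t=1,2,\dots$ sample a uniformly random ordered $k$-tuple $(v_1,\dots,v_k)$ of distinct vertices, let $F'\in\mathcal{H}_k$ be the drawn graph with $ij\in E(F')$ iff $v_iv_j\in E(G_{t-1})$, sample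 $H$ with probability $\mathcal{R}_{F',H}$, and obtain $G_t$ from $G_{t-1}$ by setting, for all $i\ne j$, $v_iv_j\in E(G_t)$ iff $ij\in E(H)$ (other pairs unchanged). The stabilization time is $\kappa(G)=\min\{\ell:G_\ell=G_{\ell+1}=\cdots\}$ (finite almost surely for removal processes) and the final graph is $G^*=G_{\kappa(G)}$. The graphon representation of a graph on $[n]$: fix a partition $(\Omega_v)_{v\in[n]}$ of $\Omega$ into sets of measure $1/n$ and let $W_G=1$ on $\Omega_u\times\Omega_v$ for $uv\in E(G)$ and $0$ elsewhere. Velocity: for a kernel $W$, $H'\in\mathcal{H}_k$, distinct $a,b$, $t^{x,y}_{\mathrm{ind}}(H'^{a,b},W)=\int\prod_{ij\in E(H')}W(x_i,x_j)\prod_{ij\notin E(H')}(1-W(x_i,x_j))\prod_{i\ne a,b}d\pi(x_i)$ with $x_a=x,x_b=y$, and $\mathfrak{V}_{\mathcal{R}}W(x,y)=\sum_{H',H}\sum_{a\ne b}\mathcal{R}_{H',H}t^{x,y}_{\mathrm{ind}}(H'^{a,b},W)(\mathbb{1}[ab\in E(H)\setminus E(H')]-\mathbb{1}[ab\in E(H')\setminus E(H)])$. For a graphon $W$, the trajectory $t\mapsto\Phi^tW$, $t\ge0$, solves $\frac{d}{dt}\Phi^tW=\mathfrak{V}_{\mathcal{R}}(\Phi^tW)$ in $(\mathcal{W},\|\cdot\|_\infty)$ with $\Phi^0W=W$, and $\mathrm{dest}(W)$ is the graphon $S$ with $d_\square(\Phi^tW,S)\to0$ as $t\to\infty$. *)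

theory Defs
  imports "HOL-Probability.Probability"
begin

section \<open>Graphs and rules\<close>

text \<open>A graph on \<open>[n] = {1..n}\<close> is identified with its set of edges, an edge being a two-element
  subset of \<open>[n]\<close>. Thus \<open>F \<subseteq> H\<close> says that \<open>F\<close> is a labelled subgraph of \<open>H\<close>, and
  \<open>H - F\<close> is \<open>H\<close> with the edges of \<open>F\<close> deleted.\<close>

type_synonym graph = "nat set set"

definition pairs :: "nat \<Rightarrow> nat set set" where
  "pairs n = {e. e \<subseteq> {1..n} \<and> card e = 2}"

definition graphs :: "nat \<Rightarrow> graph set" where
  "graphs n = Pow (pairs n)"

text \<open>Only the entries indexed by \<open>graphs k\<close> of a rule of order \<open>k\<close> are meaningful.\<close>

type_synonym rule = "graph \<Rightarrow> graph \<Rightarrow> real"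

definition flip_rule :: "nat \<Rightarrow> rule \<Rightarrow> bool" where
  "flip_rule k R \<longleftrightarrow>
     (\<forall>H'\<in>graphs k. (\<forall>H\<in>graphs k. 0 \<le> R H' H \<and> R H' H \<le> 1) \<and> (\<Sum>H\<in>graphs k. R H' H) = 1)"

definition removal_rule :: "graph \<Rightarrow> rule" where
  "removal_rule F H' H = of_bool (H = (if F \<subseteq> H' then H' - F else H'))"

lemma finite_pairs [simp]: "finite (pairs n)"
  by (rule finite_subset[of _ "Pow {1..n}"]) (auto simp: pairs_def)

lemma finite_graphs [simp]: "finite (graphs n)"
  by (simp add: graphs_def)

lemma flip_rule_removal_rule: "flip_rule k (removal_rule F)"
proof -
  have "(\<Sum>H\<in>graphs k. removal_rule F H' H) = 1" if "H' \<in> graphs k" for H'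
  proof -
    have "(if F \<subseteq> H' then H' - F else H') \<in> graphs k"
      using that by (auto simp: graphs_def)
    then show ?thesis
      by (simp add: removal_rule_def of_bool_def sum.delta)
  qed
  then show ?thesis
    by (simp add: flip_rule_def removal_rule_def)
qed


section \<open>Flip processes on finite graphs\<close>

definition tuples :: "nat \<Rightarrow> nat \<Rightarrow> (nat \<Rightarrow> nat) set" where
  "tuples k n = {v \<in> {1..k} \<rightarrow>\<^sub>E {1..n}. inj_on v {1..k}}"

definition drawn_graph :: "nat \<Rightarrow> graph \<Rightarrow> (nat \<Rightarrow> nat) \<Rightarrow> graph" where
  "drawn_graph k G v = {e \<in> pairs k. v ` e \<in> G}"

definition replace_graph :: "nat \<Rightarrow> graph \<Rightarrow> (nat \<Rightarrow> nat) \<Rightarrow> graph \<Rightarrow> graph" where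
  "replace_graph k G v H = {e \<in> G. \<not> e \<subseteq> v ` {1..k}} \<union> (\<lambda>e. v ` e) ` H"

definition rule_row :: "nat \<Rightarrow> rule \<Rightarrow> graph \<Rightarrow> graph pmf" where
  "rule_row k R H' = embed_pmf (\<lambda>H. if H \<in> graphs k then R H' H else 0)"

lemma pmf_rule_row:
  assumes "flip_rule k R" and "H' \<in> graphs k"
  shows "pmf (rule_row k R H') H = (if H \<in> graphs k then R H' H else 0)"
proof -
  let ?f = "\<lambda>H. if H \<in> graphs k then R H' H else 0"
  have nn: "0 \<le> ?f H" for H
    using assms by (auto simp: flip_rule_def)
  have "(\<integral>\<^sup>+H. ennreal (?f H) \<partial>count_space UNIV) = (\<Sum>H\<in>graphs k. ennreal (?f H))"
    by (intro nn_integral_count_space') auto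
  also have "\<dots> = ennreal (\<Sum>H\<in>graphs k. ?f H)"
    by (rule sum_ennreal) (rule nn)
  also have "(\<Sum>H\<in>graphs k. ?f H) = 1"
    using assms by (simp add: flip_rule_def)
  finally show ?thesis
    unfolding rule_row_def using nn by (subst pmf_embed_pmf) auto
qed

definition flip_step :: "nat \<Rightarrow> rule \<Rightarrow> nat \<Rightarrow> graph \<Rightarrow> graph pmf" where
  "flip_step k R n G =
     do {
       v \<leftarrow> pmf_of_set (tuples k n);
       H \<leftarrow> rule_row k R (drawn_graph k G v);
       return_pmf (replace_graph k G v H)
     }"

text \<open>\<open>X\<close> is a realization, on the probability space \<open>P\<close>, of the flip process with rule \<open>R\<close>
  started at \<open>G\<close>: the Markov chain on graphs on \<open>[n]\<close> with initial state \<open>G\<close> and transition law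
  \<open>flip_step k R n\<close>, described by its finite-dimensional distributions.\<close>

definition flip_process ::
    "'w measure \<Rightarrow> nat \<Rightarrow> rule \<Rightarrow> nat \<Rightarrow> graph \<Rightarrow> (nat \<Rightarrow> 'w \<Rightarrow> graph) \<Rightarrow> bool" where
  "flip_process P k R n G X \<longleftrightarrow>
     prob_space P \<and>
     (\<forall>t. X t \<in> measurable P (count_space (graphs n))) \<and>
     (\<forall>t g. measure P {\<omega> \<in> space P. \<forall>i\<le>t. X i \<omega> = g i} =
        of_bool (g 0 = G) * (\<Prod>i<t. pmf (flip_step k R n (g i)) (g (Suc i))))"

text \<open>For a sequence of graphs that does not stabilize, the next value is irrelevant; for removal
  processes this happens with probability zero.\<close>

definition stabilization_time :: "(nat \<Rightarrow> graph) \<Rightarrow> nat" where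
  "stabilization_time g = (LEAST l. \<forall>m\<ge>l. g m = g l)"

definition final_graph :: "(nat \<Rightarrow> graph) \<Rightarrow> graph" where
  "final_graph g = g (stabilization_time g)"


section \<open>Kernels and graphons\<close>

definition atomless :: "'a measure \<Rightarrow> bool" where
  "atomless M \<longleftrightarrow>
     (\<forall>A\<in>sets M. 0 < measure M A \<longrightarrow>
        (\<exists>B\<in>sets M. B \<subseteq> A \<and> 0 < measure M B \<and> measure M B < measure M A))"

text \<open>Separability of the \<open>\<sigma>\<close>-algebra in the pseudometric
  \<open>(A, B) \<mapsto> measure M (sym_diff A B)\<close>. Every countably generated \<open>\<sigma>\<close>-algebra has it.\<close>

definition separable_sigma_algebra :: "'a measure \<Rightarrow> bool" where
  "separable_sigma_algebra M \<longleftrightarrow>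
     (\<exists>\<C>. countable \<C> \<and> \<C> \<subseteq> sets M \<and>
        (\<forall>A\<in>sets M. \<forall>e>0. \<exists>B\<in>\<C>. measure M (sym_diff A B) < e))"

text \<open>Kernels are represented by functions, and the identification up to null sets is made by the
  notions below: \<open>linf_norm\<close> and \<open>cut_dist\<close> do not distinguish between almost everywhere equal
  kernels.\<close>

type_synonym 'a kern = "'a \<Rightarrow> 'a \<Rightarrow> real"

definition kernel :: "'a measure \<Rightarrow> 'a kern \<Rightarrow> bool" where
  "kernel M W \<longleftrightarrow>
     (\<lambda>(x, y). W x y) \<in> borel_measurable (M \<Otimes>\<^sub>M M) \<and>
     (\<forall>x\<in>space M. \<forall>y\<in>space M. W x y = W y x) \<and>
     (\<exists>C. \<forall>x\<in>space M. \<forall>y\<in>space M. \<bar>W x y\<bar> \<le> C)"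

definition graphon :: "'a measure \<Rightarrow> 'a kern \<Rightarrow> bool" where
  "graphon M W \<longleftrightarrow> kernel M W \<and> (\<forall>x\<in>space M. \<forall>y\<in>space M. 0 \<le> W x y \<and> W x y \<le> 1)"

definition linf_norm :: "'a measure \<Rightarrow> 'a kern \<Rightarrow> ereal" where
  "linf_norm M W = esssup (M \<Otimes>\<^sub>M M) (\<lambda>(x, y). ereal \<bar>W x y\<bar>)"

definition cut_dist :: "'a measure \<Rightarrow> 'a kern \<Rightarrow> 'a kern \<Rightarrow> real" where
  "cut_dist M U W =
     (SUP (S, T) \<in> sets M \<times> sets M. \<bar>LINT (x, y) : S \<times> T | M \<Otimes>\<^sub>M M. U x y - W x y\<bar>)"

definition vertex_partition :: "'a measure \<Rightarrow> nat \<Rightarrow> (nat \<Rightarrow> 'a set) \<Rightarrow> bool" where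
  "vertex_partition M n \<Omega> \<longleftrightarrow>
     (\<forall>v\<in>{1..n}. \<Omega> v \<in> sets M \<and> measure M (\<Omega> v) = 1 / real n) \<and>
     disjoint_family_on \<Omega> {1..n} \<and> (\<Union>v\<in>{1..n}. \<Omega> v) = space M"

definition graph_kernel :: "(nat \<Rightarrow> 'a set) \<Rightarrow> graph \<Rightarrow> 'a kern" where
  "graph_kernel \<Omega> G x y = of_bool (\<exists>u v. {u, v} \<in> G \<and> x \<in> \<Omega> u \<and> y \<in> \<Omega> v)"


section \<open>Velocity, trajectories and destinations\<close>

definition t_ind :: "'a measure \<Rightarrow> nat \<Rightarrow> graph \<Rightarrow> nat \<Rightarrow> nat \<Rightarrow> 'a kern \<Rightarrow> 'a kern" where
  "t_ind M k H a b W x y =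
     (\<integral>z. (let z' = z(a := x, b := y) in
          (\<Prod>(i, j) \<in> {(i, j). 1 \<le> i \<and> i < j \<and> j \<le> k \<and> {i, j} \<in> H}. W (z' i) (z' j)) *
          (\<Prod>(i, j) \<in> {(i, j). 1 \<le> i \<and> i < j \<and> j \<le> k \<and> {i, j} \<notin> H}. 1 - W (z' i) (z' j)))
      \<partial>(Pi\<^sub>M ({1..k} - {a, b}) (\<lambda>_. M)))"

definition velocity :: "'a measure \<Rightarrow> nat \<Rightarrow> rule \<Rightarrow> 'a kern \<Rightarrow> 'a kern" where
  "velocity M k R W x y =
     (\<Sum>H'\<in>graphs k. \<Sum>H\<in>graphs k. \<Sum>(a, b) \<in> {(a, b). a \<in> {1..k} \<and> b \<in> {1..k} \<and> a \<noteq> b}.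
        R H' H * t_ind M k H' a b W x y *
        (of_bool ({a, b} \<in> H - H') - of_bool ({a, b} \<in> H' - H)))"

text \<open>\<open>\<Phi> t\<close> plays the role of \<open>\<Phi>\<^sup>t W\<close>; the derivative is taken in the \<open>L\<^sup>\<infinity>\<close> norm, one-sided
  at \<open>t = 0\<close>.\<close>

definition is_trajectory ::
    "'a measure \<Rightarrow> nat \<Rightarrow> rule \<Rightarrow> 'a kern \<Rightarrow> (real \<Rightarrow> 'a kern) \<Rightarrow> bool" where
  "is_trajectory M k R W \<Phi> \<longleftrightarrow>
     (\<forall>t\<ge>0. kernel M (\<Phi> t)) \<and>
     (AE (x, y) in M \<Otimes>\<^sub>M M. \<Phi> 0 x y = W x y) \<and>
     (\<forall>t\<ge>0. ((\<lambda>s. linf_norm M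
          (\<lambda>x y. (\<Phi> s x y - \<Phi> t x y) / (s - t) - velocity M k R (\<Phi> t) x y)) \<longlongrightarrow> 0)
        (at t within {0..}))"

definition is_destination ::
    "'a measure \<Rightarrow> nat \<Rightarrow> rule \<Rightarrow> 'a kern \<Rightarrow> 'a kern \<Rightarrow> bool" where
  "is_destination M k R W S \<longleftrightarrow>
     graphon M S \<and>
     (\<exists>\<Phi>. is_trajectory M k R W \<Phi> \<and> ((\<lambda>t. cut_dist M (\<Phi> t) S) \<longlongrightarrow> 0) at_top)"

text \<open>Destinations are unique up to null sets, and \<open>dest\<close> selects one representative.\<close>

definition dest :: "'a measure \<Rightarrow> nat \<Rightarrow> rule \<Rightarrow> 'a kern \<Rightarrow> 'a kern" where
  "dest M k R W = (SOME S. is_destination M k R W S)"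

end

theory Submission
  imports Defs
begin

text \<open>For the removal rule the velocity of a kernel at a pair is minus the rate at which copies of
  \<open>F\<close> cover that pair, and on kernels that are constant on the blocks \<open>\<Omega> u \<times> \<Omega> v\<close> the trajectory is an
  ordinary differential equation for an \<open>n \<times> n\<close> matrix.  One step of the process moves the adjacency
  matrix in expectation by about \<open>1/n\<^sup>2\<close> times the velocity.  The velocity is Lipschitz in the cut norm
  by the counting lemma, so exponential moments and a union bound over the \<open>4\<^sup>n\<close> rectangles show that
  the process at time \<open>T n\<^sup>2\<close> is close in cut norm to the flow at time \<open>T\<close>, for bounded \<open>T\<close>.

  The flow is decreasing and loses mass at a rate of at least the \<open>F\<close>-density, hence its \<open>F\<close>-density
  at time \<open>T\<close> is \<open>O(1/T)\<close>, uniformly in the graph; by cut-norm closeness the same holds for the process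
  at step \<open>T n\<^sup>2\<close>.  The removal lemma, applied to both, provides a set of pairs of small total weight that
  meets every copy of \<open>F\<close>.  Every copy removed later uses up weight on one of these pairs, so neither
  the flow nor the process loses much from then on.\<close>

section \<open>Counting in the cut norm\<close>

text \<open>The obstacle is the infinite horizon. Tracking errors grow exponentially: over a total
  time \<tau> an error is amplified by up to \<open>exp (mF * eF * \<tau>)\<close>, so the process
  can be followed only up to a time fixed before n. Beyond it, a decay of the density like 1/T does
  not suffice by itself, because 1/T is not integrable and a small rate could still destroy a
  positive fraction of the edges. The removal lemma turns small density into a bound on the whole
  remaining loss that does not involve time. Constants are therefore chosen in the order:
  \<epsilon>, the weight in the removal lemma, its threshold \<gamma>, the time 2/\<gamma>, the time
  step d, and finally n.

  During a block of about d n^2 steps the rate is frozen. A rectangle sum deviates by order n^2 only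
  with probability exp (-c n^2), which beats the number of rectangles however small c is.

  The destination is picked by a choice among limits of all trajectories in the L-infinity sense, so
  the matrix flow must be shown to be the only solution up to null sets. Its entries only decrease,
  hence converge, and their limits form the destination.\<close>

lemma sum_PiE_resample:
  fixes g :: "('i \<Rightarrow> 'v) \<Rightarrow> real"
  assumes "i \<in> I"
  shows "(\<Sum>\<phi>\<in>PiE I U. \<Sum>x\<in>U i. g (\<phi>(i := x))) = real (card (U i)) * (\<Sum>\<phi>\<in>PiE I U. g \<phi>)"
proof -
  \<comment> \<open>Exchanging the stored value with the fresh one is an involution of
    \<open>PiE I U \<times> U i\<close>, so overwriting a coordinate keeps the uniform
    distribution.\<close>
  let ?s = "\<lambda>(\<phi>, x). (\<phi>(i := x), \<phi> i)"
  have "(\<Sum>\<phi>\<in>PiE I U. \<Sum>x\<in>U i. g (\<phi>(i := x))) = (\<Sum>(\<phi>, x)\<in>PiE I U \<times> U i. g (\<phi>(i := x)))"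
    by (simp add: sum.cartesian_product)
  also have "\<dots> = (\<Sum>(\<phi>, x)\<in>PiE I U \<times> U i. g \<phi>)"
    by (rule sum.reindex_bij_witness[of _ ?s ?s])
       (use assms in \<open>auto simp: PiE_iff fun_upd_idem extensional_def\<close>)
  also have "\<dots> = (\<Sum>\<phi>\<in>PiE I U. \<Sum>x\<in>U i. g \<phi>)"
    by (rule sum.cartesian_product[symmetric])
  finally show ?thesis by (simp add: sum_distrib_left)
qed

lemma sum_PiE_resample2:
  fixes g :: "('i \<Rightarrow> 'v) \<Rightarrow> real"
  assumes "i \<in> I" "j \<in> I"
  shows "(\<Sum>\<phi>\<in>PiE I U. \<Sum>x\<in>U i. \<Sum>y\<in>U j. g (\<phi>(i := x, j := y))) =
    real (card (U i)) * real (card (U j)) * (\<Sum>\<phi>\<in>PiE I U. g \<phi>)"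
  using sum_PiE_resample[OF assms(1), where U = U and g = "\<lambda>\<psi>. \<Sum>y\<in>U j. g (\<psi>(j := y))"]
    sum_PiE_resample[OF assms(2), where U = U and g = g] by simp

text \<open>The cut norm without normalization: a density error \<kappa> between X and Y appears as
  \<kappa> times the product of their sizes. Stating a bound in place of a supremum lets errors be
  added and scaled directly.\<close>

definition cut_bound :: "'a set \<Rightarrow> 'b set \<Rightarrow> ('a \<Rightarrow> 'b \<Rightarrow> real) \<Rightarrow> real \<Rightarrow> bool" where
  "cut_bound X Y d K \<longleftrightarrow> (\<forall>A\<subseteq>X. \<forall>B\<subseteq>Y. \<bar>\<Sum>x\<in>A. \<Sum>y\<in>B. d x y\<bar> \<le> K)"

lemma sum_weighted_le:
  fixes f h :: "'a \<Rightarrow> real"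
  assumes "finite X" and f: "\<And>x. x \<in> X \<Longrightarrow> 0 \<le> f x \<and> f x \<le> 1"
  shows "(\<Sum>x\<in>X. f x * h x) \<le> (\<Sum>x\<in>{x\<in>X. h x > 0}. h x)"
proof -
  have "(\<Sum>x\<in>X. f x * h x) \<le> (\<Sum>x\<in>X. if h x > 0 then h x else 0)"
  proof (rule sum_mono)
    fix x assume "x \<in> X"
    then show "f x * h x \<le> (if h x > 0 then h x else 0)"
      using f[of x] mult_right_mono[of "f x" 1 "h x"] by (auto simp: mult_nonneg_nonpos)
  qed
  then show ?thesis using assms(1) by (simp add: sum.inter_filter)
qed

text \<open>A bilinear form on a product of cubes is largest at a vertex: with g fixed the form is
  linear in f and grows when f is rounded to the indicator of A; then g is rounded in the same
  way.\<close>

lemma cut_bound_weighted_upper: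
  assumes "finite X" "finite Y" and K: "cut_bound X Y d K"
    and f: "\<And>x. x \<in> X \<Longrightarrow> 0 \<le> f x \<and> f x \<le> 1" and g: "\<And>y. y \<in> Y \<Longrightarrow> 0 \<le> g y \<and> g y \<le> 1"
  shows "(\<Sum>x\<in>X. \<Sum>y\<in>Y. f x * g y * d x y) \<le> K"
proof -
  let ?h = "\<lambda>x. \<Sum>y\<in>Y. g y * d x y"
  define A where "A = {x\<in>X. ?h x > 0}"
  define B where "B = {y\<in>Y. (\<Sum>x\<in>A. d x y) > 0}"
  have "(\<Sum>x\<in>X. \<Sum>y\<in>Y. f x * g y * d x y) = (\<Sum>x\<in>X. f x * ?h x)"
    by (simp add: sum_distrib_left mult.assoc)
  also have "\<dots> \<le> (\<Sum>x\<in>A. ?h x)"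
    unfolding A_def by (rule sum_weighted_le) (use assms in auto)
  also have "\<dots> = (\<Sum>y\<in>Y. g y * (\<Sum>x\<in>A. d x y))"
    by (subst sum.swap) (simp add: sum_distrib_left)
  also have "\<dots> \<le> (\<Sum>y\<in>B. \<Sum>x\<in>A. d x y)"
    unfolding B_def by (rule sum_weighted_le) (use assms in auto)
  also have "\<dots> = (\<Sum>x\<in>A. \<Sum>y\<in>B. d x y)"
    by (rule sum.swap)
  also have "\<dots> \<le> K"
  proof -
    have "A \<subseteq> X" "B \<subseteq> Y" by (auto simp: A_def B_def)
    then show ?thesis using K unfolding cut_bound_def by (metis abs_le_D1)
  qed
  finally show ?thesis .
qed

lemma cut_bound_uminus: "cut_bound X Y (\<lambda>x y. - d x y) K = cut_bound X Y d K"
  by (simp add: cut_bound_def sum_negf)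

lemma cut_bound_weighted:
  assumes "finite X" "finite Y" and "cut_bound X Y d K"
    and "\<And>x. x \<in> X \<Longrightarrow> 0 \<le> f x \<and> f x \<le> 1" and "\<And>y. y \<in> Y \<Longrightarrow> 0 \<le> g y \<and> g y \<le> 1"
  shows "\<bar>\<Sum>x\<in>X. \<Sum>y\<in>Y. f x * g y * d x y\<bar> \<le> K"
  using cut_bound_weighted_upper[of X Y d K f g]
    cut_bound_weighted_upper[of X Y "\<lambda>x y. - d x y" K f g] assms
  by (simp add: cut_bound_uminus sum_negf)

lemma prod_in_unit:
  fixes f :: "'a \<Rightarrow> real"
  assumes "\<And>x. x \<in> A \<Longrightarrow> 0 \<le> f x \<and> f x \<le> 1"
  shows "0 \<le> prod f A \<and> prod f A \<le> 1"
  using assms by (auto intro: prod_nonneg prod_le_1)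

text \<open>With all coordinates but those of \<open>i\<close> and \<open>j\<close> fixed, no other factor depends on both, so the
  inner sum is a weighted sum of \<open>d\<close> against a product of two functions.\<close>

lemma edge_swap_bound:
  fixes r :: "'i \<times> 'i \<Rightarrow> 'v \<Rightarrow> 'v \<Rightarrow> real" and c :: "'i \<Rightarrow> 'v \<Rightarrow> real"
  assumes fin: "finite I" "\<And>i. i \<in> I \<Longrightarrow> finite (U i)"
    and ij: "i \<in> I" "j \<in> I" "i \<noteq> j"
    and R: "R \<subseteq> I \<times> I" "(i, j) \<notin> R" "(j, i) \<notin> R"
    and c: "\<And>l x. l \<in> I \<Longrightarrow> x \<in> U l \<Longrightarrow> 0 \<le> c l x \<and> c l x \<le> 1"
    and r: "\<And>a b x y. (a, b) \<in> R \<Longrightarrow> x \<in> U a \<Longrightarrow> y \<in> U b \<Longrightarrow> 0 \<le> r (a, b) x y \<and> r (a, b) x y \<le> 1"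
    and d: "cut_bound (U i) (U j) d (\<kappa> * real (card (U i)) * real (card (U j)))"
  shows "\<bar>\<Sum>\<phi>\<in>PiE I U. (\<Prod>l\<in>I. c l (\<phi> l)) * (\<Prod>e\<in>R. r e (\<phi> (fst e)) (\<phi> (snd e))) * d (\<phi> i) (\<phi> j)\<bar>
     \<le> \<kappa> * (\<Prod>l\<in>I. real (card (U l)))"
proof (cases "PiE I U = {}")
  case True
  then obtain l where "l \<in> I" "U l = {}" by (auto simp: PiE_eq_empty_iff)
  then have "(\<Prod>l\<in>I. real (card (U l))) = 0" using fin by auto
  then show ?thesis using True by simp
next
  case False
  then have ne: "\<And>l. l \<in> I \<Longrightarrow> U l \<noteq> {}" by (auto simp: PiE_eq_empty_iff)
  define G where "G \<phi> = (\<Prod>l\<in>I. c l (\<phi> l)) * (\<Prod>e\<in>R. r e (\<phi> (fst e)) (\<phi> (snd e))) * d (\<phi> i) (\<phi> j)" for \<phi>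
  have finR: "finite R" using R fin by (meson finite_SigmaI finite_subset)
  define K where "K = \<kappa> * real (card (U i)) * real (card (U j))"
  have inner: "\<bar>\<Sum>x\<in>U i. \<Sum>y\<in>U j. G (\<phi>(i := x, j := y))\<bar> \<le> K" if \<phi>: "\<phi> \<in> PiE I U" for \<phi>
  proof -
    \<comment> \<open>R contains neither orientation of the pair ij. Factors touching i therefore
      see x but not y, and the remaining factors do not see x; f and g collect the two
      groups.\<close>
    define R1 where "R1 = {e\<in>R. fst e = i \<or> snd e = i}"
    define R2 where "R2 = R - R1"
    define f where "f x = c i x * (\<Prod>e\<in>R1. r e ((\<phi>(i := x)) (fst e)) ((\<phi>(i := x)) (snd e)))" for x
    define g where "g y = (\<Prod>l\<in>I - {i}. c l ((\<phi>(j := y)) l)) *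
        (\<Prod>e\<in>R2. r e ((\<phi>(j := y)) (fst e)) ((\<phi>(j := y)) (snd e)))" for y
    have G_eq: "G (\<phi>(i := x, j := y)) = f x * g y * d x y" for x y
    proof -
      have "(\<Prod>l\<in>I. c l ((\<phi>(i := x, j := y)) l)) = c i x * (\<Prod>l\<in>I - {i}. c l ((\<phi>(j := y)) l))"
      proof -
        have "(\<Prod>l\<in>I - {i}. c l ((\<phi>(i := x, j := y)) l)) = (\<Prod>l\<in>I - {i}. c l ((\<phi>(j := y)) l))"
          by (rule prod.cong) auto
        then show ?thesis using ij fin by (simp add: prod.remove[of I i])
      qed
      moreover have "(\<Prod>e\<in>R. r e ((\<phi>(i := x, j := y)) (fst e)) ((\<phi>(i := x, j := y)) (snd e))) =
         (\<Prod>e\<in>R1. r e ((\<phi>(i := x)) (fst e)) ((\<phi>(i := x)) (snd e))) *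
         (\<Prod>e\<in>R2. r e ((\<phi>(j := y)) (fst e)) ((\<phi>(j := y)) (snd e)))"
      proof -
        have "R = R1 \<union> R2" "R1 \<inter> R2 = {}" "finite R1" "finite R2"
          using finR by (auto simp: R1_def R2_def)
        moreover have "(\<Prod>e\<in>R1. r e ((\<phi>(i := x, j := y)) (fst e)) ((\<phi>(i := x, j := y)) (snd e))) =
          (\<Prod>e\<in>R1. r e ((\<phi>(i := x)) (fst e)) ((\<phi>(i := x)) (snd e)))"
          by (rule prod.cong) (use R ij in \<open>auto simp: R1_def\<close>)
        moreover have "(\<Prod>e\<in>R2. r e ((\<phi>(i := x, j := y)) (fst e)) ((\<phi>(i := x, j := y)) (snd e))) =
          (\<Prod>e\<in>R2. r e ((\<phi>(j := y)) (fst e)) ((\<phi>(j := y)) (snd e)))"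
          by (rule prod.cong) (use R ij in \<open>auto simp: R1_def R2_def\<close>)
        ultimately show ?thesis by (simp add: prod.union_disjoint)
      qed
      ultimately show ?thesis using ij by (simp add: G_def f_def g_def)
    qed
    have upd: "\<phi>(l := x) \<in> PiE I U" if "l \<in> I" "x \<in> U l" for l x
      using that \<phi> by (auto simp: PiE_iff extensional_def)
    have r': "0 \<le> r e (\<psi> (fst e)) (\<psi> (snd e)) \<and> r e (\<psi> (fst e)) (\<psi> (snd e)) \<le> 1"
      if "e \<in> R" "\<psi> \<in> PiE I U" for e \<psi>
      using that R r[of "fst e" "snd e" "\<psi> (fst e)" "\<psi> (snd e)"] by (auto simp: PiE_iff)
    have f01: "0 \<le> f x \<and> f x \<le> 1" if "x \<in> U i" for x
    proof -
      have "0 \<le> (\<Prod>e\<in>R1. r e ((\<phi>(i := x)) (fst e)) ((\<phi>(i := x)) (snd e))) \<and>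
         (\<Prod>e\<in>R1. r e ((\<phi>(i := x)) (fst e)) ((\<phi>(i := x)) (snd e))) \<le> 1"
        by (rule prod_in_unit) (use r'[OF _ upd[OF ij(1) that]] in \<open>auto simp: R1_def\<close>)
      then show ?thesis unfolding f_def using c[OF ij(1) that] by (auto intro: mult_le_one)
    qed
    have g01: "0 \<le> g y \<and> g y \<le> 1" if "y \<in> U j" for y
    proof -
      have "0 \<le> (\<Prod>e\<in>R2. r e ((\<phi>(j := y)) (fst e)) ((\<phi>(j := y)) (snd e))) \<and>
         (\<Prod>e\<in>R2. r e ((\<phi>(j := y)) (fst e)) ((\<phi>(j := y)) (snd e))) \<le> 1"
        by (rule prod_in_unit) (use r'[OF _ upd[OF ij(2) that]] in \<open>auto simp: R2_def\<close>)
      moreover have "0 \<le> (\<Prod>l\<in>I - {i}. c l ((\<phi>(j := y)) l)) \<and> (\<Prod>l\<in>I - {i}. c l ((\<phi>(j := y)) l)) \<le> 1"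
        by (rule prod_in_unit) (use c upd[OF ij(2) that] in \<open>auto simp: PiE_iff\<close>)
      ultimately show ?thesis unfolding g_def by (auto intro: mult_le_one)
    qed
    show ?thesis unfolding G_eq K_def
      by (rule cut_bound_weighted) (use d f01 g01 ij fin in auto)
  qed
  \<comment> \<open>Resampling coordinates i and j multiplies the sum by the sizes of the two parts;
    these factors cancel against those in the cut bound.\<close>
  have "real (card (U i)) * real (card (U j)) * \<bar>\<Sum>\<phi>\<in>PiE I U. G \<phi>\<bar> =
      \<bar>\<Sum>\<phi>\<in>PiE I U. \<Sum>x\<in>U i. \<Sum>y\<in>U j. G (\<phi>(i := x, j := y))\<bar>"
    by (simp only: sum_PiE_resample2[OF ij(1,2)] abs_mult abs_of_nat)
  also have "\<dots> \<le> (\<Sum>\<phi>\<in>PiE I U. K)"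
    by (rule order.trans[OF sum_abs sum_mono]) (rule inner)
  also have "\<dots> = real (card (U i)) * real (card (U j)) * (\<kappa> * (\<Prod>l\<in>I. real (card (U l))))"
    using fin by (simp add: K_def card_PiE)
  finally have "\<bar>\<Sum>\<phi>\<in>PiE I U. G \<phi>\<bar> \<le> \<kappa> * (\<Prod>l\<in>I. real (card (U l)))"
    by (rule mult_left_le_imp_le) (use ij ne fin in \<open>auto simp: card_gt_0_iff\<close>)
  then show ?thesis by (simp add: G_def)
qed

text \<open>Telescoping over the edges. The induction needs a statement in which some edges already
  carry other weights: E' with weights q holds the edges switched to w', and E those still to be
  switched. Taking e out of E leaves one term in which only e differs, handled by
  \<open>edge_swap_bound\<close>, and one in which e has moved to E'.\<close>

lemma counting_lemma_aux:
  fixes w w' q :: "'i \<times> 'i \<Rightarrow> 'v \<Rightarrow> 'v \<Rightarrow> real" and c :: "'i \<Rightarrow> 'v \<Rightarrow> real"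
  assumes fin: "finite I" "\<And>i. i \<in> I \<Longrightarrow> finite (U i)"
    and "finite E" "finite E'" "E \<subseteq> I \<times> I" "E' \<subseteq> I \<times> I" "E \<inter> E' = {}"
    and asym: "\<And>i j. (i, j) \<in> E \<union> E' \<Longrightarrow> i \<noteq> j \<and> (j, i) \<notin> E \<union> E'"
    and c: "\<And>l x. l \<in> I \<Longrightarrow> x \<in> U l \<Longrightarrow> 0 \<le> c l x \<and> c l x \<le> 1"
    and w: "\<And>i j x y. (i, j) \<in> E \<Longrightarrow> x \<in> U i \<Longrightarrow> y \<in> U j \<Longrightarrow> 0 \<le> w (i, j) x y \<and> w (i, j) x y \<le> 1"
    and w': "\<And>i j x y. (i, j) \<in> E \<Longrightarrow> x \<in> U i \<Longrightarrow> y \<in> U j \<Longrightarrow> 0 \<le> w' (i, j) x y \<and> w' (i, j) x y \<le> 1"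
    and q: "\<And>i j x y. (i, j) \<in> E' \<Longrightarrow> x \<in> U i \<Longrightarrow> y \<in> U j \<Longrightarrow> 0 \<le> q (i, j) x y \<and> q (i, j) x y \<le> 1"
    and cut: "\<And>i j. (i, j) \<in> E \<Longrightarrow>
      cut_bound (U i) (U j) (\<lambda>x y. w (i, j) x y - w' (i, j) x y) (\<kappa> * real (card (U i)) * real (card (U j)))"
  shows "\<bar>\<Sum>\<phi>\<in>PiE I U. (\<Prod>l\<in>I. c l (\<phi> l)) * (\<Prod>e\<in>E'. q e (\<phi> (fst e)) (\<phi> (snd e))) *
      ((\<Prod>e\<in>E. w e (\<phi> (fst e)) (\<phi> (snd e))) - (\<Prod>e\<in>E. w' e (\<phi> (fst e)) (\<phi> (snd e))))\<bar>
     \<le> real (card E) * \<kappa> * (\<Prod>l\<in>I. real (card (U l)))"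
  using assms(3-)
proof (induction E arbitrary: E' q rule: finite_induct)
  case empty
  then show ?case by simp
next
  case (insert e E)
  obtain i j where e: "e = (i, j)" by (cases e)
  have ij: "i \<in> I" "j \<in> I" "i \<noteq> j" "(i, j) \<notin> E \<union> E'" "(j, i) \<notin> E \<union> E'"
    using insert.prems(2) insert.prems(4) insert.prems(5)[of i j] insert.hyps(2) e by auto
  define C where "C \<phi> = (\<Prod>l\<in>I. c l (\<phi> l))" for \<phi>
  define ev where "ev a \<phi> x = a x (\<phi> (fst x)) (\<phi> (snd x))"
    for a :: "'i \<times> 'i \<Rightarrow> 'v \<Rightarrow> 'v \<Rightarrow> real" and \<phi> x
  \<comment> \<open>Weights of the other edges while e itself is switched: those not yet switched
    keep w.\<close>
  define r where "r x = (if x \<in> E then w x else q x)" for x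
  have 1: "\<bar>\<Sum>\<phi>\<in>PiE I U. C \<phi> * (\<Prod>x\<in>E \<union> E'. ev r \<phi> x) * (w e (\<phi> i) (\<phi> j) - w' e (\<phi> i) (\<phi> j))\<bar>
      \<le> \<kappa> * (\<Prod>l\<in>I. real (card (U l)))"
    unfolding C_def ev_def
  proof (rule edge_swap_bound[OF fin ij(1-3)], goal_cases)
    case 2
    then show ?case using insert.prems(2,3) by auto
  next
    case (5 l x)
    then show ?case by (rule insert.prems(6))
  next
    case (6 a b x y)
    then show ?case using insert.prems(7)[of a b x y] insert.prems(9)[of a b x y] by (auto simp: r_def)
  next
    case 7
    then show ?case using insert.prems(10)[of i j] by (simp add: e)
  qed (use ij in auto)
  have 2: "\<bar>\<Sum>\<phi>\<in>PiE I U. C \<phi> * (\<Prod>x\<in>insert e E'. ev (q(e := w' e)) \<phi> x) *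
      ((\<Prod>x\<in>E. ev w \<phi> x) - (\<Prod>x\<in>E. ev w' \<phi> x))\<bar> \<le> real (card E) * \<kappa> * (\<Prod>l\<in>I. real (card (U l)))"
    unfolding C_def ev_def
  proof (rule insert.IH, goal_cases)
    case (5 a b)
    then show ?case using insert.prems(5)[of a b] insert.prems(5)[of b a] e by auto
  next
    case (6 l x)
    then show ?case by (rule insert.prems(6))
  next
    case (7 a b x y)
    then show ?case using insert.prems(7)[of a b x y] by auto
  next
    case (8 a b x y)
    then show ?case using insert.prems(8)[of a b x y] by auto
  next
    case (10 a b)
    then show ?case using insert.prems(10)[of a b] by auto
  next
    case (9 a b x y)
    then show ?case using insert.prems(8)[of i j x y] insert.prems(9)[of a b x y] e by auto
  qed (use insert.prems(1-4) insert.hyps in \<open>auto simp: e\<close>)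
  have split: "C \<phi> * (\<Prod>x\<in>E'. ev q \<phi> x) * ((\<Prod>x\<in>insert e E. ev w \<phi> x) - (\<Prod>x\<in>insert e E. ev w' \<phi> x)) =
     C \<phi> * (\<Prod>x\<in>E \<union> E'. ev r \<phi> x) * (w e (\<phi> i) (\<phi> j) - w' e (\<phi> i) (\<phi> j)) +
     C \<phi> * (\<Prod>x\<in>insert e E'. ev (q(e := w' e)) \<phi> x) * ((\<Prod>x\<in>E. ev w \<phi> x) - (\<Prod>x\<in>E. ev w' \<phi> x))" for \<phi>
  proof -
    have "(\<Prod>x\<in>E \<union> E'. ev r \<phi> x) = (\<Prod>x\<in>E. ev r \<phi> x) * (\<Prod>x\<in>E'. ev r \<phi> x)"
      using insert.hyps(1) insert.prems(1,4) by (intro prod.union_disjoint) auto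
    also have "(\<Prod>x\<in>E. ev r \<phi> x) = (\<Prod>x\<in>E. ev w \<phi> x)"
      by (rule prod.cong) (auto simp: r_def ev_def)
    also have "(\<Prod>x\<in>E'. ev r \<phi> x) = (\<Prod>x\<in>E'. ev q \<phi> x)"
      by (rule prod.cong) (use insert.prems(4) in \<open>auto simp: r_def ev_def\<close>)
    finally have a: "(\<Prod>x\<in>E \<union> E'. ev r \<phi> x) = (\<Prod>x\<in>E. ev w \<phi> x) * (\<Prod>x\<in>E'. ev q \<phi> x)" .
    have "e \<notin> E'" using insert.prems(4) by auto
    then have "(\<Prod>x\<in>insert e E'. ev (q(e := w' e)) \<phi> x) = w' e (\<phi> i) (\<phi> j) * (\<Prod>x\<in>E'. ev (q(e := w' e)) \<phi> x)"
      using insert.prems(1) by (simp add: ev_def e)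
    also have "(\<Prod>x\<in>E'. ev (q(e := w' e)) \<phi> x) = (\<Prod>x\<in>E'. ev q \<phi> x)"
      by (rule prod.cong) (use \<open>e \<notin> E'\<close> in \<open>auto simp: ev_def\<close>)
    finally have b: "(\<Prod>x\<in>insert e E'. ev (q(e := w' e)) \<phi> x) = w' e (\<phi> i) (\<phi> j) * (\<Prod>x\<in>E'. ev q \<phi> x)" .
    have "(\<Prod>x\<in>insert e E. ev a \<phi> x) = a e (\<phi> i) (\<phi> j) * (\<Prod>x\<in>E. ev a \<phi> x)" for a
      using insert.hyps by (simp add: ev_def e)
    then show ?thesis unfolding a b by (simp add: algebra_simps)
  qed
  have "\<bar>\<Sum>\<phi>\<in>PiE I U. C \<phi> * (\<Prod>x\<in>E'. ev q \<phi> x) * ((\<Prod>x\<in>insert e E. ev w \<phi> x) - (\<Prod>x\<in>insert e E. ev w' \<phi> x))\<bar>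
     \<le> \<kappa> * (\<Prod>l\<in>I. real (card (U l))) + real (card E) * \<kappa> * (\<Prod>l\<in>I. real (card (U l)))"
    unfolding split sum.distrib using 1 2 by linarith
  then show ?case using insert.hyps by (simp add: C_def ev_def algebra_simps)
qed

text \<open>Separate parts and a separate matrix for each edge serve the removal lemma, where w is
  compared with the constant density of each pair. The vertex weights c serve the Lipschitz bound
  for rates, where they confine two coordinates to a rectangle.\<close>

lemma counting_lemma:
  fixes w w' :: "'i \<times> 'i \<Rightarrow> 'v \<Rightarrow> 'v \<Rightarrow> real" and c :: "'i \<Rightarrow> 'v \<Rightarrow> real"
  assumes "finite I" "\<And>i. i \<in> I \<Longrightarrow> finite (U i)" "E \<subseteq> I \<times> I"
    and "\<And>i j. (i, j) \<in> E \<Longrightarrow> i \<noteq> j \<and> (j, i) \<notin> E"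
    and "\<And>l x. l \<in> I \<Longrightarrow> x \<in> U l \<Longrightarrow> 0 \<le> c l x \<and> c l x \<le> 1"
    and "\<And>i j x y. (i, j) \<in> E \<Longrightarrow> x \<in> U i \<Longrightarrow> y \<in> U j \<Longrightarrow> 0 \<le> w (i, j) x y \<and> w (i, j) x y \<le> 1"
    and "\<And>i j x y. (i, j) \<in> E \<Longrightarrow> x \<in> U i \<Longrightarrow> y \<in> U j \<Longrightarrow> 0 \<le> w' (i, j) x y \<and> w' (i, j) x y \<le> 1"
    and "\<And>i j. (i, j) \<in> E \<Longrightarrow>
      cut_bound (U i) (U j) (\<lambda>x y. w (i, j) x y - w' (i, j) x y) (\<kappa> * real (card (U i)) * real (card (U j)))"
  shows "\<bar>\<Sum>\<phi>\<in>PiE I U. (\<Prod>l\<in>I. c l (\<phi> l)) *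
      ((\<Prod>e\<in>E. w e (\<phi> (fst e)) (\<phi> (snd e))) - (\<Prod>e\<in>E. w' e (\<phi> (fst e)) (\<phi> (snd e))))\<bar>
     \<le> real (card E) * \<kappa> * (\<Prod>l\<in>I. real (card (U l)))"
proof -
  have "finite E" using assms by (meson finite_SigmaI finite_subset)
  then show ?thesis
    using counting_lemma_aux[of I U E "{}" c w w' _ \<kappa>] assms by simp
qed

section \<open>Regularity and the weighted removal lemma\<close>

text \<open>Conditional expectation of f for the partition of Z into the fibres of C.\<close>

definition block_avg :: "'a set \<Rightarrow> ('a \<Rightarrow> 'c) \<Rightarrow> ('a \<Rightarrow> real) \<Rightarrow> 'a \<Rightarrow> real" where
  "block_avg Z C f z = (\<Sum>z'\<in>{z'\<in>Z. C z' = C z}. f z') / real (card {z'\<in>Z. C z' = C z})"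

text \<open>The characteristic property of conditional expectations. Once the two sums are
  exchanged, each value of f is spread over its class and divided by the class size, and h does not
  notice.\<close>

lemma sum_block_avg:
  assumes "finite Z" and h: "\<And>z z'. z \<in> Z \<Longrightarrow> z' \<in> Z \<Longrightarrow> C z = C z' \<Longrightarrow> h z = h z'"
  shows "(\<Sum>z\<in>Z. block_avg Z C f z * h z) = (\<Sum>z\<in>Z. f z * h z)"
proof -
  let ?B = "\<lambda>z. {z'\<in>Z. C z' = C z}"
  have "(\<Sum>z\<in>Z. block_avg Z C f z * h z) =
      (\<Sum>z\<in>Z. \<Sum>z'\<in>Z. if C z' = C z then f z' * h z / real (card (?B z)) else 0)"
    using assms(1)
    by (intro sum.cong) (auto simp: block_avg_def sum_distrib_right sum_divide_distrib sum.inter_filter[symmetric])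
  also have "\<dots> = (\<Sum>z'\<in>Z. \<Sum>z\<in>Z. if C z' = C z then f z' * h z / real (card (?B z)) else 0)"
    by (rule sum.swap)
  also have "\<dots> = (\<Sum>z'\<in>Z. f z' * h z')"
  proof (rule sum.cong[OF refl])
    fix z' assume z': "z' \<in> Z"
    have "(\<Sum>z\<in>Z. if C z' = C z then f z' * h z / real (card (?B z)) else 0) =
        (\<Sum>z\<in>Z. if C z = C z' then f z' * h z' / real (card (?B z')) else 0)"
      using h[OF z'] by (intro sum.cong) auto
    also have "\<dots> = (\<Sum>z\<in>?B z'. f z' * h z' / real (card (?B z')))"
      by (rule sum.inter_filter[OF assms(1), symmetric])
    also have "\<dots> = f z' * h z'"
    proof -
      have "card (?B z') > 0" using z' assms(1) by (subst card_gt_0_iff) auto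
      then show ?thesis by (simp only: sum_constant) simp
    qed
    finally show "(\<Sum>z\<in>Z. if C z' = C z then f z' * h z / real (card (?B z)) else 0) = f z' * h z'" .
  qed
  finally show ?thesis .
qed

lemma block_avg_cong: "C z = C z' \<Longrightarrow> block_avg Z C f z = block_avg Z C f z'"
  by (simp add: block_avg_def)

text \<open>Pythagoras: the finer average minus the coarser one is orthogonal to every function that
  is constant on the coarser classes.\<close>

lemma energy_refine:
  assumes "finite Z" and ref: "\<And>z z'. z \<in> Z \<Longrightarrow> z' \<in> Z \<Longrightarrow> C' z = C' z' \<Longrightarrow> C z = C z'"
  shows "(\<Sum>z\<in>Z. (block_avg Z C' f z)\<^sup>2) =
    (\<Sum>z\<in>Z. (block_avg Z C f z)\<^sup>2) + (\<Sum>z\<in>Z. (block_avg Z C' f z - block_avg Z C f z)\<^sup>2)"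
proof -
  have "(\<Sum>z\<in>Z. block_avg Z C' f z * block_avg Z C f z) = (\<Sum>z\<in>Z. f z * block_avg Z C f z)"
    by (rule sum_block_avg[OF assms(1)]) (rule block_avg_cong, rule ref)
  also have "\<dots> = (\<Sum>z\<in>Z. block_avg Z C f z * block_avg Z C f z)"
    by (rule sum_block_avg[OF assms(1), symmetric]) (rule block_avg_cong)
  finally have "(\<Sum>z\<in>Z. block_avg Z C' f z * block_avg Z C f z) = (\<Sum>z\<in>Z. (block_avg Z C f z)\<^sup>2)"
    by (simp add: power2_eq_square)
  moreover have "(\<Sum>z\<in>Z. (block_avg Z C' f z - block_avg Z C f z)\<^sup>2) =
     (\<Sum>z\<in>Z. (block_avg Z C' f z)\<^sup>2) + (\<Sum>z\<in>Z. (block_avg Z C f z)\<^sup>2) -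
     2 * (\<Sum>z\<in>Z. block_avg Z C' f z * block_avg Z C f z)"
    by (simp add: power2_diff sum.distrib sum_subtractf sum_distrib_left mult.assoc)
  ultimately show ?thesis by simp
qed

lemma block_avg_in_unit:
  assumes "finite Z" "\<And>z. z \<in> Z \<Longrightarrow> 0 \<le> f z \<and> f z \<le> 1"
  shows "0 \<le> block_avg Z C f z \<and> block_avg Z C f z \<le> 1"
proof -
  have "(\<Sum>z'\<in>{z'\<in>Z. C z' = C z}. f z') \<le> (\<Sum>z'\<in>{z'\<in>Z. C z' = C z}. 1)"
    using assms by (intro sum_mono) auto
  moreover have "0 \<le> (\<Sum>z'\<in>{z'\<in>Z. C z' = C z}. f z')"
    using assms by (intro sum_nonneg) auto
  ultimately show ?thesis by (auto simp: block_avg_def divide_simps)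
qed

section \<open>Regular pairs and the energy increment\<close>

definition color_class :: "'v set \<Rightarrow> ('v \<Rightarrow> 'c) \<Rightarrow> 'c \<Rightarrow> 'v set" where
  "color_class V c i = {x\<in>V. c x = i}"

definition pair_density :: "('v \<Rightarrow> 'v \<Rightarrow> real) \<Rightarrow> 'v set \<Rightarrow> 'v set \<Rightarrow> real" where
  "pair_density w X Y = (\<Sum>x\<in>X. \<Sum>y\<in>Y. w x y) / (real (card X) * real (card Y))"

text \<open>Deviations are measured relative to the whole pair instead of the subsets, the form in
  which the counting lemma takes them.\<close>

definition regular_pair :: "real \<Rightarrow> ('v \<Rightarrow> 'v \<Rightarrow> real) \<Rightarrow> 'v set \<Rightarrow> 'v set \<Rightarrow> bool" where
  "regular_pair \<epsilon> w X Y \<longleftrightarrow>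
     cut_bound X Y (\<lambda>x y. w x y - pair_density w X Y) (\<epsilon> * real (card X) * real (card Y))"

text \<open>Irregularity is counted in pairs of vertices rather than pairs of classes, which weights
  classes of unequal sizes correctly.\<close>

definition irregular_points :: "real \<Rightarrow> 'v set \<Rightarrow> ('v \<Rightarrow> 'v \<Rightarrow> real) \<Rightarrow> ('v \<Rightarrow> 'c) \<Rightarrow> ('v \<times> 'v) set" where
  "irregular_points \<epsilon> V w c =
     {(x, y) \<in> V \<times> V. \<not> regular_pair \<epsilon> w (color_class V c (c x)) (color_class V c (c y))}"

lemma block_avg_pair:
  "block_avg (V \<times> V) (map_prod c c) (\<lambda>(x, y). w x y) (x, y) =
     pair_density w (color_class V c (c x)) (color_class V c (c y))"
proof -
  have "{z'\<in>V \<times> V. map_prod c c z' = map_prod c c (x, y)} =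
      color_class V c (c x) \<times> color_class V c (c y)"
    by (auto simp: color_class_def)
  then show ?thesis
    by (simp add: block_avg_def pair_density_def sum.cartesian_product card_cartesian_product)
qed

text \<open>The index of Szemeredi's argument without normalization; for entries in [0, 1] it lies
  between 0 and the square of \<open>card V\<close>.\<close>

definition energy :: "'v set \<Rightarrow> ('v \<Rightarrow> 'v \<Rightarrow> real) \<Rightarrow> ('v \<Rightarrow> 'c) \<Rightarrow> real" where
  "energy V w c = (\<Sum>z\<in>V \<times> V. (block_avg (V \<times> V) (map_prod c c) (\<lambda>(x, y). w x y) z)\<^sup>2)"

lemma energy_le:
  assumes "finite V" "\<forall>x\<in>V. \<forall>y\<in>V. 0 \<le> w x y \<and> w x y \<le> 1"
  shows "energy V w c \<le> (real (card V))\<^sup>2"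
proof -
  have "energy V w c \<le> (\<Sum>z\<in>V \<times> V. 1)"
    unfolding energy_def
  proof (rule sum_mono)
    fix z
    have "0 \<le> block_avg (V \<times> V) (map_prod c c) (\<lambda>(x, y). w x y) z \<and>
        block_avg (V \<times> V) (map_prod c c) (\<lambda>(x, y). w x y) z \<le> 1"
      by (rule block_avg_in_unit) (use assms in auto)
    then show "(block_avg (V \<times> V) (map_prod c c) (\<lambda>(x, y). w x y) z)\<^sup>2 \<le> 1"
      by (auto simp: power_le_one)
  qed
  then show ?thesis by (simp add: card_cartesian_product power2_eq_square)
qed

text \<open>Every irregular pair of classes has witness sets. Splitting all classes along all
  witnesses makes each witness rectangle a union of new blocks. Cauchy-Schwarz on that rectangle
  gains \<epsilon>^2 times the size of the pair, and the irregular pairs have total size above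
  \<epsilon> times the square of \<open>card V\<close>. The number N of new colours depends on M
  alone.\<close>

lemma energy_increment:
  fixes c :: "'v \<Rightarrow> nat" and w :: "'v \<Rightarrow> 'v \<Rightarrow> real" and \<epsilon> :: real and M :: nat
  defines "N \<equiv> card ({..<M} \<times> Pow ({..<M} \<times> {..<M}) \<times> Pow ({..<M} \<times> {..<M}))"
  assumes V: "finite V" and c: "c ` V \<subseteq> {..<M}" and \<epsilon>: "\<epsilon> > 0"
    and irr: "real (card (irregular_points \<epsilon> V w c)) > \<epsilon> * (real (card V))\<^sup>2"
  shows "\<exists>c' :: 'v \<Rightarrow> nat. c' ` V \<subseteq> {..<N} \<and>
     energy V w c' \<ge>
     energy V w c + \<epsilon> ^ 3 * (real (card V))\<^sup>2"
proof -
  let ?cl = "color_class V c"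
  let ?f = "\<lambda>(x, y). w x y"
  define irreg where "irreg i j = (\<not> regular_pair \<epsilon> w (?cl i) (?cl j))" for i j
  let ?d = "\<lambda>i j. pair_density w (?cl i) (?cl j)"
  have "\<exists>A B. irreg i j \<longrightarrow> A \<subseteq> ?cl i \<and> B \<subseteq> ?cl j \<and>
      \<bar>\<Sum>x\<in>A. \<Sum>y\<in>B. w x y - ?d i j\<bar> > \<epsilon> * real (card (?cl i)) * real (card (?cl j))" for i j
    unfolding irreg_def regular_pair_def cut_bound_def by (metis linorder_not_le)
  then obtain A B where AB: "\<And>i j. irreg i j \<Longrightarrow> A i j \<subseteq> ?cl i"
    "\<And>i j. irreg i j \<Longrightarrow> B i j \<subseteq> ?cl j"
    "\<And>i j. irreg i j \<Longrightarrow> \<bar>\<Sum>x\<in>A i j. \<Sum>y\<in>B i j. w x y - ?d i j\<bar> > \<epsilon> * real (card (?cl i)) * real (card (?cl j))"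
    by metis
  define D where "D = {..<M} \<times> Pow ({..<M} \<times> {..<M}) \<times> Pow ({..<M} \<times> {..<M})"
  \<comment> \<open>The refined colours are encoded as natural numbers below N, so that the
    refinement can be iterated at one type.\<close>
  have "finite D" by (simp add: D_def)
  then obtain enc where enc: "bij_betw enc D {0..<N}"
    unfolding N_def D_def using ex_bij_betw_finite_nat by blast
  define c1 where "c1 x = (c x, {(i, j) \<in> {..<M} \<times> {..<M}. x \<in> A i j}, {(i, j) \<in> {..<M} \<times> {..<M}. x \<in> B i j})" for x
  define c' where "c' x = enc (c1 x)" for x
  have c1D: "c1 x \<in> D" if "x \<in> V" for x using c that by (auto simp: c1_def D_def)
  have c'_N: "c' ` V \<subseteq> {..<N}"
    using enc c1D by (auto simp: c'_def bij_betw_def)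
  have c'_eq: "c1 x = c1 y" if "x \<in> V" "y \<in> V" "c' x = c' y" for x y
    using that enc c1D by (auto simp: c'_def bij_betw_def inj_on_def)
  define g where "g z = block_avg (V \<times> V) (map_prod c' c') ?f z - block_avg (V \<times> V) (map_prod c c) ?f z" for z
  have fin: "finite (V \<times> V)" using V by simp
  have en: "energy V w c' =
     energy V w c + (\<Sum>z\<in>V \<times> V. (g z)\<^sup>2)"
    unfolding g_def energy_def
  proof (rule energy_refine[OF fin])
    fix z z' assume "z \<in> V \<times> V" "z' \<in> V \<times> V" "map_prod c' c' z = map_prod c' c' z'"
    then have "c1 (fst z) = c1 (fst z')" "c1 (snd z) = c1 (snd z')"
      by (auto intro!: c'_eq)
    then show "map_prod c c z = map_prod c c z'"
      by (cases z; cases z') (simp add: c1_def)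
  qed
  have blk: "(\<Sum>z\<in>?cl i \<times> ?cl j. (g z)\<^sup>2) \<ge> \<epsilon>\<^sup>2 * (real (card (?cl i)) * real (card (?cl j)))"
    if ij: "i < M" "j < M" "irreg i j" for i j
  proof -
    let ?AB = "A i j \<times> B i j"
    let ?h = "\<lambda>z. of_bool (z \<in> ?AB) :: real"
    let ?n = "real (card (?cl i)) * real (card (?cl j))"
    have sub: "?AB \<subseteq> ?cl i \<times> ?cl j" "?cl i \<times> ?cl j \<subseteq> V \<times> V"
      using AB(1,2)[OF ij(3)] by (auto simp: color_class_def)
    have finc: "finite (?cl i)" "finite (?cl j)" using V by (auto simp: color_class_def)
    then have fin2: "finite (?cl i \<times> ?cl j)" by simp
    have "(\<Sum>z\<in>V \<times> V. block_avg (V \<times> V) (map_prod c' c') ?f z * ?h z) = (\<Sum>z\<in>V \<times> V. ?f z * ?h z)"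
    proof (rule sum_block_avg[OF fin])
      fix z z' assume "z \<in> V \<times> V" "z' \<in> V \<times> V" "map_prod c' c' z = map_prod c' c' z'"
      then have "c1 (fst z) = c1 (fst z')" "c1 (snd z) = c1 (snd z')" by (auto intro!: c'_eq)
      then show "?h z = ?h z'" using ij by (cases z; cases z') (auto simp: c1_def set_eq_iff)
    qed
    moreover have conv: "(\<Sum>z\<in>V \<times> V. q z * ?h z) = (\<Sum>z\<in>?AB. q z)" for q :: "'v \<times> 'v \<Rightarrow> real"
    proof -
      have "(\<Sum>z\<in>V \<times> V. q z * ?h z) = (\<Sum>z\<in>V \<times> V. if z \<in> ?AB then q z else 0)"
        by (intro sum.cong) auto
      also have "\<dots> = (\<Sum>z\<in>V \<times> V \<inter> ?AB. q z)"
        using fin by (rule sum.inter_restrict[symmetric])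
      also have "V \<times> V \<inter> ?AB = ?AB" using sub by blast
      finally show ?thesis .
    qed
    ultimately have 1: "(\<Sum>z\<in>?AB. block_avg (V \<times> V) (map_prod c' c') ?f z) = (\<Sum>z\<in>?AB. ?f z)"
      by simp
    have 2: "block_avg (V \<times> V) (map_prod c c) ?f z = ?d i j" if "z \<in> ?AB" for z
    proof -
      have "z \<in> ?cl i \<times> ?cl j" using that sub by blast
      then show ?thesis by (cases z) (simp add: block_avg_pair, simp add: color_class_def)
    qed
    \<comment> \<open>On the witness rectangle the new averages sum to the same value as w, and the
      old ones are constantly the density, so g sums exactly to the deviation of the
      witness.\<close>
    have "(\<Sum>z\<in>?AB. g z) = (\<Sum>z\<in>?AB. ?f z - ?d i j)"
      unfolding g_def sum_subtractf 1 using 2 by simp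
    also have "\<dots> = (\<Sum>x\<in>A i j. \<Sum>y\<in>B i j. w x y - ?d i j)"
      by (simp add: sum.cartesian_product case_prod_beta)
    finally have "\<epsilon> * ?n < \<bar>\<Sum>z\<in>?AB. g z\<bar>" using AB(3)[OF ij(3)] by (simp add: mult.assoc)
    then have "(\<epsilon> * ?n)\<^sup>2 \<le> (\<Sum>z\<in>?AB. g z)\<^sup>2"
      using \<epsilon> by (metis abs_le_square_iff abs_of_nonneg less_imp_le mult_nonneg_nonneg of_nat_0_le_iff)
    also have "\<dots> \<le> real (card ?AB) * (\<Sum>z\<in>?AB. (g z)\<^sup>2)"
      using sum_squared_le_sum_of_squares[of g ?AB] by (simp only: mult.commute)
    also have "\<dots> \<le> ?n * (\<Sum>z\<in>?cl i \<times> ?cl j. (g z)\<^sup>2)"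
    proof (rule mult_mono)
      have "card ?AB \<le> card (?cl i \<times> ?cl j)" by (rule card_mono[OF fin2 sub(1)])
      then show "real (card ?AB) \<le> ?n" by (metis card_cartesian_product of_nat_le_iff of_nat_mult)
      show "(\<Sum>z\<in>?AB. (g z)\<^sup>2) \<le> (\<Sum>z\<in>?cl i \<times> ?cl j. (g z)\<^sup>2)"
        by (rule sum_mono2[OF fin2 sub(1)]) simp
    qed (auto intro: sum_nonneg)
    finally have *: "?n * (\<epsilon>\<^sup>2 * ?n) \<le> ?n * (\<Sum>z\<in>?cl i \<times> ?cl j. (g z)\<^sup>2)"
      by (simp add: power2_eq_square algebra_simps)
    show ?thesis
    proof (cases "?n = 0")
      case True
      show ?thesis unfolding True by (simp add: sum_nonneg)
    next
      case False
      moreover have "?n \<ge> 0" by simp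
      ultimately have "?n > 0" by linarith
      with * show ?thesis by (simp only: mult_le_cancel_left_pos)
    qed
  qed
  define J where "J = {(i, j) \<in> {..<M} \<times> {..<M}. irreg i j}"
  have finJ: "finite J" by (rule finite_subset[of _ "{..<M} \<times> {..<M}"]) (auto simp: J_def)
  define Q where "Q p = ?cl (fst p) \<times> ?cl (snd p)" for p
  have disj: "Q p \<inter> Q q = {}" if "p \<noteq> q" for p q
    using that by (auto simp: Q_def color_class_def prod_eq_iff)
  have un: "irregular_points \<epsilon> V w c = (\<Union>p\<in>J. Q p)"
  proof (rule set_eqI)
    fix z
    have cM: "c x < M" if "x \<in> V" for x using c that by auto
    show "z \<in> irregular_points \<epsilon> V w c \<longleftrightarrow> z \<in> (\<Union>p\<in>J. Q p)"
      unfolding irregular_points_def J_def Q_def irreg_def using cM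
      by (cases z) (auto simp: color_class_def)
  qed
  have finQ: "finite (Q p)" for p using V by (simp add: Q_def color_class_def)
  have "\<epsilon> ^ 3 * (real (card V))\<^sup>2 = \<epsilon>\<^sup>2 * (\<epsilon> * (real (card V))\<^sup>2)"
    by (simp add: power2_eq_square power3_eq_cube)
  also have "\<dots> \<le> \<epsilon>\<^sup>2 * real (card (irregular_points \<epsilon> V w c))"
    using irr by (intro mult_left_mono) auto
  also have "real (card (irregular_points \<epsilon> V w c)) = (\<Sum>p\<in>J. real (card (Q p)))"
    unfolding un using finJ finQ disj by (subst card_UN_disjoint) simp_all
  also have "\<epsilon>\<^sup>2 * \<dots> \<le> (\<Sum>p\<in>J. (\<Sum>z\<in>Q p. (g z)\<^sup>2))"
    unfolding sum_distrib_left
  proof (rule sum_mono)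
    fix p assume "p \<in> J"
    then show "\<epsilon>\<^sup>2 * real (card (Q p)) \<le> (\<Sum>z\<in>Q p. (g z)\<^sup>2)"
      using blk[of "fst p" "snd p"] unfolding Q_def J_def card_cartesian_product of_nat_mult
      by (cases p) simp
  qed
  also have "\<dots> = (\<Sum>z\<in>irregular_points \<epsilon> V w c. (g z)\<^sup>2)"
    unfolding un using finJ finQ disj by (subst sum.UNION_disjoint) simp_all
  also have "\<dots> \<le> (\<Sum>z\<in>V \<times> V. (g z)\<^sup>2)"
    by (rule sum_mono2[OF fin]) (auto simp: irregular_points_def)
  finally have "energy V w c' \<ge> energy V w c + \<epsilon> ^ 3 * (real (card V))\<^sup>2"
    unfolding en by simp
  then show ?thesis using c'_N by blast
qed

text \<open>r bounds the number of increments: energy above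
  \<open>(1 - real r * \<epsilon> ^ 3)\<close> times the square of \<open>card V\<close> leaves room
  for fewer than r of them, and r = 0 contradicts \<open>energy_le\<close>. The bound M' is fixed
  before the vertex set and the matrix.\<close>

lemma regularity_iterate:
  fixes \<epsilon> :: real
  assumes \<epsilon>: "\<epsilon> > 0"
  shows "\<exists>M'. \<forall>(V :: 'v set) w (c :: 'v \<Rightarrow> nat). finite V \<longrightarrow> (\<forall>x\<in>V. \<forall>y\<in>V. 0 \<le> w x y \<and> w x y \<le> 1) \<longrightarrow>
     c ` V \<subseteq> {..<M} \<longrightarrow>
     energy V w c >
        (1 - real r * \<epsilon> ^ 3) * (real (card V))\<^sup>2 \<longrightarrow>
     (\<exists>c' :: 'v \<Rightarrow> nat. c' ` V \<subseteq> {..<M'} \<and> real (card (irregular_points \<epsilon> V w c')) \<le> \<epsilon> * (real (card V))\<^sup>2)"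
proof (induction r arbitrary: M)
  case 0
  show ?case
  proof (intro exI[of _ M] allI impI)
    fix V :: "'v set" and w and c :: "'v \<Rightarrow> nat"
    assume "finite V" "\<forall>x\<in>V. \<forall>y\<in>V. 0 \<le> w x y \<and> w x y \<le> 1"
      "energy V w c > (1 - real 0 * \<epsilon> ^ 3) * (real (card V))\<^sup>2"
    with energy_le[of V w c] show "\<exists>c' :: 'v \<Rightarrow> nat. c' ` V \<subseteq> {..<M} \<and>
        real (card (irregular_points \<epsilon> V w c')) \<le> \<epsilon> * (real (card V))\<^sup>2"
      by simp
  qed
next
  case (Suc r)
  define N where "N = card ({..<M} \<times> Pow ({..<M} \<times> {..<M}) \<times> Pow ({..<M} \<times> {..<M}))"
  obtain M' where M': "\<forall>(V :: 'v set) w (c :: 'v \<Rightarrow> nat). finite V \<longrightarrow> (\<forall>x\<in>V. \<forall>y\<in>V. 0 \<le> w x y \<and> w x y \<le> 1) \<longrightarrow>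
     c ` V \<subseteq> {..<N} \<longrightarrow>
     energy V w c >
        (1 - real r * \<epsilon> ^ 3) * (real (card V))\<^sup>2 \<longrightarrow>
     (\<exists>c' :: 'v \<Rightarrow> nat. c' ` V \<subseteq> {..<M'} \<and> real (card (irregular_points \<epsilon> V w c')) \<le> \<epsilon> * (real (card V))\<^sup>2)"
    by (rule exE[OF Suc.IH[of N]])
  show ?case
  proof (intro exI[of _ "max M M'"] allI impI)
    fix V :: "'v set" and w and c :: "'v \<Rightarrow> nat"
    assume V: "finite V" and w: "\<forall>x\<in>V. \<forall>y\<in>V. 0 \<le> w x y \<and> w x y \<le> 1" and c: "c ` V \<subseteq> {..<M}"
      and e: "energy V w c >
        (1 - real (Suc r) * \<epsilon> ^ 3) * (real (card V))\<^sup>2"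
    show "\<exists>c' :: 'v \<Rightarrow> nat. c' ` V \<subseteq> {..<max M M'} \<and> real (card (irregular_points \<epsilon> V w c')) \<le> \<epsilon> * (real (card V))\<^sup>2"
    proof (cases "real (card (irregular_points \<epsilon> V w c)) \<le> \<epsilon> * (real (card V))\<^sup>2")
      case True
      then show ?thesis using c by (intro exI[of _ c]) auto
    next
      case False
      then obtain c1 :: "'v \<Rightarrow> nat" where c1: "c1 ` V \<subseteq> {..<N}"
        "energy V w c1 \<ge>
         energy V w c + \<epsilon> ^ 3 * (real (card V))\<^sup>2"
        using energy_increment[OF V c \<epsilon>, of w] unfolding N_def not_le by blast
      have "energy V w c1 >
        (1 - real r * \<epsilon> ^ 3) * (real (card V))\<^sup>2"
        using c1(2) e by (simp add: algebra_simps)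
      then obtain c' :: "'v \<Rightarrow> nat" where "c' ` V \<subseteq> {..<M'}"
        "real (card (irregular_points \<epsilon> V w c')) \<le> \<epsilon> * (real (card V))\<^sup>2"
        using M'[rule_format, OF V _ c1(1)] w by blast
      then show ?thesis by (intro exI[of _ c']) auto
    qed
  qed
qed

lemma regularity_lemma:
  fixes \<epsilon> :: real
  assumes "\<epsilon> > 0"
  shows "\<exists>M. \<forall>(V :: 'v set) w. finite V \<longrightarrow> (\<forall>x\<in>V. \<forall>y\<in>V. 0 \<le> w x y \<and> w x y \<le> 1) \<longrightarrow>
     (\<exists>c :: 'v \<Rightarrow> nat. c ` V \<subseteq> {..<M} \<and> real (card (irregular_points \<epsilon> V w c)) \<le> \<epsilon> * (real (card V))\<^sup>2)"
proof -
  obtain r :: nat where r: "1 < real r * \<epsilon> ^ 3"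
    using reals_Archimedean3[of "\<epsilon> ^ 3"] assms by auto
  obtain M where M: "\<forall>(V :: 'v set) w (c :: 'v \<Rightarrow> nat). finite V \<longrightarrow> (\<forall>x\<in>V. \<forall>y\<in>V. 0 \<le> w x y \<and> w x y \<le> 1) \<longrightarrow>
     c ` V \<subseteq> {..<1} \<longrightarrow>
     energy V w c >
        (1 - real r * \<epsilon> ^ 3) * (real (card V))\<^sup>2 \<longrightarrow>
     (\<exists>c' :: 'v \<Rightarrow> nat. c' ` V \<subseteq> {..<M} \<and> real (card (irregular_points \<epsilon> V w c')) \<le> \<epsilon> * (real (card V))\<^sup>2)"
    by (rule exE[OF regularity_iterate[OF assms, of 1 r]])
  show ?thesis
  proof (intro exI[of _ M] allI impI)
    fix V :: "'v set" and w
    assume V: "finite V" and w: "\<forall>x\<in>V. \<forall>y\<in>V. 0 \<le> w x y \<and> w x y \<le> (1::real)"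
    show "\<exists>c :: 'v \<Rightarrow> nat. c ` V \<subseteq> {..<M} \<and> real (card (irregular_points \<epsilon> V w c)) \<le> \<epsilon> * (real (card V))\<^sup>2"
    proof (cases "V = {}")
      case True
      then show ?thesis by (simp add: irregular_points_def)
    next
      case False
      \<comment> \<open>By the choice of r the energy threshold is negative, so the partition into a
        single class can start the iteration.\<close>
      then have "(1 - real r * \<epsilon> ^ 3) * (real (card V))\<^sup>2 < 0"
        using r V by (intro mult_neg_pos) (auto simp: card_gt_0_iff)
      also have "0 \<le> energy V w (\<lambda>_. 0 :: nat)"
        by (simp add: energy_def sum_nonneg)
      finally have "energy V w (\<lambda>_. 0 :: nat) > (1 - real r * \<epsilon> ^ 3) * (real (card V))\<^sup>2" .
      moreover have "(\<lambda>_. 0 :: nat) ` V \<subseteq> {..<1}" by auto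
      ultimately show ?thesis using M[rule_format, OF V] w by blast
    qed
  qed
qed

section \<open>Cleaning and the removal lemma\<close>

lemma sum_low_density_le:
  fixes d :: real
  assumes V: "finite V" and d: "0 \<le> d"
    and L: "L = {(x, y) \<in> V \<times> V. pair_density w (color_class V c (c x)) (color_class V c (c y)) < d}"
  shows "(\<Sum>(x, y)\<in>L. w x y) \<le> d * (real (card V))\<^sup>2"
proof -
  let ?f = "\<lambda>(x, y). w x y" and ?a = "block_avg (V \<times> V) (map_prod c c) (\<lambda>(x, y). w x y)"
  have L': "L = {z \<in> V \<times> V. ?a z < d}" unfolding L by (auto simp: block_avg_pair)
  have fin: "finite (V \<times> V)" using V by simp
  have conv: "(\<Sum>z\<in>L. q z) = (\<Sum>z\<in>V \<times> V. q z * of_bool (z \<in> L))" for q :: "'a \<times> 'a \<Rightarrow> real"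
  proof -
    have "(\<Sum>z\<in>L. q z) = (\<Sum>z\<in>V \<times> V. if z \<in> L then q z else 0)"
      unfolding L' using sum.inter_filter[OF fin, of q "\<lambda>z. ?a z < d"] by (simp cong: sum.cong)
    also have "\<dots> = (\<Sum>z\<in>V \<times> V. q z * of_bool (z \<in> L))" by (intro sum.cong) auto
    finally show ?thesis .
  qed
  have "(\<Sum>z\<in>L. ?f z) = (\<Sum>z\<in>V \<times> V. ?f z * of_bool (z \<in> L))" by (rule conv)
  \<comment> \<open>Membership in L depends only on the classes of the two vertices, so w may be
    replaced by its block averages, and these are below d on L.\<close>
  also have "\<dots> = (\<Sum>z\<in>V \<times> V. ?a z * of_bool (z \<in> L))"
  proof (rule sum_block_avg[OF fin, symmetric])
    fix z z' assume z: "z \<in> V \<times> V" "z' \<in> V \<times> V" "map_prod c c z = map_prod c c z'"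
    then show "of_bool (z \<in> L) = (of_bool (z' \<in> L) :: real)"
      unfolding L' using block_avg_cong[where C = "map_prod c c" and z = z and z' = z' and Z = "V \<times> V" and f = ?f] z by simp
  qed
  also have "\<dots> = (\<Sum>z\<in>L. ?a z)" by (rule conv[symmetric])
  also have "\<dots> \<le> (\<Sum>z\<in>L. d)" by (rule sum_mono) (simp add: L')
  also have "\<dots> \<le> d * (real (card V))\<^sup>2"
  proof -
    have "card L \<le> card (V \<times> V)" using fin by (intro card_mono) (auto simp: L)
    then have "real (card L) \<le> (real (card V))\<^sup>2"
      by (metis card_cartesian_product of_nat_le_iff of_nat_mult power2_eq_square)
    then show ?thesis using d by (simp add: mult.commute mult_left_mono)
  qed
  finally show ?thesis by simp
qed

lemma card_small_classes_le:
  fixes s :: real and c :: "'v \<Rightarrow> nat"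
  assumes V: "finite V" and c: "c ` V \<subseteq> {..<M}" and s: "0 \<le> s"
  shows "real (card {x\<in>V. real (card (color_class V c (c x))) < s}) \<le> real M * s"
proof -
  define J where "J = {i. i < M \<and> real (card (color_class V c i)) < s}"
  have J: "finite J" "card J \<le> M"
    using card_mono[of "{..<M}" J] by (auto simp: J_def)
  have "card {x\<in>V. real (card (color_class V c (c x))) < s} \<le> card (\<Union>i\<in>J. color_class V c i)"
    using c V J by (intro card_mono) (auto simp: J_def color_class_def)
  also have "\<dots> \<le> (\<Sum>i\<in>J. card (color_class V c i))"
    by (rule card_UN_le[OF J(1)])
  finally have "real (card {x\<in>V. real (card (color_class V c (c x))) < s}) \<le> (\<Sum>i\<in>J. real (card (color_class V c i)))"
    by (simp flip: of_nat_sum)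
  also have "\<dots> \<le> (\<Sum>i\<in>J. s)" by (rule sum_mono) (simp add: J_def)
  also have "\<dots> \<le> real M * s" using J s by (simp add: mult_right_mono)
  finally show ?thesis .
qed

text \<open>On each pair of E the matrix w is cut-close to its constant density, so the count
  differs from the product of the densities by at most \<epsilon> per edge, relative to the number
  of maps.\<close>

lemma embedding_count_lower:
  fixes E :: "('i \<times> 'i) set" and w :: "'v \<Rightarrow> 'v \<Rightarrow> real"
  assumes I: "finite I" "E \<subseteq> I \<times> I" "\<And>i j. (i, j) \<in> E \<Longrightarrow> i \<noteq> j \<and> (j, i) \<notin> E"
    and U: "\<And>i. i \<in> I \<Longrightarrow> finite (U i)"
    and w: "\<And>i j x y. i \<in> I \<Longrightarrow> j \<in> I \<Longrightarrow> x \<in> U i \<Longrightarrow> y \<in> U j \<Longrightarrow> 0 \<le> w x y \<and> w x y \<le> 1"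
    and reg: "\<And>i j. (i, j) \<in> E \<Longrightarrow> regular_pair \<epsilon> w (U i) (U j)"
    and dens: "\<And>i j. (i, j) \<in> E \<Longrightarrow> d \<le> pair_density w (U i) (U j)" and d: "0 \<le> d"
  shows "(d ^ card E - real (card E) * \<epsilon>) * (\<Prod>i\<in>I. real (card (U i))) \<le>
     (\<Sum>\<phi>\<in>PiE I U. \<Prod>e\<in>E. w (\<phi> (fst e)) (\<phi> (snd e)))"
proof -
  define D where "D e = pair_density w (U (fst e)) (U (snd e))" for e :: "'i \<times> 'i"
  have D01: "0 \<le> D e \<and> D e \<le> 1" if "e \<in> E" for e
  proof -
    have ij: "fst e \<in> I" "snd e \<in> I" using that I by auto
    have "(\<Sum>x\<in>U (fst e). \<Sum>y\<in>U (snd e). w x y) \<le> (\<Sum>x\<in>U (fst e). \<Sum>y\<in>U (snd e). 1)"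
      by (intro sum_mono) (use w ij in auto)
    moreover have "0 \<le> (\<Sum>x\<in>U (fst e). \<Sum>y\<in>U (snd e). w x y)"
      by (intro sum_nonneg) (use w ij in auto)
    ultimately show ?thesis by (auto simp: D_def pair_density_def divide_simps)
  qed
  have "\<bar>\<Sum>\<phi>\<in>PiE I U. (\<Prod>l\<in>I. (\<lambda>_ _. 1) l (\<phi> l)) *
      ((\<Prod>e\<in>E. (\<lambda>_. w) e (\<phi> (fst e)) (\<phi> (snd e))) - (\<Prod>e\<in>E. (\<lambda>e _ _. D e) e (\<phi> (fst e)) (\<phi> (snd e))))\<bar>
     \<le> real (card E) * \<epsilon> * (\<Prod>l\<in>I. real (card (U l)))"
  proof (rule counting_lemma[OF I(1) U I(2,3)], goal_cases)
    case (4 i j x y)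
    then show ?case using w[of i j x y] I(2) by auto
  next
    case (5 i j x y)
    then show ?case using D01 by simp
  next
    case (6 i j)
    then show ?case using reg[of i j] by (simp add: regular_pair_def D_def)
  qed simp_all
  then have "(\<Sum>\<phi>\<in>PiE I U. \<Prod>e\<in>E. D e) - real (card E) * \<epsilon> * (\<Prod>l\<in>I. real (card (U l))) \<le>
    (\<Sum>\<phi>\<in>PiE I U. \<Prod>e\<in>E. w (\<phi> (fst e)) (\<phi> (snd e)))"
    by (simp add: sum_subtractf abs_le_iff)
  moreover have "(\<Sum>\<phi>\<in>PiE I U. \<Prod>e\<in>E. D e) = (\<Prod>e\<in>E. D e) * (\<Prod>l\<in>I. real (card (U l)))"
    using I U by (simp add: card_PiE)
  moreover have "d ^ card E \<le> (\<Prod>e\<in>E. D e)"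
    using prod_mono[of E "\<lambda>_. d" D] dens d by (auto simp: D_def)
  then have "d ^ card E * (\<Prod>l\<in>I. real (card (U l))) \<le> (\<Prod>e\<in>E. D e) * (\<Prod>l\<in>I. real (card (U l)))"
    by (intro mult_right_mono) (auto intro: prod_nonneg)
  moreover have "real (card (PiE I U)) = (\<Prod>l\<in>I. real (card (U l)))"
    using I by (simp add: card_PiE)
  ultimately show ?thesis by (simp add: algebra_simps)
qed

text \<open>Z collects the vertex pairs in irregular pairs of classes, in sparse pairs, or with an
  end in a small class. A map avoiding Z on every edge would place the edges between large, dense
  and regular classes, and these contain more weighted copies than assumed. Copies are arbitrary
  maps, as in the densities of the flow.\<close>

lemma removal_lemma:
  fixes E :: "('i \<times> 'i) set" and \<delta> :: real
  assumes I: "finite I" "E \<subseteq> I \<times> I" "\<And>i j. (i, j) \<in> E \<Longrightarrow> i \<noteq> j \<and> (j, i) \<notin> E"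
    and \<delta>: "\<delta> > 0"
  shows "\<exists>\<gamma>>0. \<forall>(V :: 'v set) w. finite V \<longrightarrow> V \<noteq> {} \<longrightarrow> (\<forall>x\<in>V. \<forall>y\<in>V. 0 \<le> w x y \<and> w x y \<le> 1) \<longrightarrow>
     (\<Sum>\<phi>\<in>I \<rightarrow>\<^sub>E V. \<Prod>e\<in>E. w (\<phi> (fst e)) (\<phi> (snd e))) \<le> \<gamma> * real (card V) ^ card I \<longrightarrow>
     (\<exists>Z\<subseteq>V \<times> V. (\<Sum>(x, y)\<in>Z. w x y) \<le> \<delta> * (real (card V))\<^sup>2 \<and>
        (\<forall>\<phi>\<in>I \<rightarrow>\<^sub>E V. \<exists>e\<in>E. (\<phi> (fst e), \<phi> (snd e)) \<in> Z))"
proof -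
  \<comment> \<open>Four kinds of bad pairs share the permitted weight \<delta>.\<close>
  define d where "d = min (\<delta> / 4) 1"
  have d: "0 < d" "d \<le> 1" "4 * d \<le> \<delta>" using \<delta> by (auto simp: d_def)
  \<comment> \<open>With this \<epsilon> the counting errors of all edges together consume at most
    half of the main term \<open>d ^ card E\<close>.\<close>
  define \<epsilon> where "\<epsilon> = min d (d ^ card E / (2 * (real (card E) + 1)))"
  have \<epsilon>: "0 < \<epsilon>" "\<epsilon> \<le> d" using d by (auto simp: \<epsilon>_def)
  have e\<epsilon>: "real (card E) * \<epsilon> \<le> d ^ card E / 2"
  proof -
    have "real (card E) * \<epsilon> \<le> (real (card E) + 1) * (d ^ card E / (2 * (real (card E) + 1)))"
      using \<epsilon> by (intro mult_mono) (auto simp: \<epsilon>_def)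
    also have "\<dots> = d ^ card E / 2" by (simp add: field_simps)
    finally show ?thesis .
  qed
  obtain M where M: "\<forall>(V :: 'v set) w. finite V \<longrightarrow> (\<forall>x\<in>V. \<forall>y\<in>V. 0 \<le> w x y \<and> w x y \<le> 1) \<longrightarrow>
     (\<exists>c :: 'v \<Rightarrow> nat. c ` V \<subseteq> {..<M} \<and> real (card (irregular_points \<epsilon> V w c)) \<le> \<epsilon> * (real (card V))\<^sup>2)"
    by (rule exE[OF regularity_lemma[OF \<epsilon>(1)]])
  \<comment> \<open>There are at most M classes, so the small ones together cover at most a
    d-fraction of V.\<close>
  define s where "s = d / (real M + 1)"
  have s: "0 < s" "s \<le> 1" "real M * s \<le> d" using d by (auto simp: s_def field_simps)
  \<comment> \<open>Half of the count guaranteed by classes of relative size s, which makes the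
    final contradiction strict.\<close>
  define \<gamma> where "\<gamma> = d ^ card E / 4 * s ^ card I"
  have "\<gamma> > 0" using d s by (simp add: \<gamma>_def)
  show ?thesis
  proof (intro exI[of _ \<gamma>] conjI allI impI \<open>\<gamma> > 0\<close>)
    fix V :: "'v set" and w :: "'v \<Rightarrow> 'v \<Rightarrow> real"
    assume V: "finite V" "V \<noteq> {}" and w: "\<forall>x\<in>V. \<forall>y\<in>V. 0 \<le> w x y \<and> w x y \<le> 1"
      and few: "(\<Sum>\<phi>\<in>I \<rightarrow>\<^sub>E V. \<Prod>e\<in>E. w (\<phi> (fst e)) (\<phi> (snd e))) \<le> \<gamma> * real (card V) ^ card I"
    obtain c :: "'v \<Rightarrow> nat" where c: "c ` V \<subseteq> {..<M}"
      "real (card (irregular_points \<epsilon> V w c)) \<le> \<epsilon> * (real (card V))\<^sup>2"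
      using M[rule_format, OF V(1)] w by blast
    let ?n = "real (card V)"
    let ?cl = "color_class V c"
    have n: "?n > 0" using V by (simp add: card_gt_0_iff)
    define L where "L = {(x, y) \<in> V \<times> V. pair_density w (?cl (c x)) (?cl (c y)) < d}"
    define S where "S = {x\<in>V. real (card (?cl (c x))) < s * ?n}"
    define Z where "Z = irregular_points \<epsilon> V w c \<union> L \<union> S \<times> V \<union> V \<times> S"
    have finVV: "finite (V \<times> V)" using V by simp
    have sub: "irregular_points \<epsilon> V w c \<subseteq> V \<times> V" "L \<subseteq> V \<times> V" "S \<times> V \<subseteq> V \<times> V" "V \<times> S \<subseteq> V \<times> V"
      by (auto simp: irregular_points_def L_def S_def)
    then have ZV: "Z \<subseteq> V \<times> V" unfolding Z_def by blast
    have fin: "finite (irregular_points \<epsilon> V w c)" "finite L" "finite (S \<times> V)" "finite (V \<times> S)"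
      using sub finVV by (meson finite_subset)+
    have Sle: "real (card S) * ?n \<le> d * ?n\<^sup>2"
    proof -
      have "real (card S) \<le> real M * (s * ?n)"
        unfolding S_def by (rule card_small_classes_le[OF V(1) c(1)]) (use s in simp)
      also have "\<dots> \<le> d * ?n" using s by (simp add: mult_right_mono flip: mult.assoc)
      finally show ?thesis using n by (simp add: power2_eq_square mult_right_mono flip: mult.assoc)
    qed
    have w01: "0 \<le> (case z of (x, y) \<Rightarrow> w x y) \<and> (case z of (x, y) \<Rightarrow> w x y) \<le> 1" if "z \<in> V \<times> V" for z
      using w that by auto
    have le_card: "(\<Sum>z\<in>A. case z of (x, y) \<Rightarrow> w x y) \<le> real (card A)" if "A \<subseteq> V \<times> V" for A
      using sum_mono[of A "\<lambda>z. case z of (x, y) \<Rightarrow> w x y" "\<lambda>_. 1"] w01 that by auto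
    have un: "(\<Sum>z\<in>A \<union> B. case z of (x, y) \<Rightarrow> w x y) \<le>
        (\<Sum>z\<in>A. case z of (x, y) \<Rightarrow> w x y) + (\<Sum>z\<in>B. case z of (x, y) \<Rightarrow> w x y)"
      if "A \<subseteq> V \<times> V" "B \<subseteq> V \<times> V" for A B
    proof -
      have "finite A" "finite B" using that finVV by (meson finite_subset)+
      moreover have "0 \<le> (\<Sum>z\<in>A \<inter> B. case z of (x, y) \<Rightarrow> w x y)"
        using w01 that by (intro sum_nonneg) blast
      ultimately show ?thesis by (simp add: sum_Un)
    qed
    have "(\<Sum>(x, y)\<in>Z. w x y) \<le> (\<Sum>(x, y)\<in>irregular_points \<epsilon> V w c. w x y) + (\<Sum>(x, y)\<in>L. w x y) +
        (\<Sum>(x, y)\<in>S \<times> V. w x y) + (\<Sum>(x, y)\<in>V \<times> S. w x y)"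
      unfolding Z_def
      using un[of "irregular_points \<epsilon> V w c" L] un[of "irregular_points \<epsilon> V w c \<union> L" "S \<times> V"]
        un[of "irregular_points \<epsilon> V w c \<union> L \<union> S \<times> V" "V \<times> S"] sub by simp
    also have "\<dots> \<le> \<epsilon> * ?n\<^sup>2 + d * ?n\<^sup>2 + d * ?n\<^sup>2 + d * ?n\<^sup>2"
    proof (intro add_mono)
      show "(\<Sum>(x, y)\<in>irregular_points \<epsilon> V w c. w x y) \<le> \<epsilon> * ?n\<^sup>2"
        using le_card[OF sub(1)] c(2) by linarith
      show "(\<Sum>(x, y)\<in>L. w x y) \<le> d * ?n\<^sup>2"
        by (rule sum_low_density_le[OF V(1) _ L_def]) (use d in simp)
      show "(\<Sum>(x, y)\<in>S \<times> V. w x y) \<le> d * ?n\<^sup>2"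
        using le_card[OF sub(3)] Sle by (simp add: card_cartesian_product)
      show "(\<Sum>(x, y)\<in>V \<times> S. w x y) \<le> d * ?n\<^sup>2"
        using le_card[OF sub(4)] Sle by (simp add: card_cartesian_product mult.commute)
    qed
    also have "\<dots> \<le> 4 * d * ?n\<^sup>2"
      using \<epsilon>(2) mult_right_mono[of \<epsilon> d "?n\<^sup>2"] by simp
    also have "\<dots> \<le> \<delta> * ?n\<^sup>2" using d(3) by (intro mult_right_mono) auto
    finally have Zle: "(\<Sum>(x, y)\<in>Z. w x y) \<le> \<delta> * ?n\<^sup>2" .
    have hit: "\<exists>e\<in>E. (\<phi> (fst e), \<phi> (snd e)) \<in> Z" if \<phi>: "\<phi> \<in> I \<rightarrow>\<^sub>E V" for \<phi>
    proof (rule ccontr)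
      assume "\<not> ?thesis"
      then have no: "(\<phi> i, \<phi> j) \<notin> Z" if "(i, j) \<in> E" for i j using that by force
      \<comment> \<open>An index on no edge is not controlled by Z, and its class could be tiny; it
        ranges over all of V instead.\<close>
      define U where "U l = (if \<exists>j. (l, j) \<in> E \<or> (j, l) \<in> E then ?cl (c (\<phi> l)) else V)" for l
      have U: "finite (U l)" "U l \<subseteq> V" for l
        using V by (auto simp: U_def color_class_def)
      have Uedge: "U i = ?cl (c (\<phi> i))" "U j = ?cl (c (\<phi> j))" if "(i, j) \<in> E" for i j
        using that by (auto simp: U_def)
      have phiV: "\<phi> i \<in> V" if "i \<in> I" for i using that \<phi> by auto
      have "(d ^ card E - real (card E) * \<epsilon>) * (\<Prod>i\<in>I. real (card (U i))) \<le>
          (\<Sum>\<psi>\<in>PiE I U. \<Prod>e\<in>E. w (\<psi> (fst e)) (\<psi> (snd e)))"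
      proof (rule embedding_count_lower[OF I])
        fix i j assume ij: "(i, j) \<in> E"
        then have V': "\<phi> i \<in> V" "\<phi> j \<in> V" using I(2) phiV by auto
        show "regular_pair \<epsilon> w (U i) (U j)"
          using no[OF ij] V' by (auto simp: Uedge[OF ij] Z_def irregular_points_def)
        show "d \<le> pair_density w (U i) (U j)"
          using no[OF ij] V' by (auto simp: Uedge[OF ij] Z_def L_def)
      next
        fix i j x y assume "x \<in> U i" "y \<in> U j"
        then have "x \<in> V" "y \<in> V" using U(2) by auto
        then show "0 \<le> w x y \<and> w x y \<le> 1" using w by simp
      qed (use U d in auto)
      also have "\<dots> \<le> (\<Sum>\<psi>\<in>I \<rightarrow>\<^sub>E V. \<Prod>e\<in>E. w (\<psi> (fst e)) (\<psi> (snd e)))"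
      proof (rule sum_mono2)
        show "finite (I \<rightarrow>\<^sub>E V)" using V I by (simp add: finite_PiE)
        show "PiE I U \<subseteq> I \<rightarrow>\<^sub>E V" using U by (intro PiE_mono) auto
        show "0 \<le> (\<Prod>e\<in>E. w (\<psi> (fst e)) (\<psi> (snd e)))" if "\<psi> \<in> (I \<rightarrow>\<^sub>E V) - PiE I U" for \<psi>
          using that w I(2) by (intro prod_nonneg) (force simp: PiE_iff)
      qed
      also have "\<dots> \<le> \<gamma> * ?n ^ card I" by (rule few)
      also have "\<dots> < d ^ card E / 2 * (s * ?n) ^ card I"
        using d s n by (simp add: \<gamma>_def power_mult_distrib)
      also have "\<dots> \<le> (d ^ card E - real (card E) * \<epsilon>) * (\<Prod>i\<in>I. real (card (U i)))"
      proof (rule mult_mono)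
        show "d ^ card E / 2 \<le> d ^ card E - real (card E) * \<epsilon>" using e\<epsilon> by simp
        have "(\<Prod>i\<in>I. s * ?n) \<le> (\<Prod>i\<in>I. real (card (U i)))"
        proof (rule prod_mono, intro conjI)
          fix i assume i: "i \<in> I"
          show "0 \<le> s * ?n" using s by simp
          show "s * ?n \<le> real (card (U i))"
          proof (cases "\<exists>j. (i, j) \<in> E \<or> (j, i) \<in> E")
            case True
            then obtain j where j: "(i, j) \<in> E \<or> (j, i) \<in> E" by blast
            then have "j \<in> I" using I(2) by auto
            then have "\<phi> i \<notin> S" using no[of i j] no[of j i] j phiV i by (auto simp: Z_def)
            then show ?thesis using True phiV[OF i] by (simp add: U_def S_def)
          next
            case False
            then show ?thesis using s n by (simp add: U_def)
          qed
        qed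
        then show "(s * ?n) ^ card I \<le> (\<Prod>i\<in>I. real (card (U i)))" by simp
        show "0 \<le> (s * ?n) ^ card I" using s by simp
        show "0 \<le> d ^ card E - real (card E) * \<epsilon>" using e\<epsilon> d by (smt (verit) zero_le_power field_sum_of_halves)
      qed
      finally show False by simp
    qed
    show "\<exists>Z\<subseteq>V \<times> V. (\<Sum>(x, y)\<in>Z. w x y) \<le> \<delta> * ?n\<^sup>2 \<and> (\<forall>\<phi>\<in>I \<rightarrow>\<^sub>E V. \<exists>e\<in>E. (\<phi> (fst e), \<phi> (snd e)) \<in> Z)"
      using ZV Zle hit by blast
  qed
qed

section \<open>Lipschitz systems and a Gronwall inequality\<close>

text \<open>Picard iterates. States are functions on an index set because the coordinates are pairs
  of vertices, whose number varies with n.\<close>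

fun picard :: "(('i \<Rightarrow> real) \<Rightarrow> 'i \<Rightarrow> real) \<Rightarrow> ('i \<Rightarrow> real) \<Rightarrow> nat \<Rightarrow> real \<Rightarrow> 'i \<Rightarrow> real" where
  "picard f a 0 t i = a i"
| "picard f a (Suc m) t i = a i + integral {0..t} (\<lambda>s. f (picard f a m s) i)"

text \<open>The premise \<open>lip\<close>, which recurs below, is a Lipschitz bound in the supremum
  norm over I, phrased through a common bound c for the coordinates.\<close>

lemma continuous_on_lipschitz_field:
  fixes f :: "('i \<Rightarrow> real) \<Rightarrow> 'i \<Rightarrow> real"
  assumes I: "finite I" and L: "L \<ge> 0"
    and lip: "\<And>x y i c. i \<in> I \<Longrightarrow> 0 \<le> c \<Longrightarrow> (\<And>j. j \<in> I \<Longrightarrow> \<bar>x j - y j\<bar> \<le> c) \<Longrightarrow> \<bar>f x i - f y i\<bar> \<le> L * c"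
    and x: "\<And>j. j \<in> I \<Longrightarrow> continuous_on A (\<lambda>s. x s j)" and i: "i \<in> I"
  shows "continuous_on A (\<lambda>s::real. f (x s) i)"
  unfolding continuous_on_def
proof
  fix t assume t: "t \<in> A"
  have "((\<lambda>s. L * (\<Sum>j\<in>I. \<bar>x s j - x t j\<bar>)) \<longlongrightarrow> L * (\<Sum>j\<in>I. \<bar>x t j - x t j\<bar>)) (at t within A)"
    using x t by (intro tendsto_intros) (auto simp: continuous_on_def)
  then have lim: "((\<lambda>s. L * (\<Sum>j\<in>I. \<bar>x s j - x t j\<bar>)) \<longlongrightarrow> 0) (at t within A)" by simp
  have "((\<lambda>s. f (x s) i - f (x t) i) \<longlongrightarrow> 0) (at t within A)"
  proof (rule Lim_null_comparison[OF always_eventually lim], intro allI)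
    fix s
    show "norm (f (x s) i - f (x t) i) \<le> L * (\<Sum>j\<in>I. \<bar>x s j - x t j\<bar>)"
      unfolding real_norm_def
      by (rule lip[OF i]) (auto intro: sum_nonneg member_le_sum[OF _ _ I])
  qed
  then show "((\<lambda>s. f (x s) i) \<longlongrightarrow> f (x t) i) (at t within A)" by (simp add: LIM_zero_iff)
qed

lemma continuous_on_picard:
  assumes I: "finite I" and L: "L \<ge> 0"
    and lip: "\<And>x y i c. i \<in> I \<Longrightarrow> 0 \<le> c \<Longrightarrow> (\<And>j. j \<in> I \<Longrightarrow> \<bar>x j - y j\<bar> \<le> c) \<Longrightarrow> \<bar>f x i - f y i\<bar> \<le> L * c"
    and i: "i \<in> I"
  shows "continuous_on {0..T} (\<lambda>s. picard f a m s i)"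
  using i
proof (induction m arbitrary: i)
  case (Suc m)
  have "continuous_on {0..T} (\<lambda>s. f (picard f a m s) i)"
    by (rule continuous_on_lipschitz_field[OF I L lip Suc.IH Suc.prems])
  then have "continuous_on {0..T} (\<lambda>t. integral {0..t} (\<lambda>s. f (picard f a m s) i))"
    by (intro indefinite_integral_continuous_1 integrable_continuous_real)
  then show ?case by (simp add: continuous_on_add)
qed simp

text \<open>The usual factorial bound: each integration of the Lipschitz estimate raises the power
  of t by one and divides by the new exponent.\<close>

lemma picard_diff_bound:
  assumes I: "finite I" and L: "L \<ge> 0"
    and lip: "\<And>x y i c. i \<in> I \<Longrightarrow> 0 \<le> c \<Longrightarrow> (\<And>j. j \<in> I \<Longrightarrow> \<bar>x j - y j\<bar> \<le> c) \<Longrightarrow> \<bar>f x i - f y i\<bar> \<le> L * c"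
    and B: "\<And>i. i \<in> I \<Longrightarrow> \<bar>f a i\<bar> \<le> B"
    and i: "i \<in> I" and t: "0 \<le> t"
  shows "\<bar>picard f a (Suc m) t i - picard f a m t i\<bar> \<le> B * L ^ m * t ^ Suc m / fact (Suc m)"
  using i t
proof (induction m arbitrary: i t)
  case 0
  have "picard f a 0 s = a" for s by (auto simp: fun_eq_iff)
  then show ?case using 0 B[of i] by (simp add: abs_mult mult.commute[of B] mult_left_mono)
next
  case (Suc m)
  have int: "(\<lambda>s. f (picard f a k s) i) integrable_on {0..t}" for k
    by (intro integrable_continuous_real continuous_on_lipschitz_field[OF I L lip _ Suc.prems(1)]
      continuous_on_picard[OF I L lip])
  have hi: "((\<lambda>s. L * (B * L ^ m * s ^ Suc m / fact (Suc m))) has_integral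
      (B * L ^ Suc m * t ^ Suc (Suc m) / fact (Suc (Suc m)) - 0)) {0..t}"
  proof -
    have "((\<lambda>s. L * (B * L ^ m * s ^ Suc m / fact (Suc m))) has_integral
      (B * L ^ Suc m * t ^ Suc (Suc m) / fact (Suc (Suc m)) - B * L ^ Suc m * 0 ^ Suc (Suc m) / fact (Suc (Suc m)))) {0..t}"
      using Suc.prems(2)
    proof (rule fundamental_theorem_of_calculus)
      fix x :: real assume "x \<in> {0..t}"
      have "((\<lambda>s. B * L ^ Suc m * s ^ Suc (Suc m) / fact (Suc (Suc m))) has_real_derivative
          B * L ^ Suc m * (real (Suc (Suc m)) * x ^ Suc m) / fact (Suc (Suc m))) (at x within {0..t})"
        by (rule derivative_eq_intros refl | simp)+
      moreover have "B * L ^ Suc m * (real (Suc (Suc m)) * x ^ Suc m) / fact (Suc (Suc m)) =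
          L * (B * L ^ m * x ^ Suc m / fact (Suc m))"
        by (simp add: fact_Suc[of "Suc m"] divide_simps del: fact_Suc of_nat_Suc)
      ultimately show "((\<lambda>s. B * L ^ Suc m * s ^ Suc (Suc m) / fact (Suc (Suc m))) has_vector_derivative
          L * (B * L ^ m * x ^ Suc m / fact (Suc m))) (at x within {0..t})"
        by (simp only: has_real_derivative_iff_has_vector_derivative)
    qed
    then show ?thesis by simp
  qed
  have "picard f a (Suc (Suc m)) t i - picard f a (Suc m) t i =
      integral {0..t} (\<lambda>s. f (picard f a (Suc m) s) i - f (picard f a m s) i)"
    using integral_diff[OF int int, of "Suc m" m] by simp
  also have "\<bar>\<dots>\<bar> \<le> integral {0..t} (\<lambda>s. L * (B * L ^ m * s ^ Suc m / fact (Suc m)))"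
    unfolding real_norm_def[symmetric]
  proof (rule integral_norm_bound_integral)
    show "(\<lambda>s. f (picard f a (Suc m) s) i - f (picard f a m s) i) integrable_on {0..t}"
      by (intro integrable_diff int)
    show "(\<lambda>s. L * (B * L ^ m * s ^ Suc m / fact (Suc m))) integrable_on {0..t}"
      using hi by (auto simp: integrable_on_def)
    fix s assume s: "s \<in> {0..t}"
    have "0 \<le> B" using B[OF Suc.prems(1)] by linarith
    then show "norm (f (picard f a (Suc m) s) i - f (picard f a m s) i) \<le> L * (B * L ^ m * s ^ Suc m / fact (Suc m))"
      unfolding real_norm_def
      by (intro lip Suc.prems Suc.IH) (use s L in \<open>auto intro!: mult_nonneg_nonneg divide_nonneg_nonneg\<close>)
  qed
  also have "\<dots> = B * L ^ Suc m * t ^ Suc (Suc m) / fact (Suc (Suc m))"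
    using integral_unique[OF hi] by (simp only: diff_zero)
  finally show ?case .
qed

text \<open>A global Lipschitz constant makes the increments of the iterates summable uniformly on
  every bounded interval, by comparison with the exponential series. The solution therefore exists
  for all times at once, without continuation.\<close>

lemma lipschitz_ode_solution:
  fixes f :: "('i \<Rightarrow> real) \<Rightarrow> 'i \<Rightarrow> real" and a :: "'i \<Rightarrow> real"
  assumes I: "finite I" and L: "L \<ge> 0"
    and lip: "\<And>x y i c. i \<in> I \<Longrightarrow> 0 \<le> c \<Longrightarrow> (\<And>j. j \<in> I \<Longrightarrow> \<bar>x j - y j\<bar> \<le> c) \<Longrightarrow> \<bar>f x i - f y i\<bar> \<le> L * c"
  shows "\<exists>x. \<forall>i\<in>I. x 0 i = a i \<and>
    (\<forall>t\<ge>0. ((\<lambda>s. x s i) has_real_derivative f (x t) i) (at t within {0..}))"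
proof -
  define B where "B = (\<Sum>i\<in>I. \<bar>f a i\<bar>)"
  have B: "\<bar>f a i\<bar> \<le> B" if "i \<in> I" for i
    unfolding B_def by (rule member_le_sum[OF that]) (auto simp: I)
  \<comment> \<open>The limit of the iterates, written as a telescoping series for the
    M-test.\<close>
  define x where "x t i = a i + (\<Sum>m. picard f a (Suc m) t i - picard f a m t i)" for t i
  have uni: "uniform_limit {0..T} (\<lambda>m t. picard f a m t i) (\<lambda>t. x t i) sequentially" if i: "i \<in> I" for i T
  proof -
    have "uniform_limit {0..T} (\<lambda>n t. \<Sum>m<n. picard f a (Suc m) t i - picard f a m t i)
        (\<lambda>t. \<Sum>m. picard f a (Suc m) t i - picard f a m t i) sequentially"
    proof (rule Weierstrass_m_test)
      fix m t assume t: "t \<in> {0..T}"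
      have "\<bar>picard f a (Suc m) t i - picard f a m t i\<bar> \<le> B * L ^ m * t ^ Suc m / fact (Suc m)"
        by (rule picard_diff_bound[where I = I and f = f, OF I L lip B i]) (use t in auto)
      also have "\<dots> \<le> B * L ^ m * T ^ Suc m / fact (Suc m)"
        using t L B[OF i] by (intro divide_right_mono mult_left_mono power_mono mult_nonneg_nonneg) auto
      also have "\<dots> \<le> B * T * ((L * T) ^ m / fact m)"
      proof -
        have "B * L ^ m * T ^ Suc m / fact (Suc m) \<le> B * L ^ m * T ^ Suc m / fact m"
          using t L B[OF i] by (intro divide_left_mono mult_nonneg_nonneg) (auto simp: fact_mono)
        also have "\<dots> = B * T * ((L * T) ^ m / fact m)" by (simp add: power_mult_distrib mult_ac)
        finally show ?thesis .
      qed
      finally show "norm (picard f a (Suc m) t i - picard f a m t i) \<le> B * T * ((L * T) ^ m / fact m)" by simp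
    next
      show "summable (\<lambda>m. B * T * ((L * T) ^ m / fact m))"
        using summable_exp[of "L * T"] by (intro summable_mult) (simp add: field_simps)
    qed
    then have "uniform_limit {0..T} (\<lambda>n t. a i + (\<Sum>m<n. picard f a (Suc m) t i - picard f a m t i))
        (\<lambda>t. x t i) sequentially"
      unfolding x_def by (intro uniform_limit_add uniform_limit_const)
    moreover have "a i + (\<Sum>m<n. picard f a (Suc m) t i - picard f a m t i) = picard f a n t i" for n t
      by (subst sum_lessThan_telescope) simp
    ultimately show ?thesis by simp
  qed
  have cont: "continuous_on {0..T} (\<lambda>t. x t i)" if i: "i \<in> I" for i T
    by (rule uniform_limit_theorem[OF _ uni[OF i]])
       (auto intro!: always_eventually continuous_on_picard[OF I L lip i])
  have fcont: "continuous_on {0..T} (\<lambda>t. f (x t) i)" if i: "i \<in> I" for i T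
    by (rule continuous_on_lipschitz_field[OF I L lip cont i])
  have eq: "x t i = a i + integral {0..t} (\<lambda>s. f (x s) i)" if i: "i \<in> I" and t: "0 \<le> t" for i t
  proof -
    have "uniform_limit {0..t} (\<lambda>m s. f (picard f a m s) i) (\<lambda>s. f (x s) i) sequentially"
    proof (rule uniform_limitI)
      fix e :: real assume e: "e > 0"
      define e' where "e' = e / (L + 1)"
      have e': "e' > 0" "L * e' < e" using e L by (auto simp: e'_def field_simps)
      have "\<forall>\<^sub>F m in sequentially. \<forall>j\<in>I. \<forall>s\<in>{0..t}. dist (picard f a m s j) (x s j) < e'"
        using I uni e'(1) by (auto simp: uniform_limit_iff eventually_ball_finite)
      then show "\<forall>\<^sub>F m in sequentially. \<forall>s\<in>{0..t}. dist (f (picard f a m s) i) (f (x s) i) < e"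
      proof eventually_elim
        case (elim m)
        show ?case
        proof
          fix s assume "s \<in> {0..t}"
          then have "\<bar>f (picard f a m s) i - f (x s) i\<bar> \<le> L * e'"
            using elim e' by (intro lip[OF i]) (auto simp: dist_real_def intro: less_imp_le)
          then show "dist (f (picard f a m s) i) (f (x s) i) < e" using e' by (simp add: dist_real_def)
        qed
      qed
    qed
    moreover have "continuous_on {0..t} (\<lambda>s. f (picard f a m s) i)" for m
      by (rule continuous_on_lipschitz_field[OF I L lip continuous_on_picard[OF I L lip] i])
    ultimately obtain J1 J2 where J: "\<And>m. ((\<lambda>s. f (picard f a m s) i) has_integral J1 m) {0..t}"
      "((\<lambda>s. f (x s) i) has_integral J2) {0..t}" "J1 \<longlonglongrightarrow> J2"
      by (rule uniform_limit_integral) auto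
    have "(\<lambda>m. a i + J1 m) \<longlonglongrightarrow> a i + J2" by (intro tendsto_intros J)
    moreover have "picard f a (Suc m) t i = a i + J1 m" for m
      using J(1)[of m] by (simp add: integral_unique)
    ultimately have "(\<lambda>m. picard f a (Suc m) t i) \<longlonglongrightarrow> a i + J2" by simp
    moreover have "(\<lambda>m. picard f a (Suc m) t i) \<longlonglongrightarrow> x t i"
      using tendsto_uniform_limitI[OF uni[OF i, of t], of t] t by (intro LIMSEQ_Suc) auto
    ultimately show ?thesis using J(2) by (simp add: LIMSEQ_unique integral_unique)
  qed
  have der: "((\<lambda>s. x s i) has_real_derivative f (x t) i) (at t within {0..})" if i: "i \<in> I" and t: "0 \<le> t" for i t
  proof -
    have "((\<lambda>s. integral {0..s} (\<lambda>s. f (x s) i)) has_real_derivative f (x t) i) (at t within {0..t + 1})"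
      by (rule integral_has_real_derivative[OF fcont[OF i]]) (use t in auto)
    then have "((\<lambda>s. a i + integral {0..s} (\<lambda>s. f (x s) i)) has_real_derivative f (x t) i) (at t within {0..t + 1})"
      by (auto intro!: derivative_eq_intros)
    then have "((\<lambda>s. x s i) has_real_derivative f (x t) i) (at t within {0..t + 1})"
      by (rule has_field_derivative_transform_within[of _ _ _ _ 1]) (use t eq[OF i] in auto)
    moreover have "at t within {0..t + 1} = at t within {0..}"
      by (rule at_within_nhd[of _ "{..<t + 1}"]) auto
    ultimately show ?thesis by simp
  qed
  show ?thesis
    by (intro exI[of _ x]) (use eq[of _ 0] der in auto)
qed

text \<open>A Gronwall inequality for a continuous function whose right difference quotients are
  controlled only while the function is at most 1. The comparison function is
  \<open>\<eta> * exp ((L + 1) * t)\<close>: the extra 1 in the exponent absorbs the error term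
  \<eta>, and \<eta> is small enough to keep the barrier below 1 up to time T. Finally \<eta> tends
  to 0.\<close>

lemma dini_gronwall_zero:
  fixes g :: "real \<Rightarrow> real"
  assumes T: "0 \<le> T" and L: "0 \<le> L" and g0: "g 0 = 0" and cont: "continuous_on {0..T} g"
    and dini: "\<And>t \<eta>. 0 \<le> t \<Longrightarrow> t < T \<Longrightarrow> g t \<le> 1 \<Longrightarrow> 0 < \<eta> \<Longrightarrow>
      \<exists>d>0. \<forall>s. t < s \<and> s < t + d \<longrightarrow> g s \<le> g t + (s - t) * (L * g t + \<eta>)"
  shows "g T \<le> 0"
proof -
  have main: "g T \<le> \<eta> * exp ((L + 1) * T)" if \<eta>: "\<eta> > 0" "\<eta> * exp ((L + 1) * T) \<le> 1" for \<eta>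
  proof (rule ccontr)
    define b where "b t = \<eta> * exp ((L + 1) * t)" for t
    assume "\<not> ?thesis"
    then have gT: "g T > b T" by (simp add: b_def)
    define S where "S = {t\<in>{0..T}. g t > b t}"
    have S: "S \<noteq> {}" "bdd_below S" using gT T by (auto simp: S_def intro: bdd_belowI[of _ 0])
    \<comment> \<open>The time at which the barrier is about to be exceeded. Continuity gives
      \<open>g u \<le> b u\<close>, and the bound to the right of u then forbids the
      crossing.\<close>
    define u where "u = Inf S"
    have u: "0 \<le> u" "u \<le> T"
      using S gT T by (auto simp: u_def S_def intro: cInf_greatest cInf_lower)
    have below: "g t \<le> b t" if "0 \<le> t" "t < u" for t
    proof (rule ccontr)
      assume "\<not> ?thesis"
      then have "t \<in> S" using that u by (auto simp: S_def)
      then show False using cInf_lower[OF _ S(2), of t] that by (simp add: u_def)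
    qed
    have cb: "continuous_on A b" for A unfolding b_def by (intro continuous_intros)
    have gu: "g u \<le> b u"
    proof (cases "u = 0")
      case True
      then show ?thesis using g0 \<eta> by (simp add: b_def)
    next
      case False
      have "continuous_on {0..u} (\<lambda>t. b t - g t)"
        using cb continuous_on_subset[OF cont, of "{0..u}"] u by (intro continuous_intros) auto
      then have "((\<lambda>t. b t - g t) \<longlongrightarrow> b u - g u) (at u within {0..u})"
        using u by (auto simp: continuous_on_def)
      then have "((\<lambda>t. b t - g t) \<longlongrightarrow> b u - g u) (at_left u)"
        using False u by (simp add: at_within_Icc_at_left)
      moreover have "\<forall>\<^sub>F t in at_left u. 0 \<le> b t - g t"
        by (rule eventually_mono[OF eventually_at_left_real[of 0 u]]) (use below False u in auto)
      ultimately have "0 \<le> b u - g u"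
        using tendsto_lowerbound trivial_limit_at_left_real by blast
      then show ?thesis by simp
    qed
    then have uT: "u < T" using gT u by (cases "u = T") auto
    have bu: "0 < b u" "b u \<le> 1" "\<eta> \<le> b u"
    proof -
      show "0 < b u" using \<eta> by (simp add: b_def)
      have "b u \<le> b T" unfolding b_def using \<eta> u L by (intro mult_left_mono) (auto intro: mult_left_mono)
      also have "b T \<le> 1" using \<eta> by (simp add: b_def)
      finally show "b u \<le> 1" .
      show "\<eta> \<le> b u" using \<eta> u L by (simp add: b_def)
    qed
    obtain d where d: "d > 0" "\<And>s. u < s \<Longrightarrow> s < u + d \<Longrightarrow> g s \<le> g u + (s - u) * (L * g u + \<eta>)"
      using dini[of u \<eta>] u uT gu bu \<eta> by (metis order.trans)
    obtain s where s: "s \<in> S" "s < u + d"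
      using S d(1) unfolding u_def by (metis cInf_lessD less_add_same_cancel1)
    have "u \<le> s" using cInf_lower[OF s(1) S(2)] by (simp add: u_def)
    moreover have "s \<noteq> u" using s gu by (auto simp: S_def)
    ultimately have us: "u < s" by simp
    have "g s \<le> g u + (s - u) * (L * g u + \<eta>)" using d us s by blast
    also have "\<dots> \<le> b u + (s - u) * (L * b u + b u)"
      using gu us L bu by (intro add_mono mult_left_mono) auto
    also have "\<dots> = b u * (1 + (L + 1) * (s - u))" by (simp add: algebra_simps)
    also have "\<dots> \<le> b u * exp ((L + 1) * (s - u))"
      using bu by (intro mult_left_mono exp_ge_add_one_self) auto
    also have "\<dots> = b s" by (simp add: b_def exp_add[symmetric] algebra_simps)
    finally show False using s by (simp add: S_def)
  qed
  have "\<forall>\<^sub>F \<eta> in at_right 0. g T \<le> \<eta> * exp ((L + 1) * T)"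
  proof -
    have "\<forall>\<^sub>F \<eta>::real in at_right 0. \<eta> \<in> {0<..<exp (- ((L + 1) * T))}"
      by (rule eventually_at_right_real) simp
    then show ?thesis
    proof eventually_elim
      case (elim \<eta>)
      have "\<eta> * exp ((L + 1) * T) \<le> exp (- ((L + 1) * T)) * exp ((L + 1) * T)"
        using elim by (intro mult_right_mono) auto
      then show ?case using elim by (intro main) (simp_all flip: exp_add)
    qed
  qed
  moreover have "((\<lambda>\<eta>. \<eta> * exp ((L + 1) * T)) \<longlongrightarrow> 0 * exp ((L + 1) * T)) (at_right 0)"
    by (intro tendsto_intros)
  ultimately show ?thesis
    using tendsto_lowerbound[of "\<lambda>\<eta>. \<eta> * exp ((L + 1) * T)" 0 "at_right 0" "g T"] by simp
qed

section \<open>The flow on matrices\<close>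

text \<open>Each edge once, so that products over edges repeat no factor.\<close>

definition edge_pairs :: "graph \<Rightarrow> (nat \<times> nat) set" where
  "edge_pairs F = {(i, j). i < j \<and> {i, j} \<in> F}"

text \<open>Each edge in both directions, matching the ordered pairs in \<open>velocity\<close>; an
  injective copy of F covers \<open>card (arcs F)\<close> ordered pairs.\<close>

definition arcs :: "graph \<Rightarrow> (nat \<times> nat) set" where
  "arcs F = {(a, b). a \<noteq> b \<and> {a, b} \<in> F}"

text \<open>The type of vertices is left open so that the same product serves matrices, with numbers
  as vertices, and kernels, with points of the space as vertices.\<close>

definition hom_weight :: "graph \<Rightarrow> ('v \<Rightarrow> 'v \<Rightarrow> real) \<Rightarrow> (nat \<Rightarrow> 'v) \<Rightarrow> real" where
  "hom_weight F w \<phi> = (\<Prod>e\<in>edge_pairs F. w (\<phi> (fst e)) (\<phi> (snd e)))"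

definition unit_on :: "'v set \<Rightarrow> ('v \<Rightarrow> 'v \<Rightarrow> real) \<Rightarrow> bool" where
  "unit_on V w \<longleftrightarrow> (\<forall>x\<in>V. \<forall>y\<in>V. 0 \<le> w x y \<and> w x y \<le> 1)"

lemma unit_onD: "unit_on V w \<Longrightarrow> x \<in> V \<Longrightarrow> y \<in> V \<Longrightarrow> 0 \<le> w x y \<and> w x y \<le> 1"
  by (simp add: unit_on_def)

lemma mvt_half_line:
  fixes g :: "real \<Rightarrow> real"
  assumes "0 \<le> a" "a < b" and "\<And>t. 0 \<le> t \<Longrightarrow> (g has_real_derivative g' t) (at t within {0..})"
  shows "\<exists>z. a < z \<and> z < b \<and> g b - g a = (b - a) * g' z"
proof -
  have "(g has_derivative (*) (g' t)) (at t within {a..b})" if "t \<in> {a..b}" for t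
    using has_field_derivative_subset[OF assms(3)[of t], of "{a..b}"] that assms(1)
    by (auto simp: has_field_derivative_def)
  from mvt_simple[OF assms(2), of g "\<lambda>t. (*) (g' t)", OF this]
  show ?thesis by (auto simp: mult.commute)
qed

locale removal_flow =
  fixes k n :: nat and F :: graph
  assumes F: "F \<in> graphs k" and n: "0 < n"
begin

abbreviation V :: "nat set" where "V \<equiv> {1..n}"

abbreviation maps :: "(nat \<Rightarrow> nat) set" where "maps \<equiv> {1..k} \<rightarrow>\<^sub>E V"

abbreviation nk :: real where "nk \<equiv> real n ^ k"

abbreviation mF :: real where "mF \<equiv> real (card (arcs F))"

abbreviation eF :: real where "eF \<equiv> real (card (edge_pairs F))"

definition hom_density :: "(nat \<Rightarrow> nat \<Rightarrow> real) \<Rightarrow> real" where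
  "hom_density w = (\<Sum>\<phi>\<in>maps. hom_weight F w \<phi>) / nk"

text \<open>Minus the velocity in matrix form. As coordinates a and b of \<phi> are overwritten,
  each choice of the other coordinates occurs n^2 times, and division by \<open>nk\<close> gives the
  average over them.\<close>

definition rate :: "(nat \<Rightarrow> nat \<Rightarrow> real) \<Rightarrow> nat \<Rightarrow> nat \<Rightarrow> real" where
  "rate w x y = (\<Sum>(a, b)\<in>arcs F. \<Sum>\<phi>\<in>maps. hom_weight F w (\<phi>(a := x, b := y))) / nk"

lemma edgeD: "{a, b} \<in> F \<Longrightarrow> a \<in> {1..k} \<and> b \<in> {1..k}"
  using F by (auto simp: graphs_def pairs_def)

lemma edge_pairs_sub: "edge_pairs F \<subseteq> {1..k} \<times> {1..k}"
  using edgeD by (auto simp: edge_pairs_def)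

lemma arcs_sub: "arcs F \<subseteq> {1..k} \<times> {1..k}"
  using edgeD by (auto simp: arcs_def)

lemma arcsD: "(a, b) \<in> arcs F \<Longrightarrow> a \<in> {1..k} \<and> b \<in> {1..k} \<and> a \<noteq> b"
  using edgeD[of a b] by (simp add: arcs_def)

lemma finite_edge_pairs [simp]: "finite (edge_pairs F)"
  using edge_pairs_sub by (rule finite_subset) auto

lemma finite_arcs [simp]: "finite (arcs F)"
  using arcs_sub by (rule finite_subset) auto

lemma edge_pairs_arcs: "edge_pairs F \<subseteq> arcs F"
  by (auto simp: edge_pairs_def arcs_def)

lemma edge_pairs_asym: "(i, j) \<in> edge_pairs F \<Longrightarrow> i \<noteq> j \<and> (j, i) \<notin> edge_pairs F"
  by (auto simp: edge_pairs_def)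

lemma arcs_swap: "(a, b) \<in> arcs F \<longleftrightarrow> (b, a) \<in> arcs F"
  by (auto simp: arcs_def insert_commute)

lemma finite_maps [simp]: "finite maps" by (simp add: finite_PiE)

lemma card_maps: "real (card maps) = nk" by (simp add: card_PiE)

lemma nk_pos: "nk > 0" using n by simp

lemma maps_upd: "\<phi> \<in> maps \<Longrightarrow> a \<in> {1..k} \<Longrightarrow> x \<in> V \<Longrightarrow> \<phi>(a := x) \<in> maps"
  by (auto simp: PiE_iff extensional_def)

lemma maps_upd2:
  "\<phi> \<in> maps \<Longrightarrow> (a, b) \<in> arcs F \<Longrightarrow> x \<in> V \<Longrightarrow> y \<in> V \<Longrightarrow> \<phi>(a := x, b := y) \<in> maps"
  using arcs_sub by (intro maps_upd) auto

lemma maps_in: "\<phi> \<in> maps \<Longrightarrow> e \<in> edge_pairs F \<Longrightarrow> \<phi> (fst e) \<in> V \<and> \<phi> (snd e) \<in> V"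
  using edge_pairs_sub by (cases e) (auto simp: PiE_iff Pi_iff subset_iff)

lemma hom_weight_unit:
  assumes "unit_on V w" "\<phi> \<in> maps"
  shows "0 \<le> hom_weight F w \<phi> \<and> hom_weight F w \<phi> \<le> 1"
  unfolding hom_weight_def by (rule prod_in_unit) (use maps_in[OF assms(2)] unit_onD[OF assms(1)] in simp)

lemma hom_weight_mono:
  assumes "unit_on V w" "\<phi> \<in> maps" "\<And>x y. x \<in> V \<Longrightarrow> y \<in> V \<Longrightarrow> w x y \<le> w' x y"
  shows "hom_weight F w \<phi> \<le> hom_weight F w' \<phi>"
  unfolding hom_weight_def
  by (rule prod_mono) (use maps_in[OF assms(2)] unit_onD[OF assms(1)] assms(3) in simp)

lemma hom_weight_diff:
  assumes w: "unit_on V w" "unit_on V w'" and \<phi>: "\<phi> \<in> maps"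
    and c: "\<And>x y. x \<in> V \<Longrightarrow> y \<in> V \<Longrightarrow> \<bar>w x y - w' x y\<bar> \<le> c"
  shows "\<bar>hom_weight F w \<phi> - hom_weight F w' \<phi>\<bar> \<le> eF * c"
proof -
  have u: "norm (v (\<phi> (fst e)) (\<phi> (snd e))) \<le> 1" if "unit_on V v" "e \<in> edge_pairs F" for v e
    using maps_in[OF \<phi> that(2)] unit_onD[OF that(1)] by simp
  have "norm (hom_weight F w \<phi> - hom_weight F w' \<phi>) \<le>
      (\<Sum>e\<in>edge_pairs F. norm (w (\<phi> (fst e)) (\<phi> (snd e)) - w' (\<phi> (fst e)) (\<phi> (snd e))))"
    unfolding hom_weight_def by (rule norm_prod_diff) (use u w in auto)
  also have "\<dots> \<le> (\<Sum>e\<in>edge_pairs F. c)"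
    by (rule sum_mono) (use c maps_in[OF \<phi>] in auto)
  finally show ?thesis by simp
qed

lemma hom_density_unit:
  assumes "unit_on V w"
  shows "0 \<le> hom_density w"
  unfolding hom_density_def
  by (intro divide_nonneg_pos sum_nonneg nk_pos) (simp add: hom_weight_unit[OF assms])

lemma hom_density_mono:
  assumes "unit_on V w" "\<And>x y. x \<in> V \<Longrightarrow> y \<in> V \<Longrightarrow> w x y \<le> w' x y"
  shows "hom_density w \<le> hom_density w'"
  unfolding hom_density_def
  by (intro divide_right_mono sum_mono hom_weight_mono[OF assms(1) _ assms(2)] less_imp_le[OF nk_pos])

lemma sum_arcs_bound:
  assumes "\<And>a b \<phi>. (a, b) \<in> arcs F \<Longrightarrow> \<phi> \<in> maps \<Longrightarrow> \<bar>g a b \<phi>\<bar> \<le> c"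
  shows "\<bar>(\<Sum>(a, b)\<in>arcs F. \<Sum>\<phi>\<in>maps. g a b \<phi>) / nk\<bar> \<le> mF * c"
proof -
  have "\<bar>\<Sum>(a, b)\<in>arcs F. \<Sum>\<phi>\<in>maps. g a b \<phi>\<bar> \<le> (\<Sum>(a, b)\<in>arcs F. \<Sum>\<phi>\<in>maps. c)"
    unfolding case_prod_beta
    by (intro order.trans[OF sum_abs] sum_mono) (use assms in auto)
  also have "\<dots> = mF * c * nk" using card_maps by (simp add: case_prod_beta)
  finally show ?thesis using nk_pos by (simp add: pos_divide_le_eq)
qed

lemma rate_bounds:
  assumes w: "unit_on V w" and xy: "x \<in> V" "y \<in> V"
  shows "0 \<le> rate w x y" "rate w x y \<le> mF"
proof -
  have hw: "0 \<le> hom_weight F w (\<phi>(a := x, b := y)) \<and> hom_weight F w (\<phi>(a := x, b := y)) \<le> 1"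
    if "(a, b) \<in> arcs F" "\<phi> \<in> maps" for a b \<phi>
    using hom_weight_unit[OF w maps_upd2[OF that(2,1) xy]] .
  show "0 \<le> rate w x y"
    unfolding rate_def case_prod_beta
    by (intro divide_nonneg_pos sum_nonneg nk_pos) (use hw in auto)
  show "rate w x y \<le> mF"
  proof -
    have "\<bar>rate w x y\<bar> \<le> mF * 1"
      unfolding rate_def by (rule sum_arcs_bound) (use hw in auto)
    then show ?thesis by simp
  qed
qed

text \<open>This entrywise bound serves the existence of the flow and its Euler error; the
  comparison with a random graph needs the cut-norm version
  \<open>rate_cut_lipschitz\<close>.\<close>

lemma rate_sup_lipschitz:
  assumes w: "unit_on V w" "unit_on V w'" and xy: "x \<in> V" "y \<in> V"
    and c: "\<And>x y. x \<in> V \<Longrightarrow> y \<in> V \<Longrightarrow> \<bar>w x y - w' x y\<bar> \<le> c"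
  shows "\<bar>rate w x y - rate w' x y\<bar> \<le> mF * (eF * c)"
proof -
  have "rate w x y - rate w' x y = (\<Sum>(a, b)\<in>arcs F. \<Sum>\<phi>\<in>maps.
      hom_weight F w (\<phi>(a := x, b := y)) - hom_weight F w' (\<phi>(a := x, b := y))) / nk"
    by (simp add: rate_def sum_subtractf case_prod_beta diff_divide_distrib)
  then show ?thesis
    using sum_arcs_bound[of "\<lambda>a b \<phi>. hom_weight F w (\<phi>(a := x, b := y)) - hom_weight F w' (\<phi>(a := x, b := y))" "eF * c"]
      hom_weight_diff[OF w maps_upd2[OF _ _ xy] c] by auto
qed

lemma rate_sym: "rate w x y = rate w y x"
proof -
  have "(\<Sum>(a, b)\<in>arcs F. \<Sum>\<phi>\<in>maps. hom_weight F w (\<phi>(a := x, b := y))) =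
      (\<Sum>(a, b)\<in>arcs F. \<Sum>\<phi>\<in>maps. hom_weight F w (\<phi>(a := y, b := x)))"
  proof (rule sum.reindex_bij_witness[of _ prod.swap prod.swap])
    fix p assume "p \<in> arcs F"
    then have "fst p \<noteq> snd p" "prod.swap p \<in> arcs F" by (auto simp: arcs_def insert_commute)
    then show "(case prod.swap p of (a, b) \<Rightarrow> \<Sum>\<phi>\<in>maps. hom_weight F w (\<phi>(a := y, b := x))) =
        (case p of (a, b) \<Rightarrow> \<Sum>\<phi>\<in>maps. hom_weight F w (\<phi>(a := x, b := y)))"
      "prod.swap p \<in> arcs F"
      by (auto simp: case_prod_beta fun_upd_twist[of "fst p" "snd p"])
  next
    fix p assume "p \<in> arcs F"
    then show "prod.swap p \<in> arcs F" by (auto simp: arcs_def insert_commute)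
  qed auto
  then show ?thesis by (simp add: rate_def)
qed

text \<open>A copy through a pair of weight zero has weight zero. This makes 0 a barrier for the
  flow, since an entry that vanishes has no velocity.\<close>

lemma rate_eq_0:
  assumes "w x y = 0" "w y x = 0"
  shows "rate w x y = 0"
proof -
  have "hom_weight F w (\<phi>(a := x, b := y)) = 0" if ab: "(a, b) \<in> arcs F" for a b \<phi>
  proof (cases "a < b")
    case True
    then have "(a, b) \<in> edge_pairs F" using ab by (auto simp: arcs_def edge_pairs_def)
    then show ?thesis
      unfolding hom_weight_def using True assms by (intro prod_zero bexI[of _ "(a, b)"]) auto
  next
    case False
    then have "(b, a) \<in> edge_pairs F" using ab by (auto simp: arcs_def edge_pairs_def insert_commute)
    then show ?thesis
      unfolding hom_weight_def using False ab assms
      by (intro prod_zero bexI[of _ "(b, a)"]) (auto simp: arcs_def)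
  qed
  then show ?thesis unfolding rate_def by (simp add: case_prod_beta)
qed

lemma rate_cong:
  assumes "\<And>x y. x \<in> V \<Longrightarrow> y \<in> V \<Longrightarrow> w x y = w' x y" "x \<in> V" "y \<in> V"
  shows "rate w x y = rate w' x y"
proof -
  have "hom_weight F w (\<phi>(a := x, b := y)) = hom_weight F w' (\<phi>(a := x, b := y))"
    if "(a, b) \<in> arcs F" "\<phi> \<in> maps" for a b \<phi>
    unfolding hom_weight_def
    by (rule prod.cong[OF refl]) (use maps_in[OF maps_upd2[OF that(2,1) assms(2,3)]] assms(1) in blast)
  then show ?thesis unfolding rate_def
    by (intro arg_cong[where f = "\<lambda>x. x / nk"] sum.cong) auto
qed

text \<open>Double counting: summing over all values of the overwritten coordinates turns the
  overwritten maps back into all maps, so the rate on Z counts weighted copies, each as often as it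
  has arcs in Z.\<close>

lemma sum_rate:
  assumes Z: "Z \<subseteq> V \<times> V"
  shows "(\<Sum>(x, y)\<in>Z. rate w x y) = (real n)\<^sup>2 / nk *
    (\<Sum>(a, b)\<in>arcs F. \<Sum>\<phi>\<in>maps. of_bool ((\<phi> a, \<phi> b) \<in> Z) * hom_weight F w \<phi>)"
proof -
  have finZ: "finite Z" using Z by (rule finite_subset) auto
  have one: "(\<Sum>z\<in>Z. \<Sum>\<phi>\<in>maps. hom_weight F w (\<phi>(a := fst z, b := snd z))) =
      (real n)\<^sup>2 * (\<Sum>\<phi>\<in>maps. of_bool ((\<phi> a, \<phi> b) \<in> Z) * hom_weight F w \<phi>)"
    if ab: "(a, b) \<in> arcs F" for a b
  proof -
    have ab': "a \<in> {1..k}" "b \<in> {1..k}" "a \<noteq> b" using arcsD[OF ab] by auto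
    define g where "g \<phi> = of_bool ((\<phi> a, \<phi> b) \<in> Z) * hom_weight F w \<phi>" for \<phi>
    have inner: "(\<Sum>x\<in>V. \<Sum>y\<in>V. g (\<phi>(a := x, b := y))) =
        (\<Sum>z\<in>Z. hom_weight F w (\<phi>(a := fst z, b := snd z)))" for \<phi>
    proof -
      have "(\<Sum>x\<in>V. \<Sum>y\<in>V. g (\<phi>(a := x, b := y))) =
          (\<Sum>z\<in>V \<times> V. if z \<in> Z then hom_weight F w (\<phi>(a := fst z, b := snd z)) else 0)"
        unfolding sum.cartesian_product case_prod_beta using ab'(3)
        by (intro sum.cong) (auto simp: g_def)
      also have "\<dots> = (\<Sum>z\<in>(V \<times> V) \<inter> Z. hom_weight F w (\<phi>(a := fst z, b := snd z)))"
        by (rule sum.inter_restrict[symmetric]) simp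
      also have "(V \<times> V) \<inter> Z = Z" using Z by blast
      finally show ?thesis .
    qed
    have "(\<Sum>z\<in>Z. \<Sum>\<phi>\<in>maps. hom_weight F w (\<phi>(a := fst z, b := snd z))) =
        (\<Sum>\<phi>\<in>maps. \<Sum>x\<in>V. \<Sum>y\<in>V. g (\<phi>(a := x, b := y)))"
      unfolding inner by (rule sum.swap)
    also have "\<dots> = (real n)\<^sup>2 * (\<Sum>\<phi>\<in>maps. g \<phi>)"
      using sum_PiE_resample2[OF ab'(1,2), where U = "\<lambda>_. V" and g = g]
      by (simp add: power2_eq_square)
    finally show ?thesis unfolding g_def .
  qed
  have "(\<Sum>(x, y)\<in>Z. rate w x y) =
     (\<Sum>p\<in>arcs F. \<Sum>z\<in>Z. \<Sum>\<phi>\<in>maps. hom_weight F w (\<phi>(fst p := fst z, snd p := snd z))) / nk"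
    unfolding rate_def case_prod_beta sum_divide_distrib[symmetric]
    by (rule arg_cong[where f = "\<lambda>x. x / nk"], rule sum.swap)
  also have "(\<Sum>p\<in>arcs F. \<Sum>z\<in>Z. \<Sum>\<phi>\<in>maps. hom_weight F w (\<phi>(fst p := fst z, snd p := snd z))) =
     (\<Sum>p\<in>arcs F. (real n)\<^sup>2 * (\<Sum>\<phi>\<in>maps. of_bool ((\<phi> (fst p), \<phi> (snd p)) \<in> Z) * hom_weight F w \<phi>))"
  proof (rule sum.cong[OF refl])
    fix p assume "p \<in> arcs F"
    then show "(\<Sum>z\<in>Z. \<Sum>\<phi>\<in>maps. hom_weight F w (\<phi>(fst p := fst z, snd p := snd z))) =
       (real n)\<^sup>2 * (\<Sum>\<phi>\<in>maps. of_bool ((\<phi> (fst p), \<phi> (snd p)) \<in> Z) * hom_weight F w \<phi>)"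
      by (intro one) simp
  qed
  finally show ?thesis
    unfolding case_prod_beta sum_distrib_left[symmetric] by simp
qed

lemma sum_rate_all: "(\<Sum>(x, y)\<in>V \<times> V. rate w x y) = (real n)\<^sup>2 * (mF * hom_density w)"
proof -
  have "(\<Sum>\<phi>\<in>maps. of_bool ((\<phi> a, \<phi> b) \<in> V \<times> V) * hom_weight F w \<phi>) = (\<Sum>\<phi>\<in>maps. hom_weight F w \<phi>)"
    if "(a, b) \<in> arcs F" for a b
    using arcs_sub that by (intro sum.cong) (auto simp: PiE_iff Pi_iff subset_iff)
  then have "(\<Sum>(a, b)\<in>arcs F. \<Sum>\<phi>\<in>maps. of_bool ((\<phi> a, \<phi> b) \<in> V \<times> V) * hom_weight F w \<phi>) =
     (\<Sum>(a, b)\<in>arcs F. \<Sum>\<phi>\<in>maps. hom_weight F w \<phi>)"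
    by (intro sum.cong) auto
  then show ?thesis by (subst sum_rate) (auto simp: hom_density_def case_prod_beta)
qed

text \<open>Every copy has an arc in Z. Together with \<open>sum_rate_all\<close> this says that the
  total rate is at most \<open>mF\<close> times the rate on Z.\<close>

lemma sum_rate_hitting:
  assumes Z: "Z \<subseteq> V \<times> V" and w: "unit_on V w"
    and hit: "\<And>\<phi>. \<phi> \<in> maps \<Longrightarrow> \<exists>e\<in>edge_pairs F. (\<phi> (fst e), \<phi> (snd e)) \<in> Z"
  shows "(real n)\<^sup>2 * hom_density w \<le> (\<Sum>(x, y)\<in>Z. rate w x y)"
proof -
  have "(\<Sum>\<phi>\<in>maps. hom_weight F w \<phi>) \<le>
      (\<Sum>\<phi>\<in>maps. \<Sum>(a, b)\<in>arcs F. of_bool ((\<phi> a, \<phi> b) \<in> Z) * hom_weight F w \<phi>)"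
  proof (rule sum_mono)
    fix \<phi> assume \<phi>: "\<phi> \<in> maps"
    obtain e where e: "e \<in> edge_pairs F" "(\<phi> (fst e), \<phi> (snd e)) \<in> Z" using hit[OF \<phi>] by blast
    have "of_bool ((\<phi> (fst e), \<phi> (snd e)) \<in> Z) * hom_weight F w \<phi> \<le>
        (\<Sum>p\<in>arcs F. of_bool ((\<phi> (fst p), \<phi> (snd p)) \<in> Z) * hom_weight F w \<phi>)"
      using e edge_pairs_arcs hom_weight_unit[OF w \<phi>]
      by (intro member_le_sum[of e "arcs F" "\<lambda>p. of_bool ((\<phi> (fst p), \<phi> (snd p)) \<in> Z) * hom_weight F w \<phi>"]) auto
    then show "hom_weight F w \<phi> \<le> (\<Sum>(a, b)\<in>arcs F. of_bool ((\<phi> a, \<phi> b) \<in> Z) * hom_weight F w \<phi>)"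
      using e by (simp add: case_prod_beta)
  qed
  also have "\<dots> = (\<Sum>(a, b)\<in>arcs F. \<Sum>\<phi>\<in>maps. of_bool ((\<phi> a, \<phi> b) \<in> Z) * hom_weight F w \<phi>)"
    unfolding case_prod_beta by (rule sum.swap)
  finally have "(\<Sum>\<phi>\<in>maps. hom_weight F w \<phi>) / nk * (real n)\<^sup>2 \<le>
      (\<Sum>(a, b)\<in>arcs F. \<Sum>\<phi>\<in>maps. of_bool ((\<phi> a, \<phi> b) \<in> Z) * hom_weight F w \<phi>) / nk * (real n)\<^sup>2"
    using nk_pos by (intro mult_right_mono divide_right_mono) auto
  then show ?thesis by (subst sum_rate[OF Z]) (simp add: hom_density_def mult_ac)
qed

section \<open>Lipschitz bounds in the cut norm\<close>

lemma sum_weighted_hom_diff: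
  assumes w: "unit_on V w" "unit_on V w'"
    and cut: "cut_bound V V (\<lambda>x y. w x y - w' x y) (\<kappa> * (real n)\<^sup>2)"
    and c: "\<And>l x. l \<in> {1..k} \<Longrightarrow> x \<in> V \<Longrightarrow> 0 \<le> c l x \<and> c l x \<le> 1"
  shows "\<bar>\<Sum>\<phi>\<in>maps. (\<Prod>l\<in>{1..k}. c l (\<phi> l)) * (hom_weight F w \<phi> - hom_weight F w' \<phi>)\<bar> \<le> eF * \<kappa> * nk"
proof -
  have "\<bar>\<Sum>\<phi>\<in>maps. (\<Prod>l\<in>{1..k}. c l (\<phi> l)) *
      ((\<Prod>e\<in>edge_pairs F. (\<lambda>_. w) e (\<phi> (fst e)) (\<phi> (snd e))) -
       (\<Prod>e\<in>edge_pairs F. (\<lambda>_. w') e (\<phi> (fst e)) (\<phi> (snd e))))\<bar>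
     \<le> eF * \<kappa> * (\<Prod>l\<in>{1..k}. real (card V))"
  proof (rule counting_lemma, goal_cases)
    case (8 i j)
    then show ?case using cut by (simp add: power2_eq_square mult.assoc)
  next
    case (4 i j)
    then show ?case by (rule edge_pairs_asym)
  next
    case (5 l x)
    then show ?case by (rule c)
  next
    case (6 i j x y)
    then show ?case by (intro unit_onD[OF w(1)])
  next
    case (7 i j x y)
    then show ?case by (intro unit_onD[OF w(2)])
  qed (use edge_pairs_sub in auto)
  then show ?thesis unfolding hom_weight_def by simp
qed

lemma hom_density_cut_lipschitz:
  assumes w: "unit_on V w" "unit_on V w'"
    and cut: "cut_bound V V (\<lambda>x y. w x y - w' x y) (\<kappa> * (real n)\<^sup>2)"
  shows "\<bar>hom_density w - hom_density w'\<bar> \<le> eF * \<kappa>"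
proof -
  have "hom_density w - hom_density w' = (\<Sum>\<phi>\<in>maps. hom_weight F w \<phi> - hom_weight F w' \<phi>) / nk"
    by (simp add: hom_density_def sum_subtractf diff_divide_distrib)
  moreover have "\<bar>\<Sum>\<phi>\<in>maps. hom_weight F w \<phi> - hom_weight F w' \<phi>\<bar> \<le> eF * \<kappa> * nk"
    using sum_weighted_hom_diff[OF assms, of "\<lambda>_ _. 1"] by simp
  ultimately show ?thesis using nk_pos by (simp add: abs_divide pos_divide_le_eq)
qed

text \<open>Over a rectangle the rate is a count of copies with indicator weights at the two ends of
  an arc, to which the counting lemma applies. Thus the vector field is Lipschitz in the cut norm
  itself, and a cut-norm error grows only by a bounded factor per unit of time.\<close>

lemma rate_cut_lipschitz:
  assumes w: "unit_on V w" "unit_on V w'"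
    and cut: "cut_bound V V (\<lambda>x y. w x y - w' x y) (\<kappa> * (real n)\<^sup>2)"
  shows "cut_bound V V (\<lambda>x y. rate w x y - rate w' x y) (mF * eF * \<kappa> * (real n)\<^sup>2)"
  unfolding cut_bound_def
proof (intro allI impI)
  fix A B assume AB: "A \<subseteq> V" "B \<subseteq> V"
  define S where "S v a b = (\<Sum>\<phi>\<in>maps. of_bool (\<phi> a \<in> A \<and> \<phi> b \<in> B) * hom_weight F v \<phi>)" for v a b
  have R: "(\<Sum>x\<in>A. \<Sum>y\<in>B. rate v x y) = (real n)\<^sup>2 / nk * (\<Sum>(a, b)\<in>arcs F. S v a b)" for v
    using sum_rate[of "A \<times> B" v] AB by (simp add: sum.cartesian_product Sigma_mono S_def)
  have b: "\<bar>S w a b - S w' a b\<bar> \<le> eF * \<kappa> * nk" if ab: "(a, b) \<in> arcs F" for a b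
  proof -
    \<comment> \<open>Vertex weights forcing a into A and b into B.\<close>
    define c where "c l x = (if l = a then of_bool (x \<in> A) else if l = b then of_bool (x \<in> B) else 1 :: real)" for l x
    have ab': "a \<in> {1..k}" "b \<in> {1..k}" "a \<noteq> b" using arcsD[OF ab] by auto
    have "(\<Prod>l\<in>{1..k}. c l (\<phi> l)) = of_bool (\<phi> a \<in> A \<and> \<phi> b \<in> B)" for \<phi>
    proof -
      have "(\<Prod>l\<in>{1..k}. c l (\<phi> l)) = (\<Prod>l\<in>{a, b}. c l (\<phi> l))"
        by (rule prod.mono_neutral_right) (use ab' in \<open>auto simp: c_def\<close>)
      then show ?thesis using ab' by (simp add: c_def)
    qed
    then have "S w a b - S w' a b =
        (\<Sum>\<phi>\<in>maps. (\<Prod>l\<in>{1..k}. c l (\<phi> l)) * (hom_weight F w \<phi> - hom_weight F w' \<phi>))"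
      by (simp add: S_def right_diff_distrib sum_subtractf)
    then show ?thesis using sum_weighted_hom_diff[OF assms, of c] by (simp add: c_def)
  qed
  have "(\<Sum>x\<in>A. \<Sum>y\<in>B. rate w x y - rate w' x y) =
      (real n)\<^sup>2 / nk * (\<Sum>(a, b)\<in>arcs F. S w a b - S w' a b)"
    by (simp add: sum_subtractf R case_prod_beta right_diff_distrib)
  also have "\<bar>\<dots>\<bar> = (real n)\<^sup>2 / nk * \<bar>\<Sum>(a, b)\<in>arcs F. S w a b - S w' a b\<bar>"
    using nk_pos by (simp add: abs_mult)
  also have "\<dots> \<le> (real n)\<^sup>2 / nk * (mF * (eF * \<kappa> * nk))"
  proof (rule mult_left_mono)
    have "\<bar>\<Sum>p\<in>arcs F. S w (fst p) (snd p) - S w' (fst p) (snd p)\<bar> \<le> (\<Sum>p\<in>arcs F. eF * \<kappa> * nk)"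
    proof (rule order.trans[OF sum_abs sum_mono])
      fix p assume "p \<in> arcs F"
      then show "\<bar>S w (fst p) (snd p) - S w' (fst p) (snd p)\<bar> \<le> eF * \<kappa> * nk" by (intro b) simp
    qed
    then show "\<bar>\<Sum>(a, b)\<in>arcs F. S w a b - S w' a b\<bar> \<le> mF * (eF * \<kappa> * nk)"
      unfolding case_prod_beta by simp
  qed (use nk_pos in simp)
  also have "\<dots> = mF * eF * \<kappa> * (real n)\<^sup>2" using nk_pos by simp
  finally show "\<bar>\<Sum>x\<in>A. \<Sum>y\<in>B. rate w x y - rate w' x y\<bar> \<le> mF * eF * \<kappa> * (real n)\<^sup>2" .
qed

section \<open>Existence, monotonicity and decay of the flow\<close>

definition is_flow :: "(real \<Rightarrow> nat \<Rightarrow> nat \<Rightarrow> real) \<Rightarrow> bool" where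
  "is_flow w \<longleftrightarrow> (\<forall>t\<ge>0. unit_on V (w t)) \<and> (\<forall>t\<ge>0. \<forall>u\<in>V. \<forall>v\<in>V. w t u v = w t v u) \<and>
     (\<forall>t\<ge>0. \<forall>u\<in>V. \<forall>v\<in>V. ((\<lambda>s. w s u v) has_real_derivative - rate (w t) u v) (at t within {0..}))"

lemma flow_unit: "is_flow w \<Longrightarrow> 0 \<le> t \<Longrightarrow> unit_on V (w t)"
  and flow_sym: "is_flow w \<Longrightarrow> 0 \<le> t \<Longrightarrow> u \<in> V \<Longrightarrow> v \<in> V \<Longrightarrow> w t u v = w t v u"
  and flow_deriv: "is_flow w \<Longrightarrow> 0 \<le> t \<Longrightarrow> u \<in> V \<Longrightarrow> v \<in> V \<Longrightarrow>
    ((\<lambda>s. w s u v) has_real_derivative - rate (w t) u v) (at t within {0..})"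
  by (auto simp: is_flow_def)

text \<open>The vector field is clamped to \<open>[0, 1]\<close> to be globally Lipschitz; indexing by unordered pairs
  makes the solution symmetric. A coordinate below zero stands still, hence none gets there.\<close>

lemma flow_exists:
  assumes W: "unit_on V W" "\<And>u v. u \<in> V \<Longrightarrow> v \<in> V \<Longrightarrow> W u v = W v u"
  shows "\<exists>w. is_flow w \<and> (\<forall>u\<in>V. \<forall>v\<in>V. w 0 u v = W u v)"
proof -
  \<comment> \<open>The singletons \<open>{u, u}\<close> are included; they index the diagonal
    entries.\<close>
  define I where "I = (\<lambda>(u, v). {u, v}) ` (V \<times> V)"
  have I: "finite I" by (simp add: I_def)
  have Iin: "{u, v} \<in> I" if "u \<in> V" "v \<in> V" for u v using that by (auto simp: I_def)
  define cl :: "real \<Rightarrow> real" where "cl r = max 0 (min 1 r)" for r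
  have cl: "0 \<le> cl r" "cl r \<le> 1" "\<bar>cl r - cl s\<bar> \<le> \<bar>r - s\<bar>" for r s
    by (auto simp: cl_def)
  have cl_id: "cl r = r" if "0 \<le> r" "r \<le> 1" for r using that by (simp add: cl_def)
  define m where "m x = (\<lambda>u v. cl (x {u, v}))" for x :: "nat set \<Rightarrow> real"
  have m: "unit_on V (m x)" for x using cl by (simp add: m_def unit_on_def)
  define f where "f x e = - rate (m x) (Min e) (Max e)" for x e
  have MM: "Min e \<in> V" "Max e \<in> V" "{Min e, Max e} = e" if eI: "e \<in> I" for e
  proof -
    obtain u v where e: "e = {u, v}" "u \<in> V" "v \<in> V" using eI by (auto simp: I_def)
    then show "Min e \<in> V" "Max e \<in> V" by (auto simp: min_def max_def)
    show "{Min e, Max e} = e" using e by (auto simp: min_def max_def)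
  qed
  have f_eq: "f x {u, v} = - rate (m x) u v" for x u v
    using rate_sym[of "m x" u v] by (auto simp: f_def min_def max_def)
  have lip: "\<bar>f x i - f y i\<bar> \<le> mF * eF * c"
    if "i \<in> I" "0 \<le> c" "\<And>j. j \<in> I \<Longrightarrow> \<bar>x j - y j\<bar> \<le> c" for x y i c
  proof -
    have "\<bar>m x u v - m y u v\<bar> \<le> c" if "u \<in> V" "v \<in> V" for u v
      using cl(3)[of "x {u, v}" "y {u, v}"] \<open>\<And>j. j \<in> I \<Longrightarrow> \<bar>x j - y j\<bar> \<le> c\<close>[OF Iin[OF that]]
      by (simp add: m_def)
    then show ?thesis
      using rate_sup_lipschitz[OF m[of x] m[of y] MM(1,2)[OF that(1)], of c] by (simp add: f_def)
  qed
  have "\<exists>x. \<forall>e\<in>I. x 0 e = W (Min e) (Max e) \<and>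
      (\<forall>t\<ge>0. ((\<lambda>s. x s e) has_real_derivative f (x t) e) (at t within {0..}))"
  proof (rule lipschitz_ode_solution)
    show "finite I" by (rule I)
    show "0 \<le> mF * eF" by simp
  qed (rule lip)
  then obtain x where x: "\<And>e. e \<in> I \<Longrightarrow> x 0 e = W (Min e) (Max e)"
    "\<And>e t. e \<in> I \<Longrightarrow> 0 \<le> t \<Longrightarrow> ((\<lambda>s. x s e) has_real_derivative f (x t) e) (at t within {0..})"
    by blast
  have f_le: "f y e \<le> 0" if "e \<in> I" for y e
    using rate_bounds(1)[OF m MM(1,2)[OF that]] by (simp add: f_def)
  have x_le: "x t e \<le> x 0 e" if e: "e \<in> I" and t: "0 \<le> t" for t e
  proof (cases "t = 0")
    case False
    then obtain z where "x t e - x 0 e = (t - 0) * f (x z) e"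
      using mvt_half_line[of 0 t "\<lambda>s. x s e" "\<lambda>z. f (x z) e"] x(2)[OF e] t by auto
    moreover have "(t - 0) * f (x z) e \<le> 0"
      using f_le[OF e, of "x z"] t by (intro mult_nonneg_nonpos) auto
    ultimately show ?thesis by linarith
  qed simp
  have x0: "0 \<le> x 0 e \<and> x 0 e \<le> 1" if "e \<in> I" for e
    using x(1)[OF that] unit_onD[OF W(1) MM(1,2)[OF that]] by simp
  have x_nonneg: "0 \<le> x t e" if e: "e \<in> I" and t: "0 \<le> t" for t e
  proof (rule ccontr)
    assume neg: "\<not> 0 \<le> x t e"
    \<comment> \<open>The supremum of S is the last time at which the coordinate is nonnegative; the
      mean value theorem is applied between it and t.\<close>
    define S where "S = {s\<in>{0..t}. 0 \<le> x s e}"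
    have cont: "continuous_on {0..t} (\<lambda>s. x s e)"
      unfolding continuous_on_eq_continuous_within
    proof
      fix s assume "s \<in> {0..t}"
      then have "((\<lambda>s. x s e) has_real_derivative f (x s) e) (at s within {0..t})"
        by (intro DERIV_subset[OF x(2)[OF e]]) auto
      then show "continuous (at s within {0..t}) (\<lambda>s. x s e)" by (rule DERIV_continuous)
    qed
    have S: "S \<noteq> {}" "bdd_above S" "closed S"
    proof -
      show "S \<noteq> {}" using x0[OF e] t by (auto simp: S_def)
      show "bdd_above S" by (auto simp: S_def intro: bdd_aboveI[of _ t])
      show "closed S" unfolding S_def
        by (rule continuous_on_closed_Collect_le[OF continuous_on_const cont]) simp
    qed
    define s where "s = Sup S"
    have sS: "s \<in> S" unfolding s_def by (rule closed_contains_Sup[OF S])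
    then have s: "0 \<le> s" "s < t" "0 \<le> x s e" using neg by (auto simp: S_def intro: order.not_eq_order_implies_strict)
    obtain z where z: "s < z" "z < t" "x t e - x s e = (t - s) * f (x z) e"
      using mvt_half_line[of s t "\<lambda>s. x s e" "\<lambda>z. f (x z) e"] x(2)[OF e] s by auto
    have "z \<notin> S" using z S cSup_upper[of z S] unfolding s_def by auto
    then have "x z e < 0" using z s by (auto simp: S_def)
    then have "m (x z) (Min e) (Max e) = 0" "m (x z) (Max e) (Min e) = 0"
      using MM(3)[OF e] by (simp_all add: m_def cl_def insert_commute)
    then have "f (x z) e = 0" unfolding f_def using rate_eq_0 by simp
    then show False using z s neg by simp
  qed
  define w where "w t u v = x t {u, v}" for t u v
  have w01: "0 \<le> w t u v \<and> w t u v \<le> 1" if "0 \<le> t" "u \<in> V" "v \<in> V" for t u v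
    using x_nonneg[OF Iin[OF that(2,3)] that(1)] x_le[OF Iin[OF that(2,3)] that(1)] x0[OF Iin[OF that(2,3)]]
    by (simp add: w_def)
  have "is_flow w"
    unfolding is_flow_def
  proof (intro conjI allI ballI impI)
    fix t :: real assume t: "0 \<le> t"
    show "unit_on V (w t)" using w01[OF t] by (simp add: unit_on_def)
    fix u v assume uv: "u \<in> V" "v \<in> V"
    show "w t u v = w t v u" by (simp add: w_def insert_commute)
    have "rate (m (x t)) u v = rate (w t) u v"
      by (rule rate_cong[OF _ uv]) (use w01[OF t] in \<open>simp add: m_def w_def cl_id\<close>)
    then show "((\<lambda>s. w s u v) has_real_derivative - rate (w t) u v) (at t within {0..})"
      using x(2)[OF Iin[OF uv] t] by (simp add: f_eq w_def)
  qed
  moreover have "w 0 u v = W u v" if "u \<in> V" "v \<in> V" for u v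
    using x(1)[OF Iin[OF that]] W(2)[OF that] by (auto simp: w_def min_def max_def)
  ultimately show ?thesis by blast
qed

lemma flow_mvt:
  assumes w: "is_flow w" and "0 \<le> s" "s < t" "u \<in> V" "v \<in> V"
  shows "\<exists>z. s < z \<and> z < t \<and> w t u v - w s u v = - ((t - s) * rate (w z) u v)"
  using mvt_half_line[of s t "\<lambda>s. w s u v" "\<lambda>z. - rate (w z) u v"] flow_deriv[OF w] assms by auto

lemma flow_antimono:
  assumes w: "is_flow w" and "0 \<le> s" "s \<le> t" "u \<in> V" "v \<in> V"
  shows "w t u v \<le> w s u v"
proof (cases "s = t")
  case False
  then obtain z where z: "s < z" "w t u v - w s u v = - ((t - s) * rate (w z) u v)"
    using flow_mvt[OF w assms(2) _ assms(4,5), of t] assms by auto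
  have "0 \<le> rate (w z) u v"
    using rate_bounds(1)[OF flow_unit[OF w] assms(4,5)] z assms(2) by simp
  then have "0 \<le> (t - s) * rate (w z) u v" using assms(3) by simp
  then show ?thesis using z by linarith
qed simp

lemma flow_lipschitz:
  assumes w: "is_flow w" and "0 \<le> s" "s \<le> t" "u \<in> V" "v \<in> V"
  shows "\<bar>w t u v - w s u v\<bar> \<le> mF * (t - s)"
proof (cases "s = t")
  case False
  then obtain z where z: "s < z" "w t u v - w s u v = - ((t - s) * rate (w z) u v)"
    using flow_mvt[OF w assms(2) _ assms(4,5), of t] assms by auto
  have "0 \<le> rate (w z) u v" "rate (w z) u v \<le> mF"
    using rate_bounds[OF flow_unit[OF w] assms(4,5)] z assms(2) by simp_all
  then show ?thesis using z assms(3) by (simp add: abs_mult mult.commute[of mF] mult_left_mono)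
qed simp

text \<open>Error of one Euler step: within time h the entries move by at most
  \<open>mF * h\<close>, which changes the rate by at most \<open>mF * eF\<close> times as
  much.\<close>

lemma flow_euler:
  assumes w: "is_flow w" and t: "0 \<le> t" "0 \<le> h" and uv: "u \<in> V" "v \<in> V"
  shows "\<bar>w (t + h) u v - w t u v + h * rate (w t) u v\<bar> \<le> mF * eF * mF * h\<^sup>2"
proof (cases "h = 0")
  case False
  then obtain z where z: "t < z" "z < t + h" "w (t + h) u v - w t u v = - (h * rate (w z) u v)"
    using flow_mvt[OF w t(1) _ uv, of "t + h"] t by auto
  have "\<bar>w t x y - w z x y\<bar> \<le> mF * h" if "x \<in> V" "y \<in> V" for x y
  proof -
    have "\<bar>w z x y - w t x y\<bar> \<le> mF * (z - t)"
      by (rule flow_lipschitz[OF w t(1) _ that]) (use z in simp)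
    also have "\<dots> \<le> mF * h" using z by (intro mult_left_mono) auto
    finally show ?thesis by (simp add: abs_minus_commute)
  qed
  then have "\<bar>rate (w t) u v - rate (w z) u v\<bar> \<le> mF * (eF * (mF * h))"
    using t z by (intro rate_sup_lipschitz flow_unit[OF w] uv) auto
  then have "h * \<bar>rate (w t) u v - rate (w z) u v\<bar> \<le> h * (mF * (eF * (mF * h)))"
    using t by (intro mult_left_mono)
  moreover have "\<bar>w (t + h) u v - w t u v + h * rate (w t) u v\<bar> = h * \<bar>rate (w t) u v - rate (w z) u v\<bar>"
    unfolding z(3) using t by (simp add: abs_mult flip: right_diff_distrib)
  ultimately show ?thesis by (simp add: power2_eq_square mult_ac)
qed simp

lemma flow_sum_deriv:
  assumes w: "is_flow w" and "Z \<subseteq> V \<times> V" "0 \<le> t"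
  shows "((\<lambda>s. \<Sum>(x, y)\<in>Z. w s x y) has_real_derivative - (\<Sum>(x, y)\<in>Z. rate (w t) x y)) (at t within {0..})"
  unfolding case_prod_beta sum_negf[symmetric]
  by (rule DERIV_sum) (use assms flow_deriv[OF w] in auto)

text \<open>The mass is at most n^2 at time 0 and is lost at speed n^2 times
  \<open>mF * hom_density\<close>. The mean value theorem gives a time z before T at which this
  speed is at most the average n^2 / T, and the density only decreases afterwards.\<close>

lemma flow_density_decay:
  assumes w: "is_flow w" and T: "0 \<le> T"
  shows "T * (mF * hom_density (w T)) \<le> 1"
proof (cases "T = 0")
  case False
  then obtain z where z: "0 < z" "z < T" "(\<Sum>(x, y)\<in>V \<times> V. w T x y) - (\<Sum>(x, y)\<in>V \<times> V. w 0 x y) =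
      (T - 0) * - (\<Sum>(x, y)\<in>V \<times> V. rate (w z) x y)"
    using mvt_half_line[of 0 T "\<lambda>s. \<Sum>(x, y)\<in>V \<times> V. w s x y" "\<lambda>z. - (\<Sum>(x, y)\<in>V \<times> V. rate (w z) x y)"]
      flow_sum_deriv[OF w order.refl] T by auto
  have "0 \<le> (\<Sum>(x, y)\<in>V \<times> V. w T x y)"
    using unit_onD[OF flow_unit[OF w T]] by (intro sum_nonneg) auto
  moreover have "(\<Sum>(x, y)\<in>V \<times> V. w 0 x y) \<le> (\<Sum>(x, y)\<in>V \<times> V. 1)"
    using unit_onD[OF flow_unit[OF w order.refl]] by (intro sum_mono) auto
  moreover have "(\<Sum>(x, y)\<in>V \<times> V. 1) = (real n)\<^sup>2"
    by (simp add: case_prod_beta card_cartesian_product power2_eq_square)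
  ultimately have "T * ((real n)\<^sup>2 * (mF * hom_density (w z))) \<le> (real n)\<^sup>2"
    using z(3) unfolding sum_rate_all by simp
  then have "(real n)\<^sup>2 * (T * (mF * hom_density (w z))) \<le> (real n)\<^sup>2 * 1"
    by (simp add: mult_ac)
  then have "T * (mF * hom_density (w z)) \<le> 1"
    using n by (simp only: mult_le_cancel_left_pos zero_less_power of_nat_0_less_iff)
  moreover have "hom_density (w T) \<le> hom_density (w z)"
    using z by (intro hom_density_mono flow_unit[OF w T] flow_antimono[OF w]) auto
  then have "T * (mF * hom_density (w T)) \<le> T * (mF * hom_density (w z))"
    using T by (intro mult_left_mono) auto
  ultimately show ?thesis by linarith
qed simp

text \<open>By \<open>sum_rate_hitting\<close>, the total mass minus \<open>mF\<close> times the
  mass on Z never decreases, so every loss after T is paid for by the mass of Z at time T. The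
  premise \<open>hit\<close> is conditional because without edges no set can meet the copies; in
  that case nothing moves.\<close>

lemma flow_tail:
  assumes w: "is_flow w" and T: "0 \<le> T" "T \<le> t" and Z: "Z \<subseteq> V \<times> V"
    and hit: "\<And>\<phi>. edge_pairs F \<noteq> {} \<Longrightarrow> \<phi> \<in> maps \<Longrightarrow> \<exists>e\<in>edge_pairs F. (\<phi> (fst e), \<phi> (snd e)) \<in> Z"
  shows "(\<Sum>(x, y)\<in>V \<times> V. w T x y - w t x y) \<le> mF * (\<Sum>(x, y)\<in>Z. w T x y)"
proof -
  let ?h = "\<lambda>s. (\<Sum>(x, y)\<in>V \<times> V. w s x y) - mF * (\<Sum>(x, y)\<in>Z. w s x y)"
  let ?h' = "\<lambda>s. - (\<Sum>(x, y)\<in>V \<times> V. rate (w s) x y) - mF * - (\<Sum>(x, y)\<in>Z. rate (w s) x y)"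
  have h'_nonneg: "0 \<le> ?h' s" if s: "0 \<le> s" for s
  proof (cases "edge_pairs F = {}")
    case True
    have "arcs F = {}"
    proof (rule ccontr)
      assume "arcs F \<noteq> {}"
      then obtain a b where "a \<noteq> b" "{a, b} \<in> F" by (auto simp: arcs_def)
      then have "(min a b, max a b) \<in> edge_pairs F"
        by (auto simp: edge_pairs_def min_def max_def insert_commute)
      then show False using True by simp
    qed
    then show ?thesis by (simp add: rate_def)
  next
    case False
    then have "(real n)\<^sup>2 * hom_density (w s) \<le> (\<Sum>(x, y)\<in>Z. rate (w s) x y)"
      by (intro sum_rate_hitting[OF Z flow_unit[OF w s]] hit)
    then have "mF * ((real n)\<^sup>2 * hom_density (w s)) \<le> mF * (\<Sum>(x, y)\<in>Z. rate (w s) x y)"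
      by (intro mult_left_mono) auto
    then show ?thesis unfolding sum_rate_all by (simp add: mult_ac)
  qed
  have "?h T \<le> ?h t"
  proof (cases "T = t")
    case False
    have "(?h has_real_derivative ?h' s) (at s within {0..})" if "0 \<le> s" for s
      by (intro DERIV_diff DERIV_cmult flow_sum_deriv[OF w] Z order.refl that)
    then obtain z where z: "T < z" "?h t - ?h T = (t - T) * ?h' z"
      using mvt_half_line[of T t ?h ?h'] T False by auto
    have "0 \<le> (t - T) * ?h' z" using h'_nonneg[of z] z T by (intro mult_nonneg_nonneg) auto
    then show ?thesis using z by linarith
  qed simp
  moreover have "0 \<le> (\<Sum>(x, y)\<in>Z. w t x y)"
    using unit_onD[OF flow_unit[OF w, of t]] T Z by (intro sum_nonneg) auto
  then have "0 \<le> mF * (\<Sum>(x, y)\<in>Z. w t x y)" by simp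
  ultimately show ?thesis by (simp add: case_prod_beta sum_subtractf)
qed

text \<open>Entries decrease and stay nonnegative. The limit matrix is what the destination of a
  graph kernel is built from.\<close>

lemma flow_limit:
  assumes w: "is_flow w"
  shows "\<exists>l. unit_on V l \<and> (\<forall>u\<in>V. \<forall>v\<in>V. l u v = l v u \<and> ((\<lambda>t. w t u v) \<longlongrightarrow> l u v) at_top)"
proof -
  define l where "l u v = Inf ((\<lambda>t. w t u v) ` {0..})" for u v
  have bdd: "bdd_below ((\<lambda>t. w t u v) ` {0..})" if "u \<in> V" "v \<in> V" for u v
    using unit_onD[OF flow_unit[OF w] that] by (auto intro!: bdd_belowI[of _ 0])
  have "0 \<le> l u v \<and> l u v \<le> 1" if uv: "u \<in> V" "v \<in> V" for u v
  proof
    show "0 \<le> l u v" unfolding l_def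
      using unit_onD[OF flow_unit[OF w] uv] by (intro cInf_greatest) auto
    have "l u v \<le> w 0 u v" unfolding l_def by (rule cInf_lower[OF _ bdd[OF uv]]) auto
    then show "l u v \<le> 1" using unit_onD[OF flow_unit[OF w order.refl] uv] by linarith
  qed
  moreover have "l u v = l v u" if "u \<in> V" "v \<in> V" for u v
    unfolding l_def using flow_sym[OF w _ that] by (intro arg_cong[where f = Inf] image_cong) auto
  moreover have "((\<lambda>t. w t u v) \<longlongrightarrow> l u v) at_top" if uv: "u \<in> V" "v \<in> V" for u v
  proof (rule decreasing_tendsto)
    show "\<forall>\<^sub>F t in at_top. l u v \<le> w t u v"
      using eventually_ge_at_top[of 0]
      by eventually_elim (auto simp: l_def intro!: cInf_lower bdd uv)
    fix x assume "l u v < x"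
    then obtain t where t: "0 \<le> t" "w t u v < x"
      unfolding l_def using cInf_lessD[of "(\<lambda>t. w t u v) ` {0..}" x] by auto
    show "\<forall>\<^sub>F t in at_top. w t u v < x"
      using eventually_ge_at_top[of t]
      by eventually_elim (use flow_antimono[OF w t(1) _ uv] t(2) in force)
  qed
  ultimately show ?thesis by (intro exI[of _ l]) (auto simp: unit_on_def)
qed

end

section \<open>Trajectories of kernels\<close>

text \<open>Each element outside E contributes the factor p + (1 - p) = 1. For p in [0, 1] the sum
  is the probability that a random subset contains E.\<close>

lemma sum_supersets_prod:
  fixes p :: "'a \<Rightarrow> real"
  assumes D: "finite D" and E: "E \<subseteq> D"
  shows "(\<Sum>A\<in>{A. E \<subseteq> A \<and> A \<subseteq> D}. (\<Prod>x\<in>A. p x) * (\<Prod>x\<in>D - A. 1 - p x)) = (\<Prod>x\<in>E. p x)"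
proof -
  have finE: "finite E" using D E by (rule finite_subset[rotated])
  have "(\<Sum>A\<in>{A. E \<subseteq> A \<and> A \<subseteq> D}. (\<Prod>x\<in>A. p x) * (\<Prod>x\<in>D - A. 1 - p x)) =
      (\<Sum>B\<in>Pow (D - E). (\<Prod>x\<in>E. p x) * ((\<Prod>x\<in>B. p x) * (\<Prod>x\<in>(D - E) - B. 1 - p x)))"
  proof (rule sum.reindex_bij_witness[of _ "\<lambda>B. E \<union> B" "\<lambda>A. A - E"])
    fix A assume A: "A \<in> {A. E \<subseteq> A \<and> A \<subseteq> D}"
    then have fin: "finite (A - E)" using D by (auto intro: finite_subset)
    have "(\<Prod>x\<in>A. p x) = (\<Prod>x\<in>E. p x) * (\<Prod>x\<in>A - E. p x)"
    proof -
      have "A = E \<union> (A - E)" using A by auto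
      then have "(\<Prod>x\<in>A. p x) = (\<Prod>x\<in>E \<union> (A - E). p x)" by simp
      also have "\<dots> = (\<Prod>x\<in>E. p x) * (\<Prod>x\<in>A - E. p x)"
        by (rule prod.union_disjoint) (use finE fin in auto)
      finally show ?thesis .
    qed
    moreover have "(D - E) - (A - E) = D - A" using A by auto
    ultimately show "(\<Prod>x\<in>E. p x) * ((\<Prod>x\<in>A - E. p x) * (\<Prod>x\<in>(D - E) - (A - E). 1 - p x)) =
        (\<Prod>x\<in>A. p x) * (\<Prod>x\<in>D - A. 1 - p x)" by simp
  qed (use E in auto)
  also have "\<dots> = (\<Prod>x\<in>E. p x) * (\<Prod>x\<in>D - E. p x + (1 - p x))"
    using D by (subst prod_add) (auto simp: sum_distrib_left)
  finally show ?thesis by simp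
qed

section \<open>The velocity of the removal rule as a rooted density\<close>

locale graphon_space = prob_space M + removal_flow k n F
  for M :: "'a measure" and k n F
begin

sublocale pair: pair_prob_space M M by unfold_locales

lemma prob_PiM: "prob_space (Pi\<^sub>M J (\<lambda>_. M))"
  by (intro prob_space_PiM) (rule prob_space_axioms)

lemma space_upd:
  assumes "z \<in> space (Pi\<^sub>M ({1..k} - {a, b}) (\<lambda>_. M))" "x \<in> space M" "y \<in> space M" "i \<in> {1..k}"
  shows "(z(a := x, b := y)) i \<in> space M"
  using assms by (auto simp: space_PiM PiE_iff)

lemma measurable_upd:
  assumes "i \<in> {1..k}"
  shows "(\<lambda>q. ((snd q)(a := fst (fst q), b := snd (fst q))) i) \<in>
    (M \<Otimes>\<^sub>M M) \<Otimes>\<^sub>M Pi\<^sub>M ({1..k} - {a, b}) (\<lambda>_. M) \<rightarrow>\<^sub>M M"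
proof -
  consider "i = b" | "i \<noteq> b" "i = a" | "i \<in> {1..k} - {a, b}" using assms by auto
  then show ?thesis by cases (simp_all add: measurable_component_singleton)
qed

lemma measurable_kernel_upd:
  assumes U: "kernel M U" and ij: "i \<in> {1..k}" "j \<in> {1..k}"
  shows "(\<lambda>q. U (((snd q)(a := fst (fst q), b := snd (fst q))) i) (((snd q)(a := fst (fst q), b := snd (fst q))) j))
    \<in> borel_measurable ((M \<Otimes>\<^sub>M M) \<Otimes>\<^sub>M Pi\<^sub>M ({1..k} - {a, b}) (\<lambda>_. M))"
proof -
  have "(\<lambda>p. U (fst p) (snd p)) \<in> borel_measurable (M \<Otimes>\<^sub>M M)"
    using U by (simp add: kernel_def case_prod_unfold)
  from measurable_compose[OF measurable_Pair[OF measurable_upd[OF ij(1), of a b] measurable_upd[OF ij(2), of a b]] this]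
  show ?thesis by simp
qed

lemma measurable_slice:
  assumes f: "(\<lambda>q. f (fst q) (snd q)) \<in> borel_measurable ((M \<Otimes>\<^sub>M M) \<Otimes>\<^sub>M N)"
    and "x \<in> space M" "y \<in> space M"
  shows "f (x, y) \<in> borel_measurable N"
proof -
  have "(\<lambda>z. ((x, y), z)) \<in> N \<rightarrow>\<^sub>M (M \<Otimes>\<^sub>M M) \<Otimes>\<^sub>M N"
    using assms by (intro measurable_Pair1') (simp add: space_pair_measure)
  from measurable_compose[OF this f] show ?thesis by simp
qed

lemma hom_weight_joint_measurable:
  assumes "kernel M U"
  shows "(\<lambda>q. hom_weight F U ((snd q)(a := fst (fst q), b := snd (fst q))))
    \<in> borel_measurable ((M \<Otimes>\<^sub>M M) \<Otimes>\<^sub>M Pi\<^sub>M ({1..k} - {a, b}) (\<lambda>_. M))"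
  unfolding hom_weight_def
  by (rule borel_measurable_prod, rule measurable_kernel_upd[OF assms]) (use edge_pairs_sub in auto)

lemma hom_weight_measurable:
  assumes "kernel M U" "x \<in> space M" "y \<in> space M"
  shows "(\<lambda>z. hom_weight F U (z(a := x, b := y))) \<in> borel_measurable (Pi\<^sub>M ({1..k} - {a, b}) (\<lambda>_. M))"
  using measurable_slice[of "\<lambda>p z. hom_weight F U (z(a := fst p, b := snd p))", OF hom_weight_joint_measurable[OF assms(1)] assms(2,3)]
  by simp

lemma kernel_bound:
  assumes "kernel M U"
  obtains C where "1 \<le> C" "\<And>x y. x \<in> space M \<Longrightarrow> y \<in> space M \<Longrightarrow> \<bar>U x y\<bar> \<le> C"
proof -
  obtain C where "\<forall>x\<in>space M. \<forall>y\<in>space M. \<bar>U x y\<bar> \<le> C" using assms by (auto simp: kernel_def)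
  then show thesis by (intro that[of "max 1 C"]) (auto simp: le_max_iff_disj)
qed

lemma integrable_hom_weight:
  assumes U: "kernel M U" and xy: "x \<in> space M" "y \<in> space M"
  shows "integrable (Pi\<^sub>M ({1..k} - {a, b}) (\<lambda>_. M)) (\<lambda>z. hom_weight F U (z(a := x, b := y)))"
proof -
  interpret P: prob_space "Pi\<^sub>M ({1..k} - {a, b}) (\<lambda>_. M)" by (rule prob_PiM)
  obtain C where C: "1 \<le> C" "\<And>x y. x \<in> space M \<Longrightarrow> y \<in> space M \<Longrightarrow> \<bar>U x y\<bar> \<le> C"
    by (rule kernel_bound[OF U]) blast
  show ?thesis
  proof (rule P.integrable_const_bound[of _ "C ^ card (edge_pairs F)"])
    show "AE z in Pi\<^sub>M ({1..k} - {a, b}) (\<lambda>_. M). norm (hom_weight F U (z(a := x, b := y))) \<le> C ^ card (edge_pairs F)"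
    proof (rule AE_I2)
      fix z assume z: "z \<in> space (Pi\<^sub>M ({1..k} - {a, b}) (\<lambda>_. M))"
      have "norm (hom_weight F U (z(a := x, b := y))) =
          (\<Prod>e\<in>edge_pairs F. \<bar>U ((z(a := x, b := y)) (fst e)) ((z(a := x, b := y)) (snd e))\<bar>)"
        by (simp only: hom_weight_def real_norm_def abs_prod)
      also have "\<dots> \<le> (\<Prod>e\<in>edge_pairs F. C)"
      proof (rule prod_mono, intro conjI)
        fix e assume "e \<in> edge_pairs F"
        then have "fst e \<in> {1..k}" "snd e \<in> {1..k}" using edge_pairs_sub by auto
        then show "\<bar>U ((z(a := x, b := y)) (fst e)) ((z(a := x, b := y)) (snd e))\<bar> \<le> C"
          by (intro C(2) space_upd[OF z xy])
      qed simp
      finally show "norm (hom_weight F U (z(a := x, b := y))) \<le> C ^ card (edge_pairs F)" by simp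
    qed
  qed (rule hom_weight_measurable[OF U xy])
qed

text \<open>Minus the velocity: the induced densities of all graphs containing F are merged into one
  density of F, rooted at x and y.\<close>

definition vel :: "'a kern \<Rightarrow> 'a kern" where
  "vel U x y = (\<Sum>(a, b)\<in>arcs F. \<integral>z. hom_weight F U (z(a := x, b := y)) \<partial>Pi\<^sub>M ({1..k} - {a, b}) (\<lambda>_. M))"

lemma measurable_vel:
  assumes "kernel M U"
  shows "(\<lambda>p. vel U (fst p) (snd p)) \<in> borel_measurable (M \<Otimes>\<^sub>M M)"
  unfolding vel_def case_prod_beta
proof (rule borel_measurable_sum)
  fix e
  interpret P: prob_space "Pi\<^sub>M ({1..k} - {fst e, snd e}) (\<lambda>_. M)" by (rule prob_PiM)
  show "(\<lambda>p. \<integral>z. hom_weight F U (z(fst e := fst p, snd e := snd p)) \<partial>Pi\<^sub>M ({1..k} - {fst e, snd e}) (\<lambda>_. M))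
      \<in> borel_measurable (M \<Otimes>\<^sub>M M)"
    using hom_weight_joint_measurable[OF assms, of "fst e" "snd e"]
    by (intro P.borel_measurable_lebesgue_integral) (simp add: case_prod_beta)
qed

abbreviation ord_pairs :: "(nat \<times> nat) set" where
  "ord_pairs \<equiv> {(i, j). 1 \<le> i \<and> i < j \<and> j \<le> k}"

lemma finite_ord_pairs: "finite ord_pairs"
  by (rule finite_subset[of _ "{1..k} \<times> {1..k}"]) auto

text \<open>In terms of increasing pairs, the two products in \<open>t_ind\<close> run over
  complementary index sets, which is the form summed in \<open>sum_supersets_prod\<close>.\<close>

lemma bij_edge_pairs:
  "bij_betw edge_pairs {H \<in> graphs k. F \<subseteq> H} {A. edge_pairs F \<subseteq> A \<and> A \<subseteq> ord_pairs}"
proof (rule bij_betwI[of _ _ _ "\<lambda>A. (\<lambda>(i, j). {i, j}) ` A"])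
  have edge: "\<exists>i j. e = {i, j} \<and> 1 \<le> i \<and> i < j \<and> j \<le> k" if eH: "H \<in> graphs k" "e \<in> H" for H e
  proof -
    have "e \<subseteq> {1..k}" "card e = 2" using eH by (auto simp: graphs_def pairs_def)
    then obtain u v where uv: "e = {u, v}" "u \<noteq> v" by (auto simp: card_2_iff)
    then have "e = {min u v, max u v}" "1 \<le> min u v" "min u v < max u v" "max u v \<le> k"
      using \<open>e \<subseteq> {1..k}\<close> by (auto simp: min_def max_def)
    then show ?thesis by blast
  qed
  show "edge_pairs \<in> {H \<in> graphs k. F \<subseteq> H} \<rightarrow> {A. edge_pairs F \<subseteq> A \<and> A \<subseteq> ord_pairs}"
    by (auto simp: edge_pairs_def graphs_def pairs_def)
  show "(\<lambda>A. (\<lambda>(i, j). {i, j}) ` A) \<in> {A. edge_pairs F \<subseteq> A \<and> A \<subseteq> ord_pairs} \<rightarrow> {H \<in> graphs k. F \<subseteq> H}"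
  proof
    fix A assume A: "A \<in> {A. edge_pairs F \<subseteq> A \<and> A \<subseteq> ord_pairs}"
    have "F \<subseteq> (\<lambda>(i, j). {i, j}) ` A"
    proof
      fix e assume e: "e \<in> F"
      then obtain i j where "e = {i, j}" "i < j" using edge[OF F] by blast
      then have "(i, j) \<in> A" using A e by (auto simp: edge_pairs_def)
      then show "e \<in> (\<lambda>(i, j). {i, j}) ` A" using \<open>e = {i, j}\<close> by force
    qed
    moreover have "(\<lambda>(i, j). {i, j}) ` A \<in> graphs k"
    proof -
      have "{i, j} \<in> pairs k" if "(i, j) \<in> A" for i j
      proof -
        have "1 \<le> i" "i < j" "j \<le> k" using A that by auto
        then show ?thesis by (auto simp: pairs_def)
      qed
      then show ?thesis by (auto simp: graphs_def)
    qed
    ultimately show "(\<lambda>(i, j). {i, j}) ` A \<in> {H \<in> graphs k. F \<subseteq> H}" by simp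
  qed
  show "(\<lambda>(i, j). {i, j}) ` edge_pairs H = H" if H: "H \<in> {H \<in> graphs k. F \<subseteq> H}" for H
  proof (rule set_eqI)
    fix e
    show "e \<in> (\<lambda>(i, j). {i, j}) ` edge_pairs H \<longleftrightarrow> e \<in> H"
    proof
      assume e: "e \<in> H"
      then obtain i j where "e = {i, j}" "i < j" using edge[of H e] H by blast
      then have "(i, j) \<in> edge_pairs H" using e by (simp add: edge_pairs_def)
      then show "e \<in> (\<lambda>(i, j). {i, j}) ` edge_pairs H" using \<open>e = {i, j}\<close> by force
    qed (auto simp: edge_pairs_def)
  qed
  show "edge_pairs ((\<lambda>(i, j). {i, j}) ` A) = A" if A: "A \<in> {A. edge_pairs F \<subseteq> A \<and> A \<subseteq> ord_pairs}" for A
  proof (rule set_eqI)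
    fix e :: "nat \<times> nat"
    obtain i j where e: "e = (i, j)" by (cases e)
    have "(i, j) \<in> A" if "i < j" "{i, j} = {i', j'}" "(i', j') \<in> A" for i' j'
    proof -
      have "i' < j'" using A that by auto
      then have "i = i'" "j = j'" using that by (auto simp: doubleton_eq_iff)
      then show ?thesis using that by simp
    qed
    then show "e \<in> edge_pairs ((\<lambda>(i, j). {i, j}) ` A) \<longleftrightarrow> e \<in> A"
      using A unfolding e by (auto simp: edge_pairs_def)
  qed
qed

text \<open>Pointwise, the induced weights of all graphs containing F add up to the weight of F.
  Kernels on a trajectory are not assumed to have values in [0, 1], so integrability of each summand
  comes from the bound C.\<close>

lemma sum_t_ind_supergraphs:
  assumes U: "kernel M U" and xy: "x \<in> space M" "y \<in> space M"
  shows "(\<Sum>H\<in>{H \<in> graphs k. F \<subseteq> H}. t_ind M k H a b U x y) =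
    (\<integral>z. hom_weight F U (z(a := x, b := y)) \<partial>Pi\<^sub>M ({1..k} - {a, b}) (\<lambda>_. M))"
proof -
  let ?N = "Pi\<^sub>M ({1..k} - {a, b}) (\<lambda>_. M)"
  interpret P: prob_space ?N by (rule prob_PiM)
  define p where "p z e = U ((z(a := x, b := y)) (fst e)) ((z(a := x, b := y)) (snd e))" for z and e :: "nat \<times> nat"
  define g where "g A z = (\<Prod>e\<in>A. p z e) * (\<Prod>e\<in>ord_pairs - A. 1 - p z e)" for A z
  have t: "t_ind M k H a b U x y = (\<integral>z. g (edge_pairs H) z \<partial>?N)" if H: "H \<in> graphs k" for H
  proof -
    have "{(i, j). 1 \<le> i \<and> i < j \<and> j \<le> k \<and> {i, j} \<in> H} = edge_pairs H"
      using H by (auto simp: edge_pairs_def graphs_def pairs_def)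
    moreover have "{(i, j). 1 \<le> i \<and> i < j \<and> j \<le> k \<and> {i, j} \<notin> H} = ord_pairs - edge_pairs H"
      by (auto simp: edge_pairs_def)
    ultimately show ?thesis
      by (simp add: t_ind_def g_def p_def Let_def case_prod_beta)
  qed
  obtain C where C: "1 \<le> C" "\<And>x y. x \<in> space M \<Longrightarrow> y \<in> space M \<Longrightarrow> \<bar>U x y\<bar> \<le> C"
    by (rule kernel_bound[OF U]) blast
  have int: "integrable ?N (g A)" if A: "A \<subseteq> ord_pairs" for A
  proof -
    have finA: "finite A" using A finite_ord_pairs by (rule finite_subset)
    have p_meas: "(\<lambda>z. p z e) \<in> borel_measurable ?N" if "e \<in> ord_pairs" for e
    proof -
      have "fst e \<in> {1..k}" "snd e \<in> {1..k}" using that by auto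
      then show ?thesis
        using measurable_slice[of "\<lambda>p z. U ((z(a := fst p, b := snd p)) (fst e)) ((z(a := fst p, b := snd p)) (snd e))",
          OF measurable_kernel_upd[OF U] xy] by (simp add: p_def)
    qed
    show ?thesis
    proof (rule P.integrable_const_bound[of _ "C ^ card A * (1 + C) ^ card (ord_pairs - A)"])
      show "g A \<in> borel_measurable ?N"
        unfolding g_def using A p_meas
        by (intro borel_measurable_times borel_measurable_prod borel_measurable_diff borel_measurable_const) auto
      show "AE z in ?N. norm (g A z) \<le> C ^ card A * (1 + C) ^ card (ord_pairs - A)"
      proof (rule AE_I2)
        fix z assume z: "z \<in> space ?N"
        have pC: "\<bar>p z e\<bar> \<le> C" if "e \<in> ord_pairs" for e
          unfolding p_def by (intro C(2) space_upd[OF z xy]) (use that in auto)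
        have "norm (g A z) = (\<Prod>e\<in>A. \<bar>p z e\<bar>) * (\<Prod>e\<in>ord_pairs - A. \<bar>1 - p z e\<bar>)"
          by (simp add: g_def abs_mult abs_prod)
        also have "\<dots> \<le> (\<Prod>e\<in>A. C) * (\<Prod>e\<in>ord_pairs - A. 1 + C)"
        proof (intro mult_mono prod_mono conjI)
          fix e assume "e \<in> A"
          then show "\<bar>p z e\<bar> \<le> C" using pC A by auto
        next
          fix e assume "e \<in> ord_pairs - A"
          then show "\<bar>1 - p z e\<bar> \<le> 1 + C" using pC[of e] by auto
        qed (use C(1) in \<open>auto intro!: prod_nonneg\<close>)
        finally show "norm (g A z) \<le> C ^ card A * (1 + C) ^ card (ord_pairs - A)" by simp
      qed
    qed
  qed
  have "(\<Sum>H\<in>{H \<in> graphs k. F \<subseteq> H}. t_ind M k H a b U x y) =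
      (\<Sum>H\<in>{H \<in> graphs k. F \<subseteq> H}. \<integral>z. g (edge_pairs H) z \<partial>?N)"
    by (rule sum.cong) (auto simp: t)
  also have "\<dots> = (\<Sum>A\<in>{A. edge_pairs F \<subseteq> A \<and> A \<subseteq> ord_pairs}. \<integral>z. g A z \<partial>?N)"
    by (rule sum.reindex_bij_betw[OF bij_edge_pairs])
  also have "\<dots> = (\<integral>z. (\<Sum>A\<in>{A. edge_pairs F \<subseteq> A \<and> A \<subseteq> ord_pairs}. g A z) \<partial>?N)"
    by (rule Bochner_Integration.integral_sum[symmetric]) (use int in auto)
  also have "\<dots> = (\<integral>z. hom_weight F U (z(a := x, b := y)) \<partial>?N)"
  proof (rule Bochner_Integration.integral_cong[OF refl])
    fix z
    have "edge_pairs F \<subseteq> ord_pairs" using edge_pairs_sub by (auto simp: edge_pairs_def)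
    from sum_supersets_prod[OF finite_ord_pairs this, of "p z"]
    show "(\<Sum>A\<in>{A. edge_pairs F \<subseteq> A \<and> A \<subseteq> ord_pairs}. g A z) = hom_weight F U (z(a := x, b := y))"
      by (simp add: g_def hom_weight_def p_def)
  qed
  finally show ?thesis .
qed

text \<open>Row H' of the rule has a single entry 1, and whenever H' contains F the deleted pairs
  are the arcs of F, whatever else H' contains. Only the sum over supergraphs of F remains.\<close>

lemma velocity_removal:
  assumes U: "kernel M U" and xy: "x \<in> space M" "y \<in> space M"
  shows "velocity M k (removal_rule F) U x y = - vel U x y"
proof -
  let ?P = "{(a, b). a \<in> {1..k} \<and> b \<in> {1..k} \<and> a \<noteq> b}"
  have finP: "finite ?P" by (rule finite_subset[of _ "{1..k} \<times> {1..k}"]) auto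
  have "(\<Sum>H\<in>graphs k. \<Sum>p\<in>?P. removal_rule F H' H * t_ind M k H' (fst p) (snd p) U x y *
        (of_bool ({fst p, snd p} \<in> H - H') - of_bool ({fst p, snd p} \<in> H' - H))) =
      (\<Sum>p\<in>arcs F. - (if F \<subseteq> H' then t_ind M k H' (fst p) (snd p) U x y else 0))" (is "?l = ?r")
    if H': "H' \<in> graphs k" for H'
  proof -
    define q where "q H p = t_ind M k H' (fst p) (snd p) U x y *
        (of_bool ({fst p, snd p} \<in> H - H') - of_bool ({fst p, snd p} \<in> H' - H))" for H p
    define T where "T = (if F \<subseteq> H' then H' - F else H')"
    have T: "T \<in> graphs k" using H' by (auto simp: graphs_def T_def)
    have "?l = (\<Sum>H\<in>graphs k. of_bool (H = T) * (\<Sum>p\<in>?P. q H p))"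
      unfolding q_def T_def removal_rule_def by (simp only: mult.assoc sum_distrib_left)
    also have "\<dots> = (\<Sum>H\<in>graphs k. if H = T then (\<Sum>p\<in>?P. q H p) else 0)"
      by (intro sum.cong) simp_all
    also have "\<dots> = (\<Sum>p\<in>?P. q T p)"
      using T by (simp only: sum.delta[OF finite_graphs] if_True)
    also have "\<dots> = (\<Sum>p\<in>?P. if p \<in> arcs F then - (if F \<subseteq> H' then t_ind M k H' (fst p) (snd p) U x y else 0) else 0)"
      by (intro sum.cong) (auto simp: arcs_def q_def T_def)
    also have "\<dots> = (\<Sum>p\<in>?P \<inter> arcs F. - (if F \<subseteq> H' then t_ind M k H' (fst p) (snd p) U x y else 0))"
      by (rule sum.inter_restrict[OF finP, symmetric])
    also have "?P \<inter> arcs F = arcs F" using arcsD by auto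
    finally show ?thesis .
  qed
  then have "velocity M k (removal_rule F) U x y =
      (\<Sum>H'\<in>graphs k. \<Sum>p\<in>arcs F. - (if F \<subseteq> H' then t_ind M k H' (fst p) (snd p) U x y else 0))"
    unfolding velocity_def case_prod_beta by (intro sum.cong) auto
  also have "\<dots> = (\<Sum>p\<in>arcs F. - (\<Sum>H'\<in>graphs k. if F \<subseteq> H' then t_ind M k H' (fst p) (snd p) U x y else 0))"
    by (subst sum.swap) (simp add: sum_negf)
  also have "\<dots> = (\<Sum>p\<in>arcs F. - (\<Sum>H'\<in>{H' \<in> graphs k. F \<subseteq> H'}. t_ind M k H' (fst p) (snd p) U x y))"
    by (simp only: sum.inter_filter[OF finite_graphs])
  finally show ?thesis
    unfolding sum_t_ind_supergraphs[OF U xy] by (simp add: vel_def case_prod_beta sum_negf)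
qed

end

section \<open>Uniqueness of trajectories\<close>

lemma prod_diff_bound:
  fixes u w :: "'a \<Rightarrow> real"
  assumes C: "0 < C" and u: "\<And>e. e \<in> E \<Longrightarrow> \<bar>u e\<bar> \<le> C" and w: "\<And>e. e \<in> E \<Longrightarrow> \<bar>w e\<bar> \<le> C"
    and c: "\<And>e. e \<in> E \<Longrightarrow> \<bar>u e - w e\<bar> \<le> c"
  shows "\<bar>(\<Prod>e\<in>E. u e) - (\<Prod>e\<in>E. w e)\<bar> \<le> C ^ card E * (real (card E) * (c / C))"
proof -
  \<comment> \<open>Rescaling by C brings all factors into [-1, 1], where two products differ by at
    most the sum of the differences of their factors.\<close>
  have s: "(\<Prod>e\<in>E. v e) = C ^ card E * (\<Prod>e\<in>E. v e / C)" for v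
    using C by (simp add: prod_dividef)
  have "norm ((\<Prod>e\<in>E. u e / C) - (\<Prod>e\<in>E. w e / C)) \<le> (\<Sum>e\<in>E. norm (u e / C - w e / C))"
    by (rule norm_prod_diff) (use u w C in \<open>auto simp: divide_simps\<close>)
  also have "\<dots> \<le> (\<Sum>e\<in>E. c / C)"
    by (rule sum_mono) (use c C in \<open>auto simp: divide_right_mono simp flip: diff_divide_distrib\<close>)
  finally have "\<bar>(\<Prod>e\<in>E. u e / C) - (\<Prod>e\<in>E. w e / C)\<bar> \<le> real (card E) * (c / C)" by simp
  then have "C ^ card E * \<bar>(\<Prod>e\<in>E. u e / C) - (\<Prod>e\<in>E. w e / C)\<bar> \<le> C ^ card E * (real (card E) * (c / C))"
    using C by (intro mult_left_mono) auto
  moreover have "\<bar>(\<Prod>e\<in>E. u e) - (\<Prod>e\<in>E. w e)\<bar> = C ^ card E * \<bar>(\<Prod>e\<in>E. u e / C) - (\<Prod>e\<in>E. w e / C)\<bar>"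
    unfolding s[of u] s[of w] using C by (simp add: abs_mult flip: right_diff_distrib)
  ultimately show ?thesis by simp
qed

context graphon_space
begin

text \<open>Bounds between kernels hold only almost everywhere in two variables, while the integrals
  run over many coordinates. Null sets of pairs pull back to null sets because two distinct
  coordinates are distributed as \<open>M \<Otimes>\<^sub>M M\<close>.\<close>

lemma AE_two_components:
  assumes Q: "Measurable.pred (M \<Otimes>\<^sub>M M) Q" "AE p in M \<Otimes>\<^sub>M M. Q p" and ij: "i \<in> J" "j \<in> J" "i \<noteq> j"
  shows "AE z in Pi\<^sub>M J (\<lambda>_. M). Q (z i, z j)"
proof -
  let ?J = "J - {i}"
  let ?N = "Pi\<^sub>M ?J (\<lambda>_. M)"
  interpret N: prob_space ?N by (rule prob_PiM)
  interpret pn: pair_prob_space M ?N by unfold_locales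
  have J: "insert i ?J = J" using ij by auto
  have eq: "distr (M \<Otimes>\<^sub>M ?N) (Pi\<^sub>M J (\<lambda>_. M)) (\<lambda>(x, X). X(i := x)) = Pi\<^sub>M J (\<lambda>_. M)"
    using distr_pair_PiM_eq_PiM[of ?J "\<lambda>_. M" i] prob_space_axioms unfolding J by simp
  have m: "(\<lambda>z. (z i, z j)) \<in> Pi\<^sub>M J (\<lambda>_. M) \<rightarrow>\<^sub>M M \<Otimes>\<^sub>M M"
    using ij by (intro measurable_Pair measurable_component_singleton) auto
  have meas: "{z \<in> space (Pi\<^sub>M J (\<lambda>_. M)). Q (z i, z j)} \<in> sets (Pi\<^sub>M J (\<lambda>_. M))"
    using measurable_compose[OF m Q(1)] by (simp add: pred_def)
  have upd: "(\<lambda>(x, X). X(i := x)) \<in> M \<Otimes>\<^sub>M ?N \<rightarrow>\<^sub>M Pi\<^sub>M J (\<lambda>_. M)"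
  proof -
    have "(\<lambda>q. (snd q)(i := fst q)) \<in> M \<Otimes>\<^sub>M ?N \<rightarrow>\<^sub>M Pi\<^sub>M (insert i ?J) (\<lambda>_. M)"
      by (rule measurable_fun_upd[where J = ?J]) auto
    then show ?thesis unfolding J by (simp add: case_prod_unfold)
  qed
  have m2: "(\<lambda>q. (fst q, snd q j)) \<in> M \<Otimes>\<^sub>M ?N \<rightarrow>\<^sub>M M \<Otimes>\<^sub>M M"
  proof (rule measurable_Pair)
    have "(\<lambda>z. z j) \<in> ?N \<rightarrow>\<^sub>M M" by (rule measurable_component_singleton) (use ij in auto)
    from measurable_compose[OF measurable_snd this]
    show "(\<lambda>q. snd q j) \<in> M \<Otimes>\<^sub>M ?N \<rightarrow>\<^sub>M M" .
  qed simp
  have "AE q in M \<Otimes>\<^sub>M ?N. Q (fst q, snd q j)"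
  proof (rule pn.AE_pair_measure)
    show "{q \<in> space (M \<Otimes>\<^sub>M ?N). Q (fst q, snd q j)} \<in> sets (M \<Otimes>\<^sub>M ?N)"
      using measurable_compose[OF m2 Q(1)] by (simp add: pred_def)
    have "AE x in M. AE y in M. Q (x, y)" by (rule pair.AE_pair[OF Q(2)])
    then show "AE x in M. AE y in ?N. Q (fst (x, y), snd (x, y) j)"
    proof eventually_elim
      case (elim x)
      then show ?case using AE_PiM_component[of ?J "\<lambda>_. M" j "\<lambda>y. Q (x, y)"] prob_space_axioms ij by auto
    qed
  qed
  then have "AE z in distr (M \<Otimes>\<^sub>M ?N) (Pi\<^sub>M J (\<lambda>_. M)) (\<lambda>(x, X). X(i := x)). Q (z i, z j)"
    using ij by (subst AE_distr_iff[OF upd meas]) (auto simp: case_prod_beta)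
  then show ?thesis unfolding eq .
qed

text \<open>Fubini for null sets, splitting off coordinate a and then b: for almost all roots,
  almost all choices of the other coordinates are good.\<close>

lemma AE_disintegrate:
  assumes P: "AE z in Pi\<^sub>M {1..k} (\<lambda>_. M). P z" and ab: "a \<in> {1..k}" "b \<in> {1..k}" "a \<noteq> b"
  shows "AE x in M. AE y in M. AE z in Pi\<^sub>M ({1..k} - {a, b}) (\<lambda>_. M). P (z(a := x, b := y))"
proof -
  have one: "AE x in M. AE z in Pi\<^sub>M J (\<lambda>_. M). R (z(c := x))"
    if "AE z in Pi\<^sub>M (insert c J) (\<lambda>_. M). R z" for R J and c :: nat
  proof -
    interpret N: prob_space "Pi\<^sub>M J (\<lambda>_. M)" by (rule prob_PiM)
    interpret pn: pair_prob_space M "Pi\<^sub>M J (\<lambda>_. M)" by unfold_locales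
    have eq: "distr (M \<Otimes>\<^sub>M Pi\<^sub>M J (\<lambda>_. M)) (Pi\<^sub>M (insert c J) (\<lambda>_. M)) (\<lambda>(x, X). X(c := x)) = Pi\<^sub>M (insert c J) (\<lambda>_. M)"
      using distr_pair_PiM_eq_PiM[of J "\<lambda>_. M" c] prob_space_axioms by simp
    have upd: "(\<lambda>(x, X). X(c := x)) \<in> M \<Otimes>\<^sub>M Pi\<^sub>M J (\<lambda>_. M) \<rightarrow>\<^sub>M Pi\<^sub>M (insert c J) (\<lambda>_. M)"
    proof -
      have "(\<lambda>q. (snd q)(c := fst q)) \<in> M \<Otimes>\<^sub>M Pi\<^sub>M J (\<lambda>_. M) \<rightarrow>\<^sub>M Pi\<^sub>M (insert c J) (\<lambda>_. M)"
        by (rule measurable_fun_upd[where J = J]) auto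
      then show ?thesis by (simp add: case_prod_unfold)
    qed
    have "AE q in M \<Otimes>\<^sub>M Pi\<^sub>M J (\<lambda>_. M). R (case q of (x, X) \<Rightarrow> X(c := x))"
    proof (rule AE_distrD[OF upd])
      show "AE z in distr (M \<Otimes>\<^sub>M Pi\<^sub>M J (\<lambda>_. M)) (Pi\<^sub>M (insert c J) (\<lambda>_. M)) (\<lambda>(x, X). X(c := x)). R z"
        unfolding eq by (rule that)
    qed
    from pn.AE_pair[OF this] show ?thesis by simp
  qed
  have k: "{1..k} = insert a (insert b ({1..k} - {a, b}))" using ab by auto
  have "AE x in M. AE z in Pi\<^sub>M (insert b ({1..k} - {a, b})) (\<lambda>_. M). P (z(a := x))"
    by (rule one) (use P in \<open>subst k[symmetric]\<close>)
  then show ?thesis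
  proof eventually_elim
    case (elim x)
    from one[OF this] show ?case
      by eventually_elim (use ab in \<open>simp add: fun_upd_twist\<close>)
  qed
qed

lemma kernel_measurable: "kernel M U \<Longrightarrow> (\<lambda>p. U (fst p) (snd p)) \<in> borel_measurable (M \<Otimes>\<^sub>M M)"
  by (simp add: kernel_def case_prod_unfold)

text \<open>The bound on \<open>U - W\<close> holds at all edges of F for almost all k-tuples, hence
  under the integral for almost all roots x and y. The Lipschitz constant depends only on F and on
  the common bound C of the two kernels.\<close>

lemma vel_lipschitz:
  assumes U: "kernel M U" and W: "kernel M W" and C: "1 \<le> C"
    and AE: "AE p in M \<Otimes>\<^sub>M M. \<bar>U (fst p) (snd p)\<bar> \<le> C \<and> \<bar>W (fst p) (snd p)\<bar> \<le> C \<and>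
      \<bar>U (fst p) (snd p) - W (fst p) (snd p)\<bar> \<le> c"
  shows "AE p in M \<Otimes>\<^sub>M M. \<bar>vel U (fst p) (snd p) - vel W (fst p) (snd p)\<bar> \<le>
    mF * (C ^ card (edge_pairs F) * (eF * (c / C)))"
proof (rule pair.AE_pair_measure)
  let ?K = "C ^ card (edge_pairs F) * (eF * (c / C))"
  let ?Q = "\<lambda>p. \<bar>U (fst p) (snd p)\<bar> \<le> C \<and> \<bar>W (fst p) (snd p)\<bar> \<le> C \<and>
      \<bar>U (fst p) (snd p) - W (fst p) (snd p)\<bar> \<le> c"
  note [measurable] = kernel_measurable[OF U] kernel_measurable[OF W] measurable_vel[OF U] measurable_vel[OF W]
  show "{p \<in> space (M \<Otimes>\<^sub>M M). \<bar>vel U (fst p) (snd p) - vel W (fst p) (snd p)\<bar> \<le> mF * ?K} \<in> sets (M \<Otimes>\<^sub>M M)"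
    by measurable
  have Q: "Measurable.pred (M \<Otimes>\<^sub>M M) ?Q" by measurable
  have "AE z in Pi\<^sub>M {1..k} (\<lambda>_. M). \<forall>e\<in>edge_pairs F. ?Q (z (fst e), z (snd e))"
  proof (rule AE_finite_allI[OF finite_edge_pairs])
    fix e assume e: "e \<in> edge_pairs F"
    then have "fst e \<in> {1..k}" "snd e \<in> {1..k}" "fst e \<noteq> snd e"
      using edge_pairs_sub by (auto simp: edge_pairs_def)
    from AE_two_components[OF Q AE this] show "AE z in Pi\<^sub>M {1..k} (\<lambda>_. M). ?Q (z (fst e), z (snd e))" .
  qed
  then have "AE z in Pi\<^sub>M {1..k} (\<lambda>_. M). \<bar>hom_weight F U z - hom_weight F W z\<bar> \<le> ?K"
  proof eventually_elim
    case (elim z)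
    then show ?case unfolding hom_weight_def by (intro prod_diff_bound) (use C in auto)
  qed
  then have ae: "AE x in M. AE y in M. AE z in Pi\<^sub>M ({1..k} - {fst e, snd e}) (\<lambda>_. M).
      \<bar>hom_weight F U (z(fst e := x, snd e := y)) - hom_weight F W (z(fst e := x, snd e := y))\<bar> \<le> ?K"
    if "e \<in> arcs F" for e
    by (rule AE_disintegrate) (use arcsD[of "fst e" "snd e"] that in auto)
  have "AE x in M. \<forall>e\<in>arcs F. AE y in M. AE z in Pi\<^sub>M ({1..k} - {fst e, snd e}) (\<lambda>_. M).
      \<bar>hom_weight F U (z(fst e := x, snd e := y)) - hom_weight F W (z(fst e := x, snd e := y))\<bar> \<le> ?K"
    by (rule AE_finite_allI[OF finite_arcs ae])
  then show "AE x in M. AE y in M. \<bar>vel U (fst (x, y)) (snd (x, y)) - vel W (fst (x, y)) (snd (x, y))\<bar> \<le> mF * ?K"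
    using AE_space
  proof eventually_elim
    case (elim x)
    have "AE y in M. \<forall>e\<in>arcs F. AE z in Pi\<^sub>M ({1..k} - {fst e, snd e}) (\<lambda>_. M).
      \<bar>hom_weight F U (z(fst e := x, snd e := y)) - hom_weight F W (z(fst e := x, snd e := y))\<bar> \<le> ?K"
      by (rule AE_finite_allI[OF finite_arcs]) (use elim in auto)
    then show ?case using AE_space
    proof eventually_elim
      case (elim y)
      have one: "\<bar>(\<integral>z. hom_weight F U (z(fst e := x, snd e := y)) \<partial>Pi\<^sub>M ({1..k} - {fst e, snd e}) (\<lambda>_. M)) -
          (\<integral>z. hom_weight F W (z(fst e := x, snd e := y)) \<partial>Pi\<^sub>M ({1..k} - {fst e, snd e}) (\<lambda>_. M))\<bar> \<le> ?K"
        if e: "e \<in> arcs F" for e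
      proof -
        let ?N = "Pi\<^sub>M ({1..k} - {fst e, snd e}) (\<lambda>_. M)"
        interpret N: prob_space ?N by (rule prob_PiM)
        let ?f = "\<lambda>V z. hom_weight F V (z(fst e := x, snd e := y))"
        have int: "integrable ?N (?f U)" "integrable ?N (?f W)"
          by (rule integrable_hom_weight[OF U \<open>x \<in> space M\<close> elim(2)] integrable_hom_weight[OF W \<open>x \<in> space M\<close> elim(2)])+
        have "\<bar>(\<integral>z. ?f U z \<partial>?N) - (\<integral>z. ?f W z \<partial>?N)\<bar> = norm (\<integral>z. ?f U z - ?f W z \<partial>?N)"
          using int by simp
        also have "\<dots> \<le> (\<integral>z. norm (?f U z - ?f W z) \<partial>?N)"
          by (rule integral_norm_bound)
        also have "\<dots> \<le> (\<integral>z. ?K \<partial>?N)"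
        proof (rule integral_mono_AE)
          show "integrable ?N (\<lambda>z. norm (?f U z - ?f W z))"
            by (intro integrable_norm Bochner_Integration.integrable_diff int)
          show "integrable ?N (\<lambda>z. ?K)" by (rule N.integrable_const)
          show "AE z in ?N. norm (?f U z - ?f W z) \<le> ?K" using elim(1) e by simp
        qed
        finally show ?thesis
          by (simp only: lebesgue_integral_const N.prob_space scaleR_one)
      qed
      have "\<bar>vel U x y - vel W x y\<bar> \<le> (\<Sum>e\<in>arcs F. ?K)"
        unfolding vel_def case_prod_beta sum_subtractf[symmetric]
        by (rule order.trans[OF sum_abs sum_mono]) (rule one)
      then show ?case by simp
    qed
  qed
qed

text \<open>The L-infinity derivative is unfolded into a bound on difference quotients off a null
  set, which may depend on s.\<close>

lemma trajectory_quotient: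
  assumes \<Phi>: "is_trajectory M k (removal_rule F) W \<Phi>" and t: "0 \<le> t" and \<eta>: "0 < \<eta>"
  shows "\<exists>d>0. \<forall>s\<ge>0. s \<noteq> t \<and> \<bar>s - t\<bar> < d \<longrightarrow>
    (AE p in M \<Otimes>\<^sub>M M. \<bar>(\<Phi> s (fst p) (snd p) - \<Phi> t (fst p) (snd p)) / (s - t) + vel (\<Phi> t) (fst p) (snd p)\<bar> \<le> \<eta>)"
proof -
  let ?l = "\<lambda>s. linf_norm M (\<lambda>x y. (\<Phi> s x y - \<Phi> t x y) / (s - t) - velocity M k (removal_rule F) (\<Phi> t) x y)"
  have "(?l \<longlongrightarrow> 0) (at t within {0..})" and K: "kernel M (\<Phi> t)"
    using \<Phi> t by (auto simp: is_trajectory_def)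
  then have "\<forall>\<^sub>F s in at t within {0..}. ?l s < ereal \<eta>"
    using \<eta> by (intro order_tendstoD(2)[of _ 0]) auto
  then obtain d where d: "d > 0" "\<And>s. 0 \<le> s \<Longrightarrow> s \<noteq> t \<Longrightarrow> dist s t < d \<Longrightarrow> ?l s < ereal \<eta>"
    by (auto simp: eventually_at)
  show ?thesis
  proof (intro exI[of _ d] conjI allI impI d(1))
    fix s assume s: "0 \<le> s" "s \<noteq> t \<and> \<bar>s - t\<bar> < d"
    have "AE p in M \<Otimes>\<^sub>M M. (case p of (x, y) \<Rightarrow> ereal \<bar>(\<Phi> s x y - \<Phi> t x y) / (s - t) - velocity M k (removal_rule F) (\<Phi> t) x y\<bar>) \<le> ?l s"
      unfolding linf_norm_def by (rule esssup_AE)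
    then show "AE p in M \<Otimes>\<^sub>M M. \<bar>(\<Phi> s (fst p) (snd p) - \<Phi> t (fst p) (snd p)) / (s - t) + vel (\<Phi> t) (fst p) (snd p)\<bar> \<le> \<eta>"
      using AE_space
    proof eventually_elim
      case (elim p)
      have "fst p \<in> space M" "snd p \<in> space M" using elim(2) by (auto simp: space_pair_measure)
      then have "velocity M k (removal_rule F) (\<Phi> t) (fst p) (snd p) = - vel (\<Phi> t) (fst p) (snd p)"
        by (rule velocity_removal[OF K])
      moreover have "?l s < ereal \<eta>" using d(2)[of s] s by (simp add: dist_real_def)
      then have "ereal \<bar>(\<Phi> s (fst p) (snd p) - \<Phi> t (fst p) (snd p)) / (s - t) - velocity M k (removal_rule F) (\<Phi> t) (fst p) (snd p)\<bar> < ereal \<eta>"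
        using elim(1) by (simp add: case_prod_beta del: less_ereal.simps)
      ultimately show ?case by simp
    qed
  qed
qed

text \<open>The essential supremum of the difference satisfies a Gronwall inequality as long as it is at
  most 1, since then both kernels are bounded by 2.\<close>

lemma trajectory_unique:
  assumes \<Phi>: "is_trajectory M k (removal_rule F) W \<Phi>" and \<Psi>: "is_trajectory M k (removal_rule F) W \<Psi>"
    and \<Psi>1: "\<And>t x y. 0 \<le> t \<Longrightarrow> x \<in> space M \<Longrightarrow> y \<in> space M \<Longrightarrow> \<bar>\<Psi> t x y\<bar> \<le> 1" and T: "0 \<le> T"
  shows "AE p in M \<Otimes>\<^sub>M M. \<Phi> T (fst p) (snd p) = \<Psi> T (fst p) (snd p)"
proof -
  define D where "D t p = \<Phi> t (fst p) (snd p) - \<Psi> t (fst p) (snd p)" for t p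
  define N where "N t = esssup (M \<Otimes>\<^sub>M M) (\<lambda>p. ereal \<bar>D t p\<bar>)" for t
  define g where "g t = real_of_ereal (N t)" for t
  have K\<Phi>: "kernel M (\<Phi> t)" and K\<Psi>: "kernel M (\<Psi> t)" if "0 \<le> t" for t
    using \<Phi> \<Psi> that by (auto simp: is_trajectory_def)
  have Dm: "D t \<in> borel_measurable (M \<Otimes>\<^sub>M M)" if "0 \<le> t" for t
    unfolding D_def using kernel_measurable[OF K\<Phi>[OF that]] kernel_measurable[OF K\<Psi>[OF that]]
    by (rule borel_measurable_diff)
  have Dm': "(\<lambda>p. ereal \<bar>D t p\<bar>) \<in> borel_measurable (M \<Otimes>\<^sub>M M)" if "0 \<le> t" for t
    using Dm[OF that] by measurable
  \<comment> \<open>The essential supremum is taken in \<open>ereal\<close>; it is nonnegative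
    because a probability measure is not null.\<close>
  have N0: "0 \<le> N t" for t
  proof (rule ccontr)
    assume "\<not> 0 \<le> N t"
    have "AE p in M \<Otimes>\<^sub>M M. ereal \<bar>D t p\<bar> \<le> N t" unfolding N_def by (rule esssup_AE)
    then have "AE p in M \<Otimes>\<^sub>M M. False"
    proof eventually_elim
      case (elim p)
      have "0 \<le> ereal \<bar>D t p\<bar>" by simp
      then show ?case using elim \<open>\<not> 0 \<le> N t\<close> by (meson order.trans)
    qed
    then show False by (simp add: pair.P.AE_False)
  qed
  have Nle: "N t \<le> ereal c" if "0 \<le> t" "AE p in M \<Otimes>\<^sub>M M. \<bar>D t p\<bar> \<le> c" for t c
    unfolding N_def using that by (intro esssup_I Dm') auto
  have Nfin: "ereal (g t) = N t" if t: "0 \<le> t" for t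
  proof -
    obtain C where C: "\<And>x y. x \<in> space M \<Longrightarrow> y \<in> space M \<Longrightarrow> \<bar>\<Phi> t x y\<bar> \<le> C"
      by (rule kernel_bound[OF K\<Phi>[OF t]]) blast
    have "N t \<le> ereal (C + 1)"
    proof (rule Nle[OF t], rule AE_I2)
      fix p assume "p \<in> space (M \<Otimes>\<^sub>M M)"
      then have "fst p \<in> space M" "snd p \<in> space M" by (auto simp: space_pair_measure)
      then show "\<bar>D t p\<bar> \<le> C + 1" using C[of "fst p" "snd p"] \<Psi>1[OF t, of "fst p" "snd p"] by (simp add: D_def)
    qed
    then show ?thesis unfolding g_def using N0[of t] by (cases "N t") auto
  qed
  have g0: "0 \<le> g t" if "0 \<le> t" for t using N0[of t] Nfin[OF that] by (metis ereal_less_eq(5))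
  have gAE: "AE p in M \<Otimes>\<^sub>M M. \<bar>D t p\<bar> \<le> g t" if "0 \<le> t" for t
    using esssup_AE[of "\<lambda>p. ereal \<bar>D t p\<bar>" "M \<Otimes>\<^sub>M M"] by (simp add: N_def[symmetric] Nfin[OF that, symmetric])
  have gle: "g t \<le> c" if "0 \<le> t" "AE p in M \<Otimes>\<^sub>M M. \<bar>D t p\<bar> \<le> c" for t c
    using Nle[OF that] Nfin[OF that(1)] by (metis ereal_less_eq(3))
  \<comment> \<open>The bound holds for s on both sides of t and with the roles of g s and g t
    exchanged, which continuity needs; the Gronwall inequality uses it only for s beyond t.\<close>
  have step: "\<exists>d>0. \<forall>s\<ge>0. \<bar>s - t\<bar> < d \<longrightarrow> g s \<le> g t + \<bar>s - t\<bar> * (A + \<eta>) \<and> g t \<le> g s + \<bar>s - t\<bar> * (A + \<eta>)"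
    if t: "0 \<le> t" and \<eta>: "0 < \<eta>"
      and A: "AE p in M \<Otimes>\<^sub>M M. \<bar>vel (\<Phi> t) (fst p) (snd p) - vel (\<Psi> t) (fst p) (snd p)\<bar> \<le> A" for t \<eta> A
  proof -
    obtain d1 where d1: "d1 > 0" "\<And>s. 0 \<le> s \<Longrightarrow> s \<noteq> t \<Longrightarrow> \<bar>s - t\<bar> < d1 \<Longrightarrow>
      AE p in M \<Otimes>\<^sub>M M. \<bar>(\<Phi> s (fst p) (snd p) - \<Phi> t (fst p) (snd p)) / (s - t) + vel (\<Phi> t) (fst p) (snd p)\<bar> \<le> \<eta> / 2"
      using trajectory_quotient[OF \<Phi> t, of "\<eta> / 2"] \<eta> by auto
    obtain d2 where d2: "d2 > 0" "\<And>s. 0 \<le> s \<Longrightarrow> s \<noteq> t \<Longrightarrow> \<bar>s - t\<bar> < d2 \<Longrightarrow>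
      AE p in M \<Otimes>\<^sub>M M. \<bar>(\<Psi> s (fst p) (snd p) - \<Psi> t (fst p) (snd p)) / (s - t) + vel (\<Psi> t) (fst p) (snd p)\<bar> \<le> \<eta> / 2"
      using trajectory_quotient[OF \<Psi> t, of "\<eta> / 2"] \<eta> by auto
    show ?thesis
    proof (intro exI[of _ "min d1 d2"] conjI allI impI)
      show "0 < min d1 d2" using d1 d2 by simp
      fix s assume s: "0 \<le> s" "\<bar>s - t\<bar> < min d1 d2"
      have main: "AE p in M \<Otimes>\<^sub>M M. \<bar>D s p - D t p\<bar> \<le> \<bar>s - t\<bar> * (A + \<eta>)"
      proof (cases "s = t")
        case False
        have "AE p in M \<Otimes>\<^sub>M M. \<bar>(\<Phi> s (fst p) (snd p) - \<Phi> t (fst p) (snd p)) / (s - t) + vel (\<Phi> t) (fst p) (snd p)\<bar> \<le> \<eta> / 2"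
          by (rule d1(2)) (use s False in auto)
        moreover have "AE p in M \<Otimes>\<^sub>M M. \<bar>(\<Psi> s (fst p) (snd p) - \<Psi> t (fst p) (snd p)) / (s - t) + vel (\<Psi> t) (fst p) (snd p)\<bar> \<le> \<eta> / 2"
          by (rule d2(2)) (use s False in auto)
        ultimately show ?thesis using A
        proof eventually_elim
          case (elim p)
          have "(D s p - D t p) / (s - t) =
             (\<Phi> s (fst p) (snd p) - \<Phi> t (fst p) (snd p)) / (s - t) - (\<Psi> s (fst p) (snd p) - \<Psi> t (fst p) (snd p)) / (s - t)"
            by (simp add: D_def flip: diff_divide_distrib)
          then have "\<bar>(D s p - D t p) / (s - t)\<bar> \<le> A + \<eta>" using elim by argo
          then show ?case using False by (simp add: abs_divide pos_divide_le_eq mult.commute)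
        qed
      qed simp
      have "AE p in M \<Otimes>\<^sub>M M. \<bar>D s p\<bar> \<le> g t + \<bar>s - t\<bar> * (A + \<eta>)"
        using gAE[OF t] main by eventually_elim linarith
      then show "g s \<le> g t + \<bar>s - t\<bar> * (A + \<eta>)" by (rule gle[OF s(1)])
      have "AE p in M \<Otimes>\<^sub>M M. \<bar>D t p\<bar> \<le> g s + \<bar>s - t\<bar> * (A + \<eta>)"
        using gAE[OF s(1)] main by eventually_elim linarith
      then show "g t \<le> g s + \<bar>s - t\<bar> * (A + \<eta>)" by (rule gle[OF t])
    qed
  qed
  define LC where "LC C = mF * (C ^ card (edge_pairs F) * (eF / C))" for C
  have velA: "AE p in M \<Otimes>\<^sub>M M. \<bar>vel (\<Phi> t) (fst p) (snd p) - vel (\<Psi> t) (fst p) (snd p)\<bar> \<le> LC C * g t"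
    if t: "0 \<le> t" and C: "1 \<le> C" "AE p in M \<Otimes>\<^sub>M M. \<bar>\<Phi> t (fst p) (snd p)\<bar> \<le> C" for t C
  proof -
    have "AE p in M \<Otimes>\<^sub>M M. \<bar>\<Phi> t (fst p) (snd p)\<bar> \<le> C \<and> \<bar>\<Psi> t (fst p) (snd p)\<bar> \<le> C \<and>
      \<bar>\<Phi> t (fst p) (snd p) - \<Psi> t (fst p) (snd p)\<bar> \<le> g t"
      using C(2) gAE[OF t] AE_space
    proof eventually_elim
      case (elim p)
      then show ?case using \<Psi>1[OF t, of "fst p" "snd p"] C(1) by (auto simp: D_def space_pair_measure)
    qed
    from vel_lipschitz[OF K\<Phi>[OF t] K\<Psi>[OF t] C(1) this] show ?thesis by (simp add: LC_def mult_ac)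
  qed
  have cont: "continuous_on {0..T} g"
    unfolding continuous_on_iff
  proof (intro ballI allI impI)
    fix t e :: real assume t: "t \<in> {0..T}" and e: "0 < e"
    then have t0: "0 \<le> t" by simp
    \<comment> \<open>Continuity at t tolerates a constant depending on t, so a bound for the single
      kernel \<open>\<Phi> t\<close> is enough here.\<close>
    obtain C where C: "1 \<le> C" "\<And>x y. x \<in> space M \<Longrightarrow> y \<in> space M \<Longrightarrow> \<bar>\<Phi> t x y\<bar> \<le> C"
      by (rule kernel_bound[OF K\<Phi>[OF t0]]) blast
    define A where "A = LC C * g t"
    have A0: "0 \<le> A" using C g0[OF t0] by (simp add: A_def LC_def)
    have "AE p in M \<Otimes>\<^sub>M M. \<bar>vel (\<Phi> t) (fst p) (snd p) - vel (\<Psi> t) (fst p) (snd p)\<bar> \<le> A"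
      unfolding A_def by (rule velA[OF t0 C(1)]) (use C(2) in \<open>auto simp: space_pair_measure intro!: AE_I2\<close>)
    from step[OF t0 zero_less_one this] obtain d where d: "d > 0"
      "\<And>s. 0 \<le> s \<Longrightarrow> \<bar>s - t\<bar> < d \<Longrightarrow> g s \<le> g t + \<bar>s - t\<bar> * (A + 1) \<and> g t \<le> g s + \<bar>s - t\<bar> * (A + 1)"
      by blast
    show "\<exists>d>0. \<forall>s\<in>{0..T}. dist s t < d \<longrightarrow> dist (g s) (g t) < e"
    proof (intro exI[of _ "min d (e / (A + 1))"] conjI ballI impI)
      show "0 < min d (e / (A + 1))" using d e A0 by simp
      fix s assume s: "s \<in> {0..T}" "dist s t < min d (e / (A + 1))"
      then have "\<bar>s - t\<bar> * (A + 1) < e" using A0 by (simp add: dist_real_def pos_less_divide_eq)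
      then show "dist (g s) (g t) < e"
        using d(2)[of s] s by (auto simp: dist_real_def)
    qed
  qed
  have "g T \<le> 0"
  proof (rule dini_gronwall_zero[where g = g and T = T and L = "LC 2"])
    show "0 \<le> LC 2" by (simp add: LC_def)
    have "AE p in M \<Otimes>\<^sub>M M. \<bar>D 0 p\<bar> \<le> 0"
    proof -
      have "AE p in M \<Otimes>\<^sub>M M. \<Phi> 0 (fst p) (snd p) = W (fst p) (snd p)" "AE p in M \<Otimes>\<^sub>M M. \<Psi> 0 (fst p) (snd p) = W (fst p) (snd p)"
        using \<Phi> \<Psi> by (auto simp: is_trajectory_def case_prod_beta)
      then show ?thesis by eventually_elim (simp add: D_def)
    qed
    then show "g 0 = 0" using gle[of 0 0] g0[of 0] by simp
  next
    fix t \<eta> :: real assume t: "0 \<le> t" "g t \<le> 1" and \<eta>: "0 < \<eta>"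
    have "AE p in M \<Otimes>\<^sub>M M. \<bar>\<Phi> t (fst p) (snd p)\<bar> \<le> 2"
      using gAE[OF t(1)] AE_space
    proof eventually_elim
      case (elim p)
      then show ?case using \<Psi>1[OF t(1), of "fst p" "snd p"] t(2) by (auto simp: D_def space_pair_measure)
    qed
    from step[OF t(1) \<eta> velA[OF t(1) _ this]] obtain d where d: "d > 0"
      "\<And>s. 0 \<le> s \<Longrightarrow> \<bar>s - t\<bar> < d \<Longrightarrow> g s \<le> g t + \<bar>s - t\<bar> * (LC 2 * g t + \<eta>)"
      by auto
    show "\<exists>d>0. \<forall>s. t < s \<and> s < t + d \<longrightarrow> g s \<le> g t + (s - t) * (LC 2 * g t + \<eta>)"
    proof (intro exI[of _ d] conjI allI impI d(1))
      fix s assume "t < s \<and> s < t + d"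
      then show "g s \<le> g t + (s - t) * (LC 2 * g t + \<eta>)"
        using d(2)[of s] t by simp
    qed
  qed (use T cont in auto)
  then have "AE p in M \<Otimes>\<^sub>M M. \<bar>D T p\<bar> \<le> 0" using gAE[OF T] by (auto elim: eventually_mono)
  then show ?thesis by (auto simp: D_def elim: eventually_mono)
qed

end

section \<open>Cut distance and step kernels\<close>

lemma sum_PiE_insert:
  assumes "a \<notin> S"
  shows "(\<Sum>\<phi>\<in>PiE (insert a S) T. G \<phi>) = (\<Sum>y\<in>T a. \<Sum>\<phi>\<in>PiE S T. G (\<phi>(a := y)))"
  unfolding PiE_insert_eq
  by (subst sum.reindex[OF inj_combinator[OF assms]]) (simp add: sum.cartesian_product case_prod_unfold)

text \<open>For graphs the diagonal vanishes, since \<open>{u, u}\<close> has only one element and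
  is no edge.\<close>

definition adj :: "graph \<Rightarrow> nat \<Rightarrow> nat \<Rightarrow> real" where
  "adj G u v = of_bool ({u, v} \<in> G)"

lemma adj_sym: "adj G u v = adj G v u" by (simp add: adj_def insert_commute)

lemma unit_on_adj: "unit_on X (adj G)" by (simp add: unit_on_def adj_def)

context graphon_space
begin

lemma integrable_kernel:
  assumes U: "kernel M U"
  shows "integrable (M \<Otimes>\<^sub>M M) (\<lambda>p. U (fst p) (snd p))"
proof -
  obtain C where C: "1 \<le> C" "\<And>x y. x \<in> space M \<Longrightarrow> y \<in> space M \<Longrightarrow> \<bar>U x y\<bar> \<le> C"
    by (rule kernel_bound[OF U]) blast
  show ?thesis
    by (rule pair.P.integrable_const_bound[of _ C])
       (use C kernel_measurable[OF U] in \<open>auto simp: space_pair_measure intro!: AE_I2\<close>)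
qed

lemma kernel_diff:
  assumes U: "kernel M U" and W: "kernel M W"
  shows "kernel M (\<lambda>x y. U x y - W x y)"
proof -
  obtain C where C: "1 \<le> C" "\<And>x y. x \<in> space M \<Longrightarrow> y \<in> space M \<Longrightarrow> \<bar>U x y\<bar> \<le> C"
    by (rule kernel_bound[OF U]) blast
  obtain C' where C': "1 \<le> C'" "\<And>x y. x \<in> space M \<Longrightarrow> y \<in> space M \<Longrightarrow> \<bar>W x y\<bar> \<le> C'"
    by (rule kernel_bound[OF W]) blast
  have "(\<lambda>p. U (fst p) (snd p) - W (fst p) (snd p)) \<in> borel_measurable (M \<Otimes>\<^sub>M M)"
    by (intro borel_measurable_diff kernel_measurable U W)
  moreover have "\<bar>U x y - W x y\<bar> \<le> C + C'" if "x \<in> space M" "y \<in> space M" for x y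
    using C(2)[OF that] C'(2)[OF that] by linarith
  moreover have "U x y - W x y = U y x - W y x" if "x \<in> space M" "y \<in> space M" for x y
    using U W that by (auto simp: kernel_def)
  ultimately show ?thesis unfolding kernel_def case_prod_unfold by blast
qed

definition rect_int :: "'a kern \<Rightarrow> 'a set \<Rightarrow> 'a set \<Rightarrow> real" where
  "rect_int f S T = (\<integral>p. indicator (S \<times> T) p * f (fst p) (snd p) \<partial>(M \<Otimes>\<^sub>M M))"

lemma integrable_rect:
  assumes "kernel M f" "S \<in> sets M" "T \<in> sets M"
  shows "integrable (M \<Otimes>\<^sub>M M) (\<lambda>p. indicator (S \<times> T) p * f (fst p) (snd p))"
  using integrable_real_mult_indicator[OF pair_measureI[OF assms(2,3)] integrable_kernel[OF assms(1)]]
  by (simp add: mult.commute)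

lemma cut_dist_rect: "cut_dist M U W = (SUP (S, T) \<in> sets M \<times> sets M. \<bar>rect_int (\<lambda>x y. U x y - W x y) S T\<bar>)"
  by (simp add: cut_dist_def rect_int_def set_lebesgue_integral_def case_prod_unfold)

lemma rect_int_bound:
  assumes f: "kernel M f" and "S \<in> sets M" "T \<in> sets M"
    and C: "0 \<le> C" "\<And>x y. x \<in> space M \<Longrightarrow> y \<in> space M \<Longrightarrow> \<bar>f x y\<bar> \<le> C"
  shows "\<bar>rect_int f S T\<bar> \<le> C"
proof -
  have "norm (rect_int f S T) \<le> (\<integral>p. norm (indicator (S \<times> T) p * f (fst p) (snd p)) \<partial>(M \<Otimes>\<^sub>M M))"
    unfolding rect_int_def by (rule integral_norm_bound)
  also have "\<dots> \<le> (\<integral>p. C \<partial>(M \<Otimes>\<^sub>M M))"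
  proof (rule integral_mono_AE)
    show "integrable (M \<Otimes>\<^sub>M M) (\<lambda>p. norm (indicator (S \<times> T) p * f (fst p) (snd p)))"
      by (intro integrable_norm integrable_rect assms)
    show "integrable (M \<Otimes>\<^sub>M M) (\<lambda>p. C)" by (rule pair.P.integrable_const)
    show "AE p in M \<Otimes>\<^sub>M M. norm (indicator (S \<times> T) p * f (fst p) (snd p)) \<le> C"
      using C by (intro AE_I2) (auto simp: space_pair_measure indicator_def)
  qed
  finally show ?thesis by (simp only: lebesgue_integral_const pair.P.prob_space scaleR_one real_norm_def)
qed

lemma rect_int_le_cut_dist:
  assumes U: "kernel M U" and W: "kernel M W" and ST: "S \<in> sets M" "T \<in> sets M"
  shows "\<bar>rect_int (\<lambda>x y. U x y - W x y) S T\<bar> \<le> cut_dist M U W"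
proof -
  have K: "kernel M (\<lambda>x y. U x y - W x y)" by (rule kernel_diff[OF U W])
  obtain C where C: "1 \<le> C" "\<And>x y. x \<in> space M \<Longrightarrow> y \<in> space M \<Longrightarrow> \<bar>U x y - W x y\<bar> \<le> C"
    by (rule kernel_bound[OF K]) blast
  have "bdd_above ((\<lambda>(S, T). \<bar>rect_int (\<lambda>x y. U x y - W x y) S T\<bar>) ` (sets M \<times> sets M))"
    by (rule bdd_aboveI[of _ C]) (use C rect_int_bound[OF K] in auto)
  then show ?thesis unfolding cut_dist_rect using ST
    by (intro cSUP_upper2[where x = "(S, T)"]) auto
qed

lemma cut_dist_leI:
  assumes "\<And>S T. S \<in> sets M \<Longrightarrow> T \<in> sets M \<Longrightarrow> \<bar>rect_int (\<lambda>x y. U x y - W x y) S T\<bar> \<le> K"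
  shows "cut_dist M U W \<le> K"
  unfolding cut_dist_rect by (rule cSUP_least) (use assms sets.top in auto)

lemma cut_dist_triangle:
  assumes U: "kernel M U" and X: "kernel M X" and W: "kernel M W"
  shows "cut_dist M U W \<le> cut_dist M U X + cut_dist M X W"
proof (rule cut_dist_leI)
  fix S T assume ST: "S \<in> sets M" "T \<in> sets M"
  have "rect_int (\<lambda>x y. U x y - W x y) S T =
      rect_int (\<lambda>x y. U x y - X x y) S T + rect_int (\<lambda>x y. X x y - W x y) S T"
    unfolding rect_int_def
    by (subst Bochner_Integration.integral_add[symmetric])
       (use integrable_rect[OF kernel_diff[OF U X] ST] integrable_rect[OF kernel_diff[OF X W] ST]
        in \<open>auto simp: algebra_simps\<close>)
  then show "\<bar>rect_int (\<lambda>x y. U x y - W x y) S T\<bar> \<le> cut_dist M U X + cut_dist M X W"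
    using rect_int_le_cut_dist[OF U X ST] rect_int_le_cut_dist[OF X W ST] by linarith
qed

text \<open>The cut distance ignores null sets. This allows a trajectory to be exchanged for the
  flow and a graph kernel for a step kernel.\<close>

lemma cut_dist_AE_le:
  assumes U: "kernel M U" and U': "kernel M U'" and W: "kernel M W" and W': "kernel M W'"
    and AE: "AE p in M \<Otimes>\<^sub>M M. U (fst p) (snd p) = U' (fst p) (snd p)"
      "AE p in M \<Otimes>\<^sub>M M. W (fst p) (snd p) = W' (fst p) (snd p)"
  shows "cut_dist M U W \<le> cut_dist M U' W'"
proof (rule cut_dist_leI)
  fix S T assume ST: "S \<in> sets M" "T \<in> sets M"
  have "rect_int (\<lambda>x y. U x y - W x y) S T = rect_int (\<lambda>x y. U' x y - W' x y) S T"
    unfolding rect_int_def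
  proof (rule integral_cong_AE)
    show "AE p in M \<Otimes>\<^sub>M M. indicator (S \<times> T) p * (U (fst p) (snd p) - W (fst p) (snd p)) =
        indicator (S \<times> T) p * (U' (fst p) (snd p) - W' (fst p) (snd p))"
      using AE by eventually_elim simp
  qed (use integrable_rect[OF kernel_diff[OF U W] ST] integrable_rect[OF kernel_diff[OF U' W'] ST]
       in \<open>auto dest: borel_measurable_integrable\<close>)
  then show "\<bar>rect_int (\<lambda>x y. U x y - W x y) S T\<bar> \<le> cut_dist M U' W'"
    using rect_int_le_cut_dist[OF U' W' ST] by simp
qed

lemma cut_dist_commute: "cut_dist M U W = cut_dist M W U"
proof -
  have "rect_int (\<lambda>x y. U x y - W x y) S T = - rect_int (\<lambda>x y. W x y - U x y) S T" for S T
    unfolding rect_int_def by (simp flip: Bochner_Integration.integral_minus) (simp add: algebra_simps)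
  then show ?thesis by (simp add: cut_dist_rect)
qed

end

section \<open>Step kernels on a vertex partition\<close>

locale vertex_space = graphon_space M k n F for M :: "'a measure" and k n F +
  fixes \<Omega> :: "nat \<Rightarrow> 'a set"
  assumes \<Omega>: "vertex_partition M n \<Omega>"
begin

definition col :: "'a \<Rightarrow> nat" where
  "col x = (THE v. v \<in> V \<and> x \<in> \<Omega> v)"

definition step :: "(nat \<Rightarrow> nat \<Rightarrow> real) \<Rightarrow> 'a kern" where
  "step w x y = w (col x) (col y)"

lemma \<Omega>_sets: "v \<in> V \<Longrightarrow> \<Omega> v \<in> sets M"
  and \<Omega>_measure: "v \<in> V \<Longrightarrow> measure M (\<Omega> v) = 1 / real n"
  and \<Omega>_cover: "x \<in> space M \<Longrightarrow> \<exists>v\<in>V. x \<in> \<Omega> v"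
  using \<Omega> by (auto simp: vertex_partition_def)

lemma \<Omega>_disj: "u \<in> V \<Longrightarrow> v \<in> V \<Longrightarrow> x \<in> \<Omega> u \<Longrightarrow> x \<in> \<Omega> v \<Longrightarrow> u = v"
  using \<Omega> unfolding vertex_partition_def disjoint_family_on_def by (metis IntI empty_iff)

lemma col_eq: "v \<in> V \<Longrightarrow> x \<in> \<Omega> v \<Longrightarrow> col x = v"
  unfolding col_def using \<Omega>_disj by blast

lemma col_in: "x \<in> space M \<Longrightarrow> col x \<in> V" and in_col: "x \<in> space M \<Longrightarrow> x \<in> \<Omega> (col x)"
  using \<Omega>_cover[of x] col_eq by auto

lemma in_\<Omega>_iff: "x \<in> space M \<Longrightarrow> v \<in> V \<Longrightarrow> x \<in> \<Omega> v \<longleftrightarrow> col x = v"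
  using col_eq in_col by auto

lemma measurable_col_pair: "(\<lambda>p. (col (fst p), col (snd p))) \<in> M \<Otimes>\<^sub>M M \<rightarrow>\<^sub>M count_space (V \<times> V)"
proof (subst measurable_count_space_eq2, simp, intro conjI ballI)
  show "(\<lambda>p. (col (fst p), col (snd p))) \<in> space (M \<Otimes>\<^sub>M M) \<rightarrow> V \<times> V"
    using col_in by (auto simp: space_pair_measure)
  fix q assume "q \<in> V \<times> V"
  then obtain u v where q: "q = (u, v)" and uv: "u \<in> V" "v \<in> V" by blast
  have sub: "\<Omega> u \<subseteq> space M" "\<Omega> v \<subseteq> space M"
    using sets.sets_into_space[OF \<Omega>_sets] uv by blast+
  have "(\<lambda>p. (col (fst p), col (snd p))) -` {q} \<inter> space (M \<Otimes>\<^sub>M M) = \<Omega> u \<times> \<Omega> v"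
  proof (rule set_eqI)
    fix p :: "'a \<times> 'a"
    obtain x y where p: "p = (x, y)" by (cases p)
    show "p \<in> (\<lambda>p. (col (fst p), col (snd p))) -` {q} \<inter> space (M \<Otimes>\<^sub>M M) \<longleftrightarrow> p \<in> \<Omega> u \<times> \<Omega> v"
    proof (cases "x \<in> space M \<and> y \<in> space M")
      case True
      then show ?thesis
        using in_\<Omega>_iff[of x u] in_\<Omega>_iff[of y v] uv by (simp add: p q space_pair_measure)
    next
      case False
      then show ?thesis using sub by (auto simp: p space_pair_measure)
    qed
  qed
  then show "(\<lambda>p. (col (fst p), col (snd p))) -` {q} \<inter> space (M \<Otimes>\<^sub>M M) \<in> sets (M \<Otimes>\<^sub>M M)"
    using uv by (simp add: pair_measureI \<Omega>_sets)
qed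

lemma measurable_step: "(\<lambda>p. step w (fst p) (snd p)) \<in> borel_measurable (M \<Otimes>\<^sub>M M)"
  using measurable_compose[OF measurable_col_pair, of "\<lambda>q. w (fst q) (snd q)" borel]
  by (simp add: step_def)

lemma kernel_step:
  assumes "\<And>u v. u \<in> V \<Longrightarrow> v \<in> V \<Longrightarrow> w u v = w v u"
  shows "kernel M (step w)"
proof -
  define C where "C = Max ((\<lambda>(u, v). \<bar>w u v\<bar>) ` (V \<times> V))"
  have "\<bar>step w x y\<bar> \<le> C" if "x \<in> space M" "y \<in> space M" for x y
    unfolding C_def step_def by (rule Max_ge) (use col_in that in auto)
  moreover have "step w x y = step w y x" if "x \<in> space M" "y \<in> space M" for x y
    unfolding step_def by (intro assms col_in that)
  ultimately show ?thesis unfolding kernel_def case_prod_unfold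
    using measurable_step by blast
qed

lemma graph_kernel_step:
  assumes "G \<in> graphs n" "x \<in> space M" "y \<in> space M"
  shows "graph_kernel \<Omega> G x y = step (adj G) x y"
proof -
  have "(\<exists>u v. {u, v} \<in> G \<and> x \<in> \<Omega> u \<and> y \<in> \<Omega> v) \<longleftrightarrow> {col x, col y} \<in> G"
  proof
    assume "\<exists>u v. {u, v} \<in> G \<and> x \<in> \<Omega> u \<and> y \<in> \<Omega> v"
    then obtain u v where uv: "{u, v} \<in> G" "x \<in> \<Omega> u" "y \<in> \<Omega> v" by blast
    from uv(1) have "u \<in> V" "v \<in> V" using assms(1) by (auto simp: graphs_def pairs_def)
    then show "{col x, col y} \<in> G" using uv col_eq by simp
  qed (use in_col assms in blast)
  then show ?thesis by (simp add: graph_kernel_def step_def adj_def)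
qed

text \<open>For a step kernel the integrand depends only on the classes of the coordinates. It is
  expanded into indicators of products of classes, whose measures are powers of
  \<open>1 / n\<close>. The sum over the free coordinates is then padded by the overwritten
  coordinates a and b to a sum over all maps.\<close>

lemma integral_step_PiM:
  assumes e: "(a, b) \<in> arcs F" and xy: "x \<in> space M" "y \<in> space M"
  shows "(\<integral>z. hom_weight F (step w) (z(a := x, b := y)) \<partial>Pi\<^sub>M ({1..k} - {a, b}) (\<lambda>_. M)) =
    (\<Sum>\<phi>\<in>maps. hom_weight F w (\<phi>(a := col x, b := col y))) / nk"
proof -
  define J where "J = {1..k} - {a, b}"
  let ?N = "Pi\<^sub>M J (\<lambda>_. M)"
  have ab: "a \<in> {1..k}" "b \<in> {1..k}" "a \<noteq> b" using arcsD[OF e] by auto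
  interpret PS: product_sigma_finite "\<lambda>_ :: nat. M" by unfold_locales
  define G where "G \<phi> = hom_weight F w (\<phi>(a := col x, b := col y))" for \<phi>
  have G_cong: "G \<phi> = G \<psi>" if eq: "\<And>i. i \<in> J \<Longrightarrow> \<phi> i = \<psi> i" for \<phi> \<psi>
    unfolding G_def hom_weight_def
  proof (rule prod.cong[OF refl])
    have upd: "(\<phi>(a := col x, b := col y)) i = (\<psi>(a := col x, b := col y)) i" if "i \<in> {1..k}" for i
      using eq[of i] that by (simp add: J_def)
    fix e assume "e \<in> edge_pairs F"
    then have e: "fst e \<in> {1..k}" "snd e \<in> {1..k}" using edge_pairs_sub by auto
    show "w ((\<phi>(a := col x, b := col y)) (fst e)) ((\<phi>(a := col x, b := col y)) (snd e)) =
        w ((\<psi>(a := col x, b := col y)) (fst e)) ((\<psi>(a := col x, b := col y)) (snd e))"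
      by (simp only: upd[OF e(1)] upd[OF e(2)])
  qed
  have point: "hom_weight F (step w) (z(a := x, b := y)) =
      (\<Sum>\<phi>\<in>J \<rightarrow>\<^sub>E V. G \<phi> * (\<Prod>i\<in>J. indicator (\<Omega> (\<phi> i)) (z i)))" if z: "z \<in> space ?N" for z
  proof -
    define \<phi>0 where "\<phi>0 = restrict (\<lambda>i. col (z i)) J"
    have zi: "z i \<in> space M" if "i \<in> J" for i using z that PiE_mem[of z J "\<lambda>_. space M" i] by (simp add: space_PiM)
    have \<phi>0: "\<phi>0 \<in> J \<rightarrow>\<^sub>E V" unfolding \<phi>0_def by (rule restrict_PiE_iff[THEN iffD2]) (use zi col_in in blast)
    have ind: "(\<Prod>i\<in>J. indicator (\<Omega> (\<phi> i)) (z i)) = (of_bool (\<phi> = \<phi>0) :: real)" if \<phi>: "\<phi> \<in> J \<rightarrow>\<^sub>E V" for \<phi>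
    proof (cases "\<phi> = \<phi>0")
      case True
      have "(\<Prod>i\<in>J. indicator (\<Omega> (\<phi> i)) (z i)) = (\<Prod>i\<in>J. 1 :: real)"
        by (rule prod.cong[OF refl]) (simp add: True \<phi>0_def in_col zi)
      then show ?thesis using True by simp
    next
      case False
      then obtain i where i: "i \<in> J" "\<phi> i \<noteq> \<phi>0 i" using \<phi> \<phi>0 by (metis PiE_ext)
      then have "\<phi> i \<in> V" "col (z i) \<noteq> \<phi> i" using PiE_mem[OF \<phi>, of i] by (simp_all add: \<phi>0_def)
      then have "z i \<notin> \<Omega> (\<phi> i)" using in_\<Omega>_iff[OF zi[OF i(1)]] by blast
      then have "(\<Prod>i\<in>J. indicator (\<Omega> (\<phi> i)) (z i)) = (0 :: real)"
        by (intro prod_zero bexI[OF _ i(1)]) (auto simp: J_def)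
      then show ?thesis using False by simp
    qed
    have "(\<Sum>\<phi>\<in>J \<rightarrow>\<^sub>E V. G \<phi> * (\<Prod>i\<in>J. indicator (\<Omega> (\<phi> i)) (z i))) =
        (\<Sum>\<phi>\<in>J \<rightarrow>\<^sub>E V. if \<phi> = \<phi>0 then G \<phi> else 0)"
      by (rule sum.cong[OF refl]) (simp add: ind)
    also have "\<dots> = G \<phi>0" using \<phi>0 by (simp add: sum.delta finite_PiE J_def)
    also have "\<dots> = G (\<lambda>i. col (z i))" by (rule G_cong) (simp add: \<phi>0_def)
    also have "\<dots> = hom_weight F (step w) (z(a := x, b := y))"
      unfolding G_def hom_weight_def step_def by (intro prod.cong refl) simp
    finally show ?thesis ..
  qed
  have int: "integrable M (indicat_real (\<Omega> v))" "(\<integral>x. indicat_real (\<Omega> v) x \<partial>M) = 1 / real n" if "v \<in> V" for v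
    using \<Omega>_sets[OF that] \<Omega>_measure[OF that] by (simp_all add: emeasure_eq_measure sets.sets_into_space Int_absorb2)
  have "(\<integral>z. hom_weight F (step w) (z(a := x, b := y)) \<partial>?N) =
      (\<integral>z. (\<Sum>\<phi>\<in>J \<rightarrow>\<^sub>E V. G \<phi> * (\<Prod>i\<in>J. indicator (\<Omega> (\<phi> i)) (z i))) \<partial>?N)"
    by (rule Bochner_Integration.integral_cong[OF refl point])
  also have "\<dots> = (\<Sum>\<phi>\<in>J \<rightarrow>\<^sub>E V. \<integral>z. G \<phi> * (\<Prod>i\<in>J. indicator (\<Omega> (\<phi> i)) (z i)) \<partial>?N)"
  proof (rule Bochner_Integration.integral_sum)
    fix \<phi> assume "\<phi> \<in> J \<rightarrow>\<^sub>E V"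
    then show "integrable ?N (\<lambda>z. G \<phi> * (\<Prod>i\<in>J. indicator (\<Omega> (\<phi> i)) (z i)))"
      by (intro integrable_mult_right PS.product_integrable_prod int(1)) (simp add: J_def, rule PiE_mem)
  qed
  also have "\<dots> = (\<Sum>\<phi>\<in>J \<rightarrow>\<^sub>E V. G \<phi> * (1 / real n) ^ card J)"
  proof (rule sum.cong[OF refl])
    fix \<phi> assume \<phi>: "\<phi> \<in> J \<rightarrow>\<^sub>E V"
    have "(\<integral>z. (\<Prod>i\<in>J. indicat_real (\<Omega> (\<phi> i)) (z i)) \<partial>?N) = (\<Prod>i\<in>J. (\<integral>x. indicat_real (\<Omega> (\<phi> i)) x \<partial>M))"
      by (rule PS.product_integral_prod, simp add: J_def, rule int(1), rule PiE_mem[OF \<phi>])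
    also have "\<dots> = (\<Prod>i\<in>J. 1 / real n)"
      by (rule prod.cong[OF refl int(2)], rule PiE_mem[OF \<phi>])
    finally show "(\<integral>z. G \<phi> * (\<Prod>i\<in>J. indicator (\<Omega> (\<phi> i)) (z i)) \<partial>?N) = G \<phi> * (1 / real n) ^ card J"
      by simp
  qed
  also have "\<dots> = (\<Sum>\<phi>\<in>maps. G \<phi>) / nk"
  proof -
    have k: "{1..k} = insert a (insert b J)" using ab by (auto simp: J_def)
    have nJ: "a \<notin> insert b J" "b \<notin> J" using ab by (auto simp: J_def)
    \<comment> \<open>G ignores the values at a and b, so every map on J is counted n^2
      times.\<close>
    have "(\<Sum>\<phi>\<in>maps. G \<phi>) = (\<Sum>u\<in>V. \<Sum>v\<in>V. \<Sum>\<phi>\<in>J \<rightarrow>\<^sub>E V. G (\<phi>(b := v, a := u)))"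
      by (subst k, subst sum_PiE_insert[OF nJ(1)], subst sum_PiE_insert[OF nJ(2)]) (rule refl)
    also have "\<dots> = (\<Sum>u\<in>V. \<Sum>v\<in>V. \<Sum>\<phi>\<in>J \<rightarrow>\<^sub>E V. G \<phi>)"
      by (intro sum.cong refl G_cong) (use nJ in auto)
    also have "\<dots> = (real n)\<^sup>2 * (\<Sum>\<phi>\<in>J \<rightarrow>\<^sub>E V. G \<phi>)"
      by (simp add: power2_eq_square)
    finally have "(\<Sum>\<phi>\<in>maps. G \<phi>) = (real n)\<^sup>2 * (\<Sum>\<phi>\<in>J \<rightarrow>\<^sub>E V. G \<phi>)" .
    moreover have "nk = (real n)\<^sup>2 * real n ^ card J"
    proof -
      have "card J = k - 2" using ab by (simp add: J_def card_Diff_subset)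
      moreover have "k \<ge> 2" using ab by auto
      ultimately have "k = 2 + card J" by simp
      then show ?thesis by (metis power_add)
    qed
    ultimately show ?thesis using n
      by (simp add: sum_divide_distrib[symmetric] power_divide)
  qed
  finally show ?thesis by (simp only: G_def J_def)
qed

text \<open>The velocity preserves step kernels over the partition, and on them the kernel equation
  is the matrix equation.\<close>

lemma vel_step:
  assumes "x \<in> space M" "y \<in> space M"
  shows "vel (step w) x y = rate w (col x) (col y)"
proof -
  have "vel (step w) x y = (\<Sum>e\<in>arcs F. (\<Sum>\<phi>\<in>maps. hom_weight F w (\<phi>(fst e := col x, snd e := col y))) / nk)"
    unfolding vel_def case_prod_beta
    by (rule sum.cong[OF refl], rule integral_step_PiM) (use assms in auto)
  then show ?thesis by (simp add: rate_def case_prod_beta sum_divide_distrib)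
qed

text \<open>The norm is an essential supremum in \<open>ereal\<close>; the lower bound is there for
  squeezing it to 0.\<close>

lemma linf_norm_step:
  assumes f: "\<And>x y. x \<in> space M \<Longrightarrow> y \<in> space M \<Longrightarrow> f x y = step d x y"
    and c: "\<And>u v. u \<in> V \<Longrightarrow> v \<in> V \<Longrightarrow> \<bar>d u v\<bar> \<le> c"
  shows "0 \<le> linf_norm M f" "linf_norm M f \<le> ereal c"
proof -
  have eq: "(case p of (x, y) \<Rightarrow> ereal \<bar>f x y\<bar>) = ereal \<bar>step d (fst p) (snd p)\<bar>" if "p \<in> space (M \<Otimes>\<^sub>M M)" for p
    using that f[of "fst p" "snd p"] by (simp add: case_prod_beta space_pair_measure mem_Times_iff)
  have "(\<lambda>p. ereal \<bar>step d (fst p) (snd p)\<bar>) \<in> borel_measurable (M \<Otimes>\<^sub>M M)"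
    using measurable_step[of d] by measurable
  then have meas: "(\<lambda>(x, y). ereal \<bar>f x y\<bar>) \<in> borel_measurable (M \<Otimes>\<^sub>M M)"
    by (subst measurable_cong[OF eq])
  show "linf_norm M f \<le> ereal c"
    unfolding linf_norm_def
  proof (rule esssup_I[OF meas], rule AE_I2)
    fix p assume p: "p \<in> space (M \<Otimes>\<^sub>M M)"
    then have "fst p \<in> space M" "snd p \<in> space M" by (auto simp: space_pair_measure)
    then show "(case p of (x, y) \<Rightarrow> ereal \<bar>f x y\<bar>) \<le> ereal c"
      unfolding eq[OF p] using c[OF col_in col_in] by (simp add: step_def)
  qed
  show "0 \<le> linf_norm M f"
  proof (rule ccontr)
    assume neg: "\<not> 0 \<le> linf_norm M f"
    have "AE p in M \<Otimes>\<^sub>M M. (case p of (x, y) \<Rightarrow> ereal \<bar>f x y\<bar>) \<le> linf_norm M f"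
      unfolding linf_norm_def by (rule esssup_AE)
    then have "AE p in M \<Otimes>\<^sub>M M. False"
    proof eventually_elim
      case (elim p)
      have "0 \<le> (case p of (x, y) \<Rightarrow> ereal \<bar>f x y\<bar>)" by (simp add: case_prod_beta)
      then show ?case using elim neg by (meson order.trans)
    qed
    then show False by (simp add: pair.P.AE_False)
  qed
qed

text \<open>There are finitely many entries, so entrywise derivatives give a derivative in the
  L-infinity norm: the sum of the entrywise errors bounds them all.\<close>

lemma flow_trajectory:
  assumes w: "is_flow w" and W: "\<And>x y. x \<in> space M \<Longrightarrow> y \<in> space M \<Longrightarrow> W x y = step (w 0) x y"
  shows "is_trajectory M k (removal_rule F) W (\<lambda>t. step (w t))"
  unfolding is_trajectory_def
proof (intro conjI allI impI)
  have K: "kernel M (step (w t))" if "0 \<le> t" for t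
    by (rule kernel_step) (rule flow_sym[OF w that])
  show "kernel M (step (w t))" if "0 \<le> t" for t by (rule K[OF that])
  show "AE (x, y) in M \<Otimes>\<^sub>M M. step (w 0) x y = W x y"
    using W by (intro AE_I2) (auto simp: space_pair_measure)
  fix t :: real assume t: "0 \<le> t"
  define d where "d s u v = (w s u v - w t u v) / (s - t) + rate (w t) u v" for s u v
  let ?f = "\<lambda>s x y. (step (w s) x y - step (w t) x y) / (s - t) - velocity M k (removal_rule F) (step (w t)) x y"
  have f: "?f s x y = step (d s) x y" if "x \<in> space M" "y \<in> space M" for s x y
    using velocity_removal[OF K[OF t] that] vel_step[OF that, of "w t"] by (simp add: step_def d_def)
  define c where "c s = (\<Sum>u\<in>V. \<Sum>v\<in>V. \<bar>d s u v\<bar>)" for s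
  have dc: "\<bar>d s u v\<bar> \<le> c s" if "u \<in> V" "v \<in> V" for s u v
  proof -
    have "\<bar>d s u v\<bar> \<le> (\<Sum>v\<in>V. \<bar>d s u v\<bar>)" by (rule member_le_sum) (use that in auto)
    also have "\<dots> \<le> c s" unfolding c_def
      by (rule member_le_sum[where f = "\<lambda>u. \<Sum>v\<in>V. \<bar>d s u v\<bar>"]) (use that in \<open>auto intro: sum_nonneg\<close>)
    finally show ?thesis .
  qed
  have lim: "((\<lambda>s. d s u v) \<longlongrightarrow> 0) (at t within {0..})" if "u \<in> V" "v \<in> V" for u v
  proof -
    have "((\<lambda>s. (w s u v - w t u v) / (s - t)) \<longlongrightarrow> - rate (w t) u v) (at t within {0..})"
      using flow_deriv[OF w t that] by (simp add: has_field_derivative_iff)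
    then have "((\<lambda>s. d s u v) \<longlongrightarrow> - rate (w t) u v + rate (w t) u v) (at t within {0..})"
      unfolding d_def by (intro tendsto_intros)
    then show ?thesis by simp
  qed
  have "(c \<longlongrightarrow> (\<Sum>u\<in>V. \<Sum>v\<in>V. \<bar>0\<bar>)) (at t within {0..})"
    unfolding c_def by (intro tendsto_sum tendsto_rabs lim)
  then have "((\<lambda>s. ereal (c s)) \<longlongrightarrow> 0) (at t within {0..})"
    by (simp add: zero_ereal_def)
  then show "((\<lambda>s. linf_norm M (?f s)) \<longlongrightarrow> 0) (at t within {0..})"
    by (rule tendsto_sandwich[OF _ _ tendsto_const, rotated 2])
       (auto intro!: always_eventually linf_norm_step[OF f dc])
qed

text \<open>A measurable set S occupies the fraction n times the measure of
  \<open>S \<inter> \<Omega> u\<close> of class u. A rectangle integral is therefore a weighted sum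
  with weights in [0, 1], to which \<open>cut_bound_weighted\<close> applies.\<close>

lemma cut_dist_step_le:
  assumes cut: "cut_bound V V (\<lambda>u v. w u v - w' u v) (K * (real n)\<^sup>2)"
  shows "cut_dist M (step w) (step w') \<le> K"
proof (rule cut_dist_leI)
  fix S T assume ST: "S \<in> sets M" "T \<in> sets M"
  let ?m = "\<lambda>A u. measure M (A \<inter> \<Omega> u)"
  define d where "d u v = w u v - w' u v" for u v
  have sets: "A \<inter> \<Omega> u \<in> sets M" if "A \<in> sets M" "u \<in> V" for A u
    using that \<Omega>_sets by auto
  have point: "indicator (S \<times> T) p * (step w (fst p) (snd p) - step w' (fst p) (snd p)) =
      (\<Sum>q\<in>V \<times> V. d (fst q) (snd q) * indicator ((S \<inter> \<Omega> (fst q)) \<times> (T \<inter> \<Omega> (snd q))) p)"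
    if "p \<in> space (M \<Otimes>\<^sub>M M)" for p
  proof -
    have p: "fst p \<in> space M" "snd p \<in> space M" using that by (auto simp: space_pair_measure)
    have "(\<Sum>q\<in>V \<times> V. d (fst q) (snd q) * indicator ((S \<inter> \<Omega> (fst q)) \<times> (T \<inter> \<Omega> (snd q))) p) =
        (\<Sum>q\<in>V \<times> V. if q = (col (fst p), col (snd p)) then d (fst q) (snd q) * indicator (S \<times> T) p else 0)"
    proof (rule sum.cong[OF refl])
      fix q assume "q \<in> V \<times> V"
      then have "fst q \<in> V" "snd q \<in> V" by auto
      then have "fst p \<in> \<Omega> (fst q) \<longleftrightarrow> col (fst p) = fst q" "snd p \<in> \<Omega> (snd q) \<longleftrightarrow> col (snd p) = snd q"
        using in_\<Omega>_iff p by blast+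
      then show "d (fst q) (snd q) * indicator ((S \<inter> \<Omega> (fst q)) \<times> (T \<inter> \<Omega> (snd q))) p =
          (if q = (col (fst p), col (snd p)) then d (fst q) (snd q) * indicator (S \<times> T) p else 0)"
        by (cases p; cases q) (auto simp: indicator_def)
    qed
    also have "\<dots> = d (col (fst p)) (col (snd p)) * indicator (S \<times> T) p"
      using col_in[OF p(1)] col_in[OF p(2)] by (subst sum.delta) auto
    finally show ?thesis by (simp add: d_def step_def)
  qed
  have meas: "measure (M \<Otimes>\<^sub>M M) (A \<times> B) = measure M A * measure M B" if "A \<in> sets M" "B \<in> sets M" for A B
    using emeasure_pair_measure_Times[OF that] by (simp add: measure_def enn2real_mult)
  have "rect_int (\<lambda>x y. step w x y - step w' x y) S T =
      (\<integral>p. (\<Sum>q\<in>V \<times> V. d (fst q) (snd q) * indicator ((S \<inter> \<Omega> (fst q)) \<times> (T \<inter> \<Omega> (snd q))) p) \<partial>(M \<Otimes>\<^sub>M M))"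
    unfolding rect_int_def by (rule Bochner_Integration.integral_cong[OF refl point])
  also have "\<dots> = (\<Sum>q\<in>V \<times> V. d (fst q) (snd q) * (?m S (fst q) * ?m T (snd q)))"
  proof (subst Bochner_Integration.integral_sum)
    fix q assume q: "q \<in> V \<times> V"
    have R: "(S \<inter> \<Omega> (fst q)) \<times> (T \<inter> \<Omega> (snd q)) \<in> sets (M \<Otimes>\<^sub>M M)"
      using q by (intro pair_measureI sets ST) auto
    then show "integrable (M \<Otimes>\<^sub>M M) (\<lambda>p. d (fst q) (snd q) * indicator ((S \<inter> \<Omega> (fst q)) \<times> (T \<inter> \<Omega> (snd q))) p)"
      by (intro integrable_mult_right) (simp add: pair.P.emeasure_eq_measure)
  next
    show "(\<Sum>q\<in>V \<times> V. \<integral>p. d (fst q) (snd q) * indicator ((S \<inter> \<Omega> (fst q)) \<times> (T \<inter> \<Omega> (snd q))) p \<partial>(M \<Otimes>\<^sub>M M)) =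
      (\<Sum>q\<in>V \<times> V. d (fst q) (snd q) * (?m S (fst q) * ?m T (snd q)))"
    proof (rule sum.cong[OF refl])
      fix q assume q: "q \<in> V \<times> V"
      have R: "(S \<inter> \<Omega> (fst q)) \<times> (T \<inter> \<Omega> (snd q)) \<in> sets (M \<Otimes>\<^sub>M M)"
        using q by (intro pair_measureI sets ST) auto
      have "(\<integral>p. indicat_real ((S \<inter> \<Omega> (fst q)) \<times> (T \<inter> \<Omega> (snd q))) p \<partial>(M \<Otimes>\<^sub>M M)) =
          measure (M \<Otimes>\<^sub>M M) ((S \<inter> \<Omega> (fst q)) \<times> (T \<inter> \<Omega> (snd q)))"
        using sets.sets_into_space[OF R] by (simp add: Int_absorb2)
      also have "\<dots> = ?m S (fst q) * ?m T (snd q)"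
        by (rule meas) (use q ST in \<open>auto intro!: sets\<close>)
      finally show "(\<integral>p. d (fst q) (snd q) * indicator ((S \<inter> \<Omega> (fst q)) \<times> (T \<inter> \<Omega> (snd q))) p \<partial>(M \<Otimes>\<^sub>M M)) =
          d (fst q) (snd q) * (?m S (fst q) * ?m T (snd q))"
        by simp
    qed
  qed
  also have "\<dots> = (\<Sum>u\<in>V. \<Sum>v\<in>V. (real n * ?m S u) * (real n * ?m T v) * d u v) / (real n)\<^sup>2"
    unfolding sum.cartesian_product case_prod_beta sum_divide_distrib
    by (rule sum.cong[OF refl]) (use n in \<open>simp add: power2_eq_square\<close>)
  also have "\<bar>\<dots>\<bar> = \<bar>\<Sum>u\<in>V. \<Sum>v\<in>V. (real n * ?m S u) * (real n * ?m T v) * d u v\<bar> / (real n)\<^sup>2"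
    by (simp add: abs_divide)
  also have "\<dots> \<le> K"
  proof -
    have m01: "0 \<le> real n * ?m A u \<and> real n * ?m A u \<le> 1" if "u \<in> V" for A u
    proof -
      have "?m A u \<le> 1 / real n"
        using finite_measure_mono[of "A \<inter> \<Omega> u" "\<Omega> u"] \<Omega>_sets[OF that] \<Omega>_measure[OF that] by simp
      then show ?thesis using n by (simp add: field_simps)
    qed
    have "\<bar>\<Sum>u\<in>V. \<Sum>v\<in>V. (real n * ?m S u) * (real n * ?m T v) * d u v\<bar> \<le> K * (real n)\<^sup>2"
      by (rule cut_bound_weighted) (use cut m01 in \<open>auto simp: d_def\<close>)
    then show ?thesis using n by (simp add: pos_divide_le_eq)
  qed
  finally show "\<bar>rect_int (\<lambda>x y. step w x y - step w' x y) S T\<bar> \<le> K" .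
qed

text \<open>Wasteful by a factor n^2, but used only for limits in time while n is fixed.\<close>

lemma cut_dist_step_le_sum:
  "cut_dist M (step w) (step w') \<le> (\<Sum>u\<in>V. \<Sum>v\<in>V. \<bar>w u v - w' u v\<bar>)"
proof (rule cut_dist_step_le)
  let ?s = "\<Sum>u\<in>V. \<Sum>v\<in>V. \<bar>w u v - w' u v\<bar>"
  have s: "?s \<le> ?s * (real n)\<^sup>2"
    using n mult_left_mono[of 1 "(real n)\<^sup>2" ?s] by (simp add: sum_nonneg)
  show "cut_bound V V (\<lambda>u v. w u v - w' u v) (?s * (real n)\<^sup>2)"
    unfolding cut_bound_def
  proof (intro allI impI)
    fix A B assume AB: "A \<subseteq> V" "B \<subseteq> V"
    have "\<bar>\<Sum>u\<in>A. \<Sum>v\<in>B. w u v - w' u v\<bar> \<le> (\<Sum>u\<in>A. \<Sum>v\<in>B. \<bar>w u v - w' u v\<bar>)"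
      by (rule order.trans[OF sum_abs sum_mono]) (rule sum_abs)
    also have "\<dots> \<le> (\<Sum>u\<in>A. \<Sum>v\<in>V. \<bar>w u v - w' u v\<bar>)"
      by (rule sum_mono, rule sum_mono2) (use AB in auto)
    also have "\<dots> \<le> ?s"
      by (rule sum_mono2) (use AB in \<open>auto intro: sum_nonneg\<close>)
    finally show "\<bar>\<Sum>u\<in>A. \<Sum>v\<in>B. w u v - w' u v\<bar> \<le> ?s * (real n)\<^sup>2" using s by linarith
  qed
qed

section \<open>Destinations of graph kernels\<close>

lemma cut_dist_flow_tendsto:
  fixes w :: "real \<Rightarrow> nat \<Rightarrow> nat \<Rightarrow> real"
  assumes "\<And>u v. u \<in> V \<Longrightarrow> v \<in> V \<Longrightarrow> ((\<lambda>t. w t u v) \<longlongrightarrow> l u v) at_top"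
  shows "((\<lambda>t. \<Sum>u\<in>V. \<Sum>v\<in>V. \<bar>w t u v - l u v\<bar>) \<longlongrightarrow> 0) at_top"
proof -
  have "((\<lambda>t. \<Sum>u\<in>V. \<Sum>v\<in>V. \<bar>w t u v - l u v\<bar>) \<longlongrightarrow> (\<Sum>u\<in>V. \<Sum>v\<in>V. \<bar>l u v - l u v\<bar>)) at_top"
    by (intro tendsto_sum tendsto_rabs tendsto_diff tendsto_const assms)
  then show ?thesis by simp
qed

lemma cut_dist_nonneg:
  assumes "kernel M U" "kernel M W"
  shows "0 \<le> cut_dist M U W"
  using rect_int_le_cut_dist[OF assms sets.top sets.top] by linarith

text \<open>This witness is what makes the choice in \<open>dest\<close> return a destination at
  all.\<close>

lemma destination_exists:
  assumes w: "is_flow w" and W: "\<And>x y. x \<in> space M \<Longrightarrow> y \<in> space M \<Longrightarrow> W x y = step (w 0) x y"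
    and l: "unit_on V l" "\<And>u v. u \<in> V \<Longrightarrow> v \<in> V \<Longrightarrow> l u v = l v u"
    and lim: "\<And>u v. u \<in> V \<Longrightarrow> v \<in> V \<Longrightarrow> ((\<lambda>t. w t u v) \<longlongrightarrow> l u v) at_top"
  shows "is_destination M k (removal_rule F) W (step l)"
  unfolding is_destination_def
proof (intro conjI exI)
  have Kl: "kernel M (step l)" by (rule kernel_step[OF l(2)])
  show "graphon M (step l)"
    using Kl unit_onD[OF l(1) col_in col_in] by (simp add: graphon_def step_def)
  show "is_trajectory M k (removal_rule F) W (\<lambda>t. step (w t))" by (rule flow_trajectory[OF w W])
  show "((\<lambda>t. cut_dist M (step (w t)) (step l)) \<longlongrightarrow> 0) at_top"
  proof (rule tendsto_sandwich[OF _ _ tendsto_const cut_dist_flow_tendsto[of w l, OF lim]])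
    show "\<forall>\<^sub>F t in at_top. 0 \<le> cut_dist M (step (w t)) (step l)"
      using eventually_ge_at_top[of 0]
      by eventually_elim (intro cut_dist_nonneg Kl kernel_step flow_sym[OF w])
  qed (rule always_eventually, rule allI, rule cut_dist_step_le_sum)
qed

text \<open>S is an arbitrary destination, reached by some unknown trajectory. Uniqueness identifies
  that trajectory with the flow almost everywhere at each time, and the triangle inequality through
  time t loses nothing as t tends to infinity.\<close>

lemma cut_dist_destination:
  assumes S: "is_destination M k (removal_rule F) W S"
    and w: "is_flow w" and W: "\<And>x y. x \<in> space M \<Longrightarrow> y \<in> space M \<Longrightarrow> W x y = step (w 0) x y"
    and l: "\<And>u v. u \<in> V \<Longrightarrow> v \<in> V \<Longrightarrow> l u v = l v u"
    and lim: "\<And>u v. u \<in> V \<Longrightarrow> v \<in> V \<Longrightarrow> ((\<lambda>t. w t u v) \<longlongrightarrow> l u v) at_top"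
    and d: "\<And>u v. u \<in> V \<Longrightarrow> v \<in> V \<Longrightarrow> d u v = d v u"
    and D: "kernel M D" "\<And>x y. x \<in> space M \<Longrightarrow> y \<in> space M \<Longrightarrow> D x y = step d x y"
    and cut: "cut_bound V V (\<lambda>u v. l u v - d u v) (K * (real n)\<^sup>2)"
  shows "cut_dist M S D \<le> K"
proof -
  obtain \<Phi> where \<Phi>: "is_trajectory M k (removal_rule F) W \<Phi>" "((\<lambda>t. cut_dist M (\<Phi> t) S) \<longlongrightarrow> 0) at_top"
    using S by (auto simp: is_destination_def)
  have KS: "kernel M S" using S by (simp add: is_destination_def graphon_def)
  have Kl: "kernel M (step l)" by (rule kernel_step[OF l])
  have Kd: "kernel M (step d)" by (rule kernel_step[OF d])
  have bound: "cut_dist M S D \<le> cut_dist M (\<Phi> t) S + ((\<Sum>u\<in>V. \<Sum>v\<in>V. \<bar>w t u v - l u v\<bar>) + K)" if t: "0 \<le> t" for t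
  proof -
    have K\<Phi>: "kernel M (\<Phi> t)" using \<Phi>(1) t by (simp add: is_trajectory_def)
    have Kw: "kernel M (step (w t))" by (rule kernel_step) (rule flow_sym[OF w t])
    have "cut_dist M S D \<le> cut_dist M S (\<Phi> t) + cut_dist M (\<Phi> t) D"
      by (rule cut_dist_triangle[OF KS K\<Phi> D(1)])
    moreover have "cut_dist M (\<Phi> t) D \<le> cut_dist M (step (w t)) (step d)"
    proof (rule cut_dist_AE_le[OF K\<Phi> Kw D(1) Kd])
      show "AE p in M \<Otimes>\<^sub>M M. \<Phi> t (fst p) (snd p) = step (w t) (fst p) (snd p)"
      proof (rule trajectory_unique[OF \<Phi>(1) flow_trajectory[OF w W] _ t])
        fix t x y assume "0 \<le> (t :: real)" "x \<in> space M" "y \<in> space M"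
        then show "\<bar>step (w t) x y\<bar> \<le> 1"
          using unit_onD[OF flow_unit[OF w] col_in col_in, of t x y] by (simp add: step_def)
      qed
      show "AE p in M \<Otimes>\<^sub>M M. D (fst p) (snd p) = step d (fst p) (snd p)"
        using D(2) by (intro AE_I2) (auto simp: space_pair_measure)
    qed
    moreover have "cut_dist M (step (w t)) (step d) \<le> cut_dist M (step (w t)) (step l) + cut_dist M (step l) (step d)"
      by (rule cut_dist_triangle[OF Kw Kl Kd])
    moreover have "cut_dist M (step (w t)) (step l) \<le> (\<Sum>u\<in>V. \<Sum>v\<in>V. \<bar>w t u v - l u v\<bar>)"
      by (rule cut_dist_step_le_sum)
    moreover have "cut_dist M (step l) (step d) \<le> K" by (rule cut_dist_step_le[OF cut])
    ultimately show ?thesis using cut_dist_commute[of S "\<Phi> t"] by linarith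
  qed
  have "((\<lambda>t. cut_dist M (\<Phi> t) S + ((\<Sum>u\<in>V. \<Sum>v\<in>V. \<bar>w t u v - l u v\<bar>) + K)) \<longlongrightarrow> 0 + (0 + K)) at_top"
    by (intro tendsto_add tendsto_const \<Phi>(2) cut_dist_flow_tendsto lim)
  then have "cut_dist M S D \<le> 0 + (0 + K)"
    by (rule tendsto_lowerbound) (use bound in \<open>auto simp: eventually_at_top_linorder\<close>)
  then show ?thesis by simp
qed

end

section \<open>The chain of removals\<close>

text \<open>For negative x the bound \<open>exp x \<le> 1 / (1 - x)\<close> suffices, since
  \<open>(1 + x + x\<^sup>2) * (1 - x) = 1 - x ^ 3\<close> is at least 1.\<close>

lemma exp_le_quadratic:
  fixes x :: real
  assumes "\<bar>x\<bar> \<le> 1"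
  shows "exp x \<le> 1 + x + x\<^sup>2"
proof (cases "0 \<le> x")
  case True
  then show ?thesis using exp_bound[of x] assms by simp
next
  case False
  have "1 - x \<le> exp (- x)" using exp_ge_add_one_self[of "- x"] by simp
  then have "exp x \<le> 1 / (1 - x)"
    using False by (simp add: exp_minus field_simps)
  also have "\<dots> \<le> 1 + x + x\<^sup>2"
  proof -
    have "(1 + x + x\<^sup>2) * (1 - x) = 1 - x ^ 3" by (simp add: power2_eq_square power3_eq_cube algebra_simps)
    moreover have "x * x\<^sup>2 \<le> 0" using False by (intro mult_nonpos_nonneg) auto
    then have "x ^ 3 \<le> 0" by (simp add: power3_eq_cube power2_eq_square)
    ultimately show ?thesis using False by (simp add: pos_divide_le_eq)
  qed
  finally show ?thesis .
qed

text \<open>The difference is a - b, where a is the effect of dividing by the smaller number and b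
  that of the missing summands; both lie between 0 and the bound. It serves to pass from injective
  tuples to all maps.\<close>

lemma avg_subset_diff:
  fixes f :: "'a \<Rightarrow> real"
  assumes S: "finite S" "T \<subseteq> S" "T \<noteq> {}" and f: "\<And>x. x \<in> S \<Longrightarrow> 0 \<le> f x \<and> f x \<le> m"
  shows "\<bar>(\<Sum>x\<in>T. f x) / real (card T) - (\<Sum>x\<in>S. f x) / real (card S)\<bar> \<le> m * (1 - real (card T) / real (card S))"
proof -
  have T: "finite T" using S finite_subset by blast
  have cT: "real (card T) > 0" "real (card T) \<le> real (card S)"
    using S T by (auto simp: card_gt_0_iff intro: card_mono)
  then have cS: "real (card S) > 0" by linarith
  have split: "(\<Sum>x\<in>S. f x) = (\<Sum>x\<in>T. f x) + (\<Sum>x\<in>S - T. f x)"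
    using sum.subset_diff[OF S(2,1), of f] by simp
  have t: "0 \<le> (\<Sum>x\<in>T. f x)" "(\<Sum>x\<in>T. f x) \<le> real (card T) * m"
    using S f sum_bounded_above[of T f m] by (auto intro!: sum_nonneg)
  have r: "0 \<le> (\<Sum>x\<in>S - T. f x)" "(\<Sum>x\<in>S - T. f x) \<le> (real (card S) - real (card T)) * m"
    using S T f sum_bounded_above[of "S - T" f m] cT(2) by (auto intro!: sum_nonneg simp: card_Diff_subset of_nat_diff card_mono)
  define a where "a = (\<Sum>x\<in>T. f x) / real (card T) - (\<Sum>x\<in>T. f x) / real (card S)"
  define b where "b = (\<Sum>x\<in>S - T. f x) / real (card S)"
  have a_eq: "a = (\<Sum>x\<in>T. f x) / real (card T) * (1 - real (card T) / real (card S))"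
    using cT cS by (simp add: a_def field_simps)
  have q: "0 \<le> 1 - real (card T) / real (card S)" using cT cS by simp
  have "0 \<le> a" unfolding a_eq using t q cT by (intro mult_nonneg_nonneg) auto
  moreover have "a \<le> m * (1 - real (card T) / real (card S))"
    unfolding a_eq using t cT q by (intro mult_right_mono) (auto simp: pos_divide_le_eq mult.commute)
  moreover have "0 \<le> b" using r cS by (simp add: b_def)
  moreover have "b \<le> m * (1 - real (card T) / real (card S))"
    using r cS by (simp add: b_def field_simps)
  moreover have "(\<Sum>x\<in>T. f x) / real (card T) - (\<Sum>x\<in>S. f x) / real (card S) = a - b"
    by (simp add: split a_def b_def add_divide_distrib)
  ultimately show ?thesis by linarith
qed

locale removal_chain = removal_flow k n F for k n F +
  assumes kn: "k \<le> n"
begin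

abbreviation K :: "graph \<Rightarrow> graph pmf" where "K \<equiv> flip_step k (removal_rule F) n"

definition strip :: "graph \<Rightarrow> (nat \<Rightarrow> nat) \<Rightarrow> graph" where
  "strip h v = (if (`) v ` F \<subseteq> h then h - (`) v ` F else h)"

lemma tuples_maps: "tuples k n \<subseteq> maps" by (auto simp: tuples_def)

lemma finite_tuples [simp]: "finite (tuples k n)"
  by (rule finite_subset[OF tuples_maps finite_maps])

lemma tuples_nonempty: "tuples k n \<noteq> {}"
proof -
  have "restrict id {1..k} \<in> tuples k n"
    using kn by (auto simp: tuples_def inj_on_def)
  then show ?thesis by blast
qed

lemma tuples_inj: "v \<in> tuples k n \<Longrightarrow> inj_on v {1..k}" by (simp add: tuples_def)

lemma F_sub: "e \<in> F \<Longrightarrow> e \<in> pairs k" using F by (auto simp: graphs_def)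

lemma pairs_image_inj:
  assumes "v \<in> tuples k n" "v ` e = v ` e'" "e \<in> pairs k" "e' \<in> pairs k"
  shows "e = e'"
  using assms(2-) inj_on_image_eq_iff[OF tuples_inj[OF assms(1)], of e e'] by (simp add: pairs_def)

lemma rule_row_removal:
  assumes "H \<in> graphs k"
  shows "rule_row k (removal_rule F) H = return_pmf (if F \<subseteq> H then H - F else H)"
proof (rule pmf_eqI)
  fix H'
  define T where "T = (if F \<subseteq> H then H - F else H)"
  have "T \<in> graphs k" using assms by (auto simp: graphs_def T_def)
  then have "pmf (rule_row k (removal_rule F) H) H' = pmf (return_pmf T) H'"
    unfolding pmf_rule_row[OF flip_rule_removal_rule assms] removal_rule_def T_def[symmetric]
    by (cases "H' = T") (simp_all add: pmf_return)
  then show "pmf (rule_row k (removal_rule F) H) H' = pmf (return_pmf (if F \<subseteq> H then H - F else H)) H'"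
    by (simp only: T_def)
qed

text \<open>An edge of h inside the image of v is the image of a unique pair in [k]. Putting the
  drawn graph back unchanged thus restores h, and omitting F from it deletes precisely the images of
  the edges of F.\<close>

lemma replace_graph_removal:
  assumes h: "h \<in> graphs n" and v: "v \<in> tuples k n"
  shows "replace_graph k h v (if F \<subseteq> drawn_graph k h v then drawn_graph k h v - F else drawn_graph k h v) = strip h v"
proof -
  note inj_im = pairs_image_inj[OF v]
  have preimage: "\<exists>e'\<in>pairs k. e = v ` e'" if e: "e \<in> h" "e \<subseteq> v ` {1..k}" for e
  proof -
    obtain e' where e': "e' \<subseteq> {1..k}" "e = v ` e'" using e(2) by (auto simp: subset_image_iff)
    have "card e = 2" using h e by (auto simp: graphs_def pairs_def)
    moreover have "card e = card e'"
      using e' inj_on_subset[OF tuples_inj[OF v] e'(1)] by (simp add: card_image)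
    ultimately show ?thesis using e' by (auto simp: pairs_def)
  qed
  have im_sub: "v ` e \<subseteq> v ` {1..k}" if "e \<in> pairs k" for e using that by (auto simp: pairs_def)
  have Fd: "F \<subseteq> drawn_graph k h v \<longleftrightarrow> (`) v ` F \<subseteq> h"
    using F_sub by (auto simp: drawn_graph_def)
  have all: "replace_graph k h v (drawn_graph k h v - E) = h - (`) v ` E" if E: "E \<subseteq> pairs k" for E
  proof (rule set_eqI)
    fix e
    show "e \<in> replace_graph k h v (drawn_graph k h v - E) \<longleftrightarrow> e \<in> h - (`) v ` E"
    proof
      assume "e \<in> replace_graph k h v (drawn_graph k h v - E)"
      then consider "e \<in> h" "\<not> e \<subseteq> v ` {1..k}" | e' where "e' \<in> pairs k" "v ` e' \<in> h" "e' \<notin> E" "e = v ` e'"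
        by (auto simp: replace_graph_def drawn_graph_def)
      then show "e \<in> h - (`) v ` E"
      proof cases
        case 1
        then show ?thesis using im_sub E by auto
      next
        case 2
        then have "e \<notin> (`) v ` E" using inj_im E by blast
        then show ?thesis using 2 by simp
      qed
    next
      assume e: "e \<in> h - (`) v ` E"
      show "e \<in> replace_graph k h v (drawn_graph k h v - E)"
      proof (cases "e \<subseteq> v ` {1..k}")
        case True
        then obtain e' where "e' \<in> pairs k" "e = v ` e'" using preimage e by blast
        then show ?thesis using e by (auto simp: replace_graph_def drawn_graph_def)
      qed (use e in \<open>simp add: replace_graph_def\<close>)
    qed
  qed
  have "F \<subseteq> pairs k" using F_sub by blast
  then show ?thesis unfolding Fd strip_def using all[of F] all[of "{}"] by auto
qed

lemma flip_step_removal: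
  assumes h: "h \<in> graphs n"
  shows "K h = map_pmf (strip h) (pmf_of_set (tuples k n))"
proof -
  have "drawn_graph k h v \<in> graphs k" for v by (auto simp: drawn_graph_def graphs_def)
  then have "K h = bind_pmf (pmf_of_set (tuples k n)) (\<lambda>v. return_pmf (replace_graph k h v
      (if F \<subseteq> drawn_graph k h v then drawn_graph k h v - F else drawn_graph k h v)))"
    unfolding flip_step_def by (simp add: rule_row_removal bind_return_pmf)
  also have "\<dots> = bind_pmf (pmf_of_set (tuples k n)) (\<lambda>v. return_pmf (strip h v))"
    by (rule bind_pmf_cong[OF refl])
       (simp add: replace_graph_removal[OF h] set_pmf_of_set[OF tuples_nonempty finite_tuples])
  finally show ?thesis by (simp add: map_pmf_def)
qed

lemma set_K: "h \<in> graphs n \<Longrightarrow> set_pmf (K h) = strip h ` tuples k n"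
  by (simp add: flip_step_removal set_pmf_of_set[OF tuples_nonempty finite_tuples])

lemma strip_graphs: "h \<in> graphs n \<Longrightarrow> strip h v \<in> graphs n"
  by (auto simp: strip_def graphs_def)

lemma strip_sub: "strip h v \<subseteq> h" by (auto simp: strip_def)

lemma F_edge_pairs: "e \<in> F \<longleftrightarrow> (\<exists>(i, j)\<in>edge_pairs F. e = {i, j})"
proof
  assume e: "e \<in> F"
  then have "card e = 2" using F_sub by (auto simp: pairs_def)
  then obtain i j where ij: "e = {i, j}" "i \<noteq> j" by (auto simp: card_2_iff)
  then have "(min i j, max i j) \<in> edge_pairs F" "e = {min i j, max i j}"
    using e by (auto simp: edge_pairs_def min_def max_def insert_commute)
  then show "\<exists>(i, j)\<in>edge_pairs F. e = {i, j}" by blast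
qed (auto simp: edge_pairs_def)

lemma hom_weight_adj: "hom_weight F (adj h) v = of_bool ((`) v ` F \<subseteq> h)"
proof (cases "(`) v ` F \<subseteq> h")
  case True
  have "hom_weight F (adj h) v = (\<Prod>e\<in>edge_pairs F. 1)"
    unfolding hom_weight_def
  proof (rule prod.cong[OF refl])
    fix e assume "e \<in> edge_pairs F"
    then have "{fst e, snd e} \<in> F" by (auto simp: edge_pairs_def)
    then have "v ` {fst e, snd e} \<in> h" using True by blast
    then show "adj h (v (fst e)) (v (snd e)) = 1" by (simp add: adj_def)
  qed
  then show ?thesis using True by simp
next
  case False
  then obtain e where e: "e \<in> F" "v ` e \<notin> h" by blast
  obtain i j where "(i, j) \<in> edge_pairs F" "e = {i, j}" using F_edge_pairs[THEN iffD1, OF e(1)] by auto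
  then have "hom_weight F (adj h) v = 0"
    unfolding hom_weight_def
    using e by (intro prod_zero bexI[of _ "(i, j)"]) (simp_all add: adj_def)
  then show ?thesis using False by simp
qed

text \<open>For a tuple v, the number of ordered pairs of Z that its step removes from h. Written as
  a sum over arcs, its mean takes the form found in \<open>sum_rate\<close>.\<close>

definition loss :: "(nat \<times> nat) set \<Rightarrow> graph \<Rightarrow> (nat \<Rightarrow> nat) \<Rightarrow> real" where
  "loss Z h v = (\<Sum>(a, b)\<in>arcs F. of_bool ((v a, v b) \<in> Z) * hom_weight F (adj h) v)"

lemma loss_bounds:
  assumes "v \<in> maps"
  shows "0 \<le> loss Z h v" "loss Z h v \<le> mF"
proof -
  have u: "0 \<le> hom_weight F (adj h) v \<and> hom_weight F (adj h) v \<le> 1"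
    by (rule hom_weight_unit[OF unit_on_adj assms])
  show "0 \<le> loss Z h v" unfolding loss_def case_prod_beta using u by (intro sum_nonneg) simp
  have "loss Z h v \<le> (\<Sum>(a, b)\<in>arcs F. 1)"
    unfolding loss_def case_prod_beta using u by (intro sum_mono) (simp add: of_bool_def)
  then show "loss Z h v \<le> mF" by (simp add: case_prod_beta)
qed

text \<open>Injectivity of v sends distinct arcs of F to distinct ordered pairs, so the removed
  pairs in Z can be counted by arcs.\<close>

lemma strip_sum:
  assumes v: "v \<in> tuples k n" and Z: "Z \<subseteq> V \<times> V"
  shows "(\<Sum>(x, y)\<in>Z. adj (strip h v) x y - adj h x y) = - loss Z h v"
proof (cases "(`) v ` F \<subseteq> h")
  case False
  then show ?thesis by (simp add: strip_def loss_def hom_weight_adj case_prod_beta)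
next
  case True
  have finZ: "finite Z" using Z by (rule finite_subset) simp
  have inj: "inj_on v {1..k}" by (rule tuples_inj[OF v])
  have "(\<Sum>(x, y)\<in>Z. adj (strip h v) x y - adj h x y) = (\<Sum>p\<in>Z. - (if {fst p, snd p} \<in> (`) v ` F then 1 else 0))"
    using True by (intro sum.cong) (auto simp: strip_def adj_def)
  also have "\<dots> = - real (card {p\<in>Z. {fst p, snd p} \<in> (`) v ` F})"
    using finZ by (simp add: sum_negf sum.inter_filter[symmetric])
  also have "{p\<in>Z. {fst p, snd p} \<in> (`) v ` F} = map_prod v v ` {p\<in>arcs F. map_prod v v p \<in> Z}"
  proof (rule set_eqI)
    fix p
    show "p \<in> {p\<in>Z. {fst p, snd p} \<in> (`) v ` F} \<longleftrightarrow> p \<in> map_prod v v ` {p\<in>arcs F. map_prod v v p \<in> Z}"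
    proof
      assume p: "p \<in> {p\<in>Z. {fst p, snd p} \<in> (`) v ` F}"
      then obtain e where e: "e \<in> F" "{fst p, snd p} = v ` e" by blast
      obtain i j where ij: "(i, j) \<in> edge_pairs F" "e = {i, j}"
        using F_edge_pairs[THEN iffD1, OF e(1)] by auto
      then have arc: "(i, j) \<in> arcs F" "(j, i) \<in> arcs F" using edge_pairs_arcs arcs_swap by blast+
      have "{fst p, snd p} = {v i, v j}" using e ij by simp
      then have "p = (v i, v j) \<or> p = (v j, v i)" by (cases p) (auto simp: doubleton_eq_iff)
      then have "p = map_prod v v (i, j) \<or> p = map_prod v v (j, i)" by simp
      then show "p \<in> map_prod v v ` {p\<in>arcs F. map_prod v v p \<in> Z}" using arc p by blast
    next
      assume "p \<in> map_prod v v ` {p\<in>arcs F. map_prod v v p \<in> Z}"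
      then obtain a b where "(a, b) \<in> arcs F" "p = (v a, v b)" "p \<in> Z" by auto
      moreover have "{v a, v b} \<in> (`) v ` F" if "{a, b} \<in> F"
        by (rule image_eqI[OF _ that]) simp
      ultimately show "p \<in> {p\<in>Z. {fst p, snd p} \<in> (`) v ` F}" by (simp add: arcs_def)
    qed
  qed
  also have "card \<dots> = card {p\<in>arcs F. map_prod v v p \<in> Z}"
  proof (rule card_image)
    show "inj_on (map_prod v v) {p\<in>arcs F. map_prod v v p \<in> Z}"
      using arcsD inj by (force simp: inj_on_def)
  qed
  also have "real (card {p\<in>arcs F. map_prod v v p \<in> Z}) = loss Z h v"
    using True by (simp add: loss_def hom_weight_adj case_prod_beta map_prod_def sum.inter_filter[symmetric] of_bool_def)
  finally show ?thesis .
qed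

text \<open>Union bound over the coordinates that may coincide; one given coincidence has
  probability \<open>1 / n\<close>, by resampling one of the two coordinates.\<close>

lemma noninjective_maps: "nk - real (card (tuples k n)) \<le> nk * ((real k)\<^sup>2 / real n)"
proof -
  let ?P = "{(i, j). i \<in> {1..k} \<and> j \<in> {1..k} \<and> i \<noteq> j}"
  have finP: "finite ?P" by (rule finite_subset[of _ "{1..k} \<times> {1..k}"]) auto
  have one: "real (card {\<phi>\<in>maps. \<phi> i = \<phi> j}) = nk / real n" if ij: "i \<in> {1..k}" "i \<noteq> j" "j \<in> {1..k}" for i j
  proof -
    let ?g = "\<lambda>\<phi>. if \<phi> i = \<phi> j then 1 else 0 :: real"
    have "(\<Sum>\<phi>\<in>maps. \<Sum>x\<in>V. ?g (\<phi>(i := x))) = (\<Sum>\<phi>\<in>maps. 1)"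
    proof (rule sum.cong[OF refl])
      fix \<phi> assume "\<phi> \<in> maps"
      then have "\<phi> j \<in> V" using ij PiE_mem by blast
      then show "(\<Sum>x\<in>V. ?g (\<phi>(i := x))) = 1" using ij by (simp add: sum.delta)
    qed
    then have "real n * (\<Sum>\<phi>\<in>maps. ?g \<phi>) = nk"
      using sum_PiE_resample[OF ij(1), where U = "\<lambda>_. V" and g = ?g] card_maps by simp
    moreover have "(\<Sum>\<phi>\<in>maps. ?g \<phi>) = real (card {\<phi>\<in>maps. \<phi> i = \<phi> j})"
      using sum.inter_filter[OF finite_maps, of "\<lambda>_. 1 :: real" "\<lambda>\<phi>. \<phi> i = \<phi> j"] by simp
    ultimately show ?thesis using n by (simp add: field_simps)
  qed
  have sub: "maps - tuples k n \<subseteq> (\<Union>p\<in>?P. {\<phi>\<in>maps. \<phi> (fst p) = \<phi> (snd p)})"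
    unfolding tuples_def inj_on_def by fastforce
  have "nk - real (card (tuples k n)) = real (card (maps - tuples k n))"
    by (simp only: card_Diff_subset[OF finite_tuples tuples_maps]
      of_nat_diff[OF card_mono[OF finite_maps tuples_maps]] card_maps)
  also have "\<dots> \<le> real (card (\<Union>p\<in>?P. {\<phi>\<in>maps. \<phi> (fst p) = \<phi> (snd p)}))"
    by (intro of_nat_mono card_mono sub) (rule finite_subset[OF _ finite_maps], auto)
  also have "\<dots> \<le> real (\<Sum>p\<in>?P. card {\<phi>\<in>maps. \<phi> (fst p) = \<phi> (snd p)})"
    by (intro of_nat_mono card_UN_le finP)
  also have "\<dots> = (\<Sum>p\<in>?P. nk / real n)"
    unfolding of_nat_sum by (rule sum.cong[OF refl], rule one) auto
  also have "\<dots> = real (card ?P) * (nk / real n)" by simp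
  also have "\<dots> \<le> (real k)\<^sup>2 * (nk / real n)"
  proof (rule mult_right_mono)
    have "card ?P \<le> card ({1..k} \<times> {1..k})" by (rule card_mono) auto
    then show "real (card ?P) \<le> (real k)\<^sup>2"
      by (simp add: card_cartesian_product power2_eq_square flip: of_nat_mult)
  qed simp
  finally show ?thesis by (simp add: mult_ac)
qed

text \<open>Over all maps the mean of \<open>loss\<close> is exactly the rate divided by n^2. The
  tuples of the process are injective, and this accounts for the whole error.\<close>

lemma mean_loss:
  assumes Z: "Z \<subseteq> V \<times> V"
  shows "\<bar>(\<Sum>v\<in>tuples k n. loss Z h v) / real (card (tuples k n)) - (\<Sum>(x, y)\<in>Z. rate (adj h) x y) / (real n)\<^sup>2\<bar>
    \<le> mF * ((real k)\<^sup>2 / real n)"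
proof -
  have "(\<Sum>(x, y)\<in>Z. rate (adj h) x y) / (real n)\<^sup>2 = (\<Sum>v\<in>maps. loss Z h v) / real (card maps)"
    unfolding sum_rate[OF Z] loss_def case_prod_beta card_maps
    using n by (subst sum.swap) simp
  moreover have "\<bar>(\<Sum>v\<in>tuples k n. loss Z h v) / real (card (tuples k n)) - (\<Sum>v\<in>maps. loss Z h v) / real (card maps)\<bar>
      \<le> mF * (1 - real (card (tuples k n)) / real (card maps))"
    by (rule avg_subset_diff[OF finite_maps tuples_maps tuples_nonempty]) (use loss_bounds in auto)
  moreover have "1 - real (card (tuples k n)) / real (card maps) \<le> (real k)\<^sup>2 / real n"
  proof -
    have "1 - real (card (tuples k n)) / nk = (nk - real (card (tuples k n))) / nk"
      using nk_pos by (simp add: diff_divide_distrib)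
    also have "\<dots> \<le> (real k)\<^sup>2 / real n"
      using noninjective_maps nk_pos by (simp add: pos_divide_le_eq mult.commute)
    finally show ?thesis by (simp only: card_maps)
  qed
  then have "mF * (1 - real (card (tuples k n)) / real (card maps)) \<le> mF * ((real k)\<^sup>2 / real n)"
    by (intro mult_left_mono) auto
  ultimately show ?thesis by linarith
qed

text \<open>Second-order expansion of the exponential, with \<open>loss\<close> between 0 and
  \<open>mF\<close>. The three exponents are the drift, the bias from non-injective maps and the
  variance term. The parameter l may have either sign, for the two tails.\<close>

lemma step_mgf:
  assumes h: "h \<in> graphs n" and Z: "Z \<subseteq> V \<times> V" and l: "\<bar>l\<bar> * mF \<le> 1"
  shows "measure_pmf.expectation (K h) (\<lambda>h'. exp (l * (\<Sum>(x, y)\<in>Z. adj h' x y - adj h x y))) \<le>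
    exp (- (l * ((\<Sum>(x, y)\<in>Z. rate (adj h) x y) / (real n)\<^sup>2)) + \<bar>l\<bar> * (mF * ((real k)\<^sup>2 / real n)) + l\<^sup>2 * mF\<^sup>2)"
proof -
  let ?T = "tuples k n"
  let ?c = "real (card ?T)"
  have c: "?c > 0" using tuples_nonempty by (simp add: card_gt_0_iff)
  define \<mu> where "\<mu> = (\<Sum>v\<in>?T. loss Z h v) / ?c"
  define r where "r = (\<Sum>(x, y)\<in>Z. rate (adj h) x y) / (real n)\<^sup>2"
  have "measure_pmf.expectation (K h) (\<lambda>h'. exp (l * (\<Sum>(x, y)\<in>Z. adj h' x y - adj h x y))) =
      (\<Sum>v\<in>?T. exp (l * (\<Sum>(x, y)\<in>Z. adj (strip h v) x y - adj h x y))) / ?c"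
    unfolding flip_step_removal[OF h]
    by (simp add: integral_pmf_of_set[OF tuples_nonempty finite_tuples])
  also have "\<dots> = (\<Sum>v\<in>?T. exp (- (l * loss Z h v))) / ?c"
    by (simp add: strip_sum[OF _ Z])
  also have "\<dots> \<le> (\<Sum>v\<in>?T. 1 + - (l * loss Z h v) + l\<^sup>2 * mF\<^sup>2) / ?c"
  proof (intro divide_right_mono sum_mono)
    fix v assume "v \<in> ?T"
    then have v: "v \<in> maps" using tuples_maps by blast
    have "\<bar>l * loss Z h v\<bar> \<le> \<bar>l\<bar> * mF"
      using loss_bounds[OF v, of Z h] by (simp add: abs_mult mult_left_mono)
    then have "\<bar>- (l * loss Z h v)\<bar> \<le> 1" using l by linarith
    from exp_le_quadratic[OF this]
    have "exp (- (l * loss Z h v)) \<le> 1 + - (l * loss Z h v) + l\<^sup>2 * (loss Z h v)\<^sup>2"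
      by (simp add: power_mult_distrib)
    moreover have "l\<^sup>2 * (loss Z h v)\<^sup>2 \<le> l\<^sup>2 * mF\<^sup>2"
      using loss_bounds[OF v, of Z h] by (intro mult_left_mono power_mono) auto
    ultimately show "exp (- (l * loss Z h v)) \<le> 1 + - (l * loss Z h v) + l\<^sup>2 * mF\<^sup>2" by linarith
  qed simp
  also have "\<dots> = 1 + (- (l * \<mu>) + l\<^sup>2 * mF\<^sup>2)"
  proof -
    have "(\<Sum>v\<in>?T. loss Z h v) = ?c * \<mu>" using c by (simp add: \<mu>_def)
    then have "(\<Sum>v\<in>?T. 1 + - (l * loss Z h v) + l\<^sup>2 * mF\<^sup>2) = ?c * (1 + (- (l * \<mu>) + l\<^sup>2 * mF\<^sup>2))"
      by (simp add: sum.distrib sum_subtractf sum_distrib_left[symmetric] algebra_simps)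
    moreover have "?c \<noteq> 0" using c by linarith
    ultimately show ?thesis by (metis nonzero_mult_div_cancel_left)
  qed
  also have "\<dots> \<le> exp (- (l * \<mu>) + l\<^sup>2 * mF\<^sup>2)" by (rule exp_ge_add_one_self)
  also have "\<dots> \<le> exp (- (l * r) + \<bar>l\<bar> * (mF * ((real k)\<^sup>2 / real n)) + l\<^sup>2 * mF\<^sup>2)"
  proof -
    have "\<bar>l * (\<mu> - r)\<bar> \<le> \<bar>l\<bar> * (mF * ((real k)\<^sup>2 / real n))"
      unfolding abs_mult using mean_loss[OF Z, of h] by (intro mult_left_mono) (auto simp: \<mu>_def r_def)
    then have "- (l * \<mu>) \<le> - (l * r) + \<bar>l\<bar> * (mF * ((real k)\<^sup>2 / real n))"
      by (simp add: algebra_simps abs_le_iff)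
    then show ?thesis by simp
  qed
  finally show ?thesis by (simp add: r_def)
qed

end

section \<open>Deviation of many steps from their drift\<close>

lemma prob_le_expectation:
  assumes "finite (set_pmf p)" "\<And>x. 0 \<le> f x" "\<And>x. x \<in> X \<Longrightarrow> 1 \<le> f x"
  shows "measure_pmf.prob p X \<le> measure_pmf.expectation p f"
proof -
  have "measure_pmf.prob p X = measure_pmf.expectation p (indicator X)" by simp
  also have "\<dots> \<le> measure_pmf.expectation p f"
    by (rule integral_mono) (use assms in \<open>auto simp: integrable_measure_pmf_finite indicator_def\<close>)
  finally show ?thesis .
qed

lemma cut_bound_add:
  assumes "cut_bound X Y d K" "cut_bound X Y d' K'"
  shows "cut_bound X Y (\<lambda>x y. d x y + d' x y) (K + K')"
  unfolding cut_bound_def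
proof (intro allI impI)
  fix A B assume "A \<subseteq> X" "B \<subseteq> Y"
  then have "\<bar>\<Sum>x\<in>A. \<Sum>y\<in>B. d x y\<bar> \<le> K" "\<bar>\<Sum>x\<in>A. \<Sum>y\<in>B. d' x y\<bar> \<le> K'"
    using assms by (auto simp: cut_bound_def)
  then show "\<bar>\<Sum>x\<in>A. \<Sum>y\<in>B. d x y + d' x y\<bar> \<le> K + K'" by (simp add: sum.distrib)
qed

lemma cut_bound_scale:
  assumes "cut_bound X Y d K" "0 \<le> c"
  shows "cut_bound X Y (\<lambda>x y. c * d x y) (c * K)"
  using assms by (simp add: cut_bound_def abs_mult mult_left_mono flip: sum_distrib_left)

lemma cut_bound_mono: "cut_bound X Y d K \<Longrightarrow> K \<le> K' \<Longrightarrow> cut_bound X Y d K'"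
  unfolding cut_bound_def by (meson order.trans)

lemma cut_bound_cong:
  assumes "\<And>x y. x \<in> X \<Longrightarrow> y \<in> Y \<Longrightarrow> d x y = d' x y"
  shows "cut_bound X Y d K = cut_bound X Y d' K"
proof -
  have "(\<Sum>x\<in>A. \<Sum>y\<in>B. d x y) = (\<Sum>x\<in>A. \<Sum>y\<in>B. d' x y)" if "A \<subseteq> X" "B \<subseteq> Y" for A B
    by (intro sum.cong refl assms) (use that in auto)
  then show ?thesis by (simp add: cut_bound_def)
qed

lemma cut_bound_sum_abs:
  assumes "finite X" "finite Y" "(\<Sum>x\<in>X. \<Sum>y\<in>Y. \<bar>d x y\<bar>) \<le> K"
  shows "cut_bound X Y d K"
  unfolding cut_bound_def
proof (intro allI impI)
  fix A B assume AB: "A \<subseteq> X" "B \<subseteq> Y"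
  have "\<bar>\<Sum>x\<in>A. \<Sum>y\<in>B. d x y\<bar> \<le> (\<Sum>x\<in>A. \<Sum>y\<in>B. \<bar>d x y\<bar>)"
    by (rule order.trans[OF sum_abs sum_mono]) (rule sum_abs)
  also have "\<dots> \<le> (\<Sum>x\<in>A. \<Sum>y\<in>Y. \<bar>d x y\<bar>)"
    by (rule sum_mono, rule sum_mono2) (use AB assms in auto)
  also have "\<dots> \<le> (\<Sum>x\<in>X. \<Sum>y\<in>Y. \<bar>d x y\<bar>)"
    by (rule sum_mono2) (use AB assms in \<open>auto intro: sum_nonneg\<close>)
  finally show "\<bar>\<Sum>x\<in>A. \<Sum>y\<in>B. d x y\<bar> \<le> K" using assms(3) by linarith
qed

context removal_chain
begin

primrec chain :: "graph \<Rightarrow> nat \<Rightarrow> graph pmf" where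
  "chain g 0 = return_pmf g"
| "chain g (Suc s) = bind_pmf (chain g s) K"

lemma chain_add: "chain g (s + t) = bind_pmf (chain g s) (\<lambda>h. chain h t)"
  by (induction t) (simp_all add: bind_return_pmf' bind_assoc_pmf)

text \<open>Each step removes at most \<open>mF\<close> ordered pairs, so the motion within a block
  is bounded with certainty. This is what allows the rate to be frozen.\<close>

lemma chain_support:
  assumes g: "g \<in> graphs n" and h: "h \<in> set_pmf (chain g s)"
  shows "h \<in> graphs n \<and> h \<subseteq> g \<and> (\<Sum>(x, y)\<in>V \<times> V. adj g x y - adj h x y) \<le> real s * mF"
  using h
proof (induction s arbitrary: h)
  case 0
  then show ?case using g by simp
next
  case (Suc s)
  then obtain h' where h': "h' \<in> set_pmf (chain g s)" "h \<in> set_pmf (K h')" by auto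
  have IH: "h' \<in> graphs n" "h' \<subseteq> g" "(\<Sum>(x, y)\<in>V \<times> V. adj g x y - adj h' x y) \<le> real s * mF"
    using Suc.IH[OF h'(1)] by blast+
  obtain v where v: "v \<in> tuples k n" "h = strip h' v" using h'(2) set_K[OF IH(1)] by auto
  have "(\<Sum>(x, y)\<in>V \<times> V. adj g x y - adj h x y) =
      (\<Sum>(x, y)\<in>V \<times> V. adj g x y - adj h' x y) - (\<Sum>(x, y)\<in>V \<times> V. adj h x y - adj h' x y)"
    unfolding case_prod_beta sum_subtractf by simp
  also have "\<dots> = (\<Sum>(x, y)\<in>V \<times> V. adj g x y - adj h' x y) + loss (V \<times> V) h' v"
    unfolding v(2) strip_sum[OF v(1) order.refl] by simp
  also have "\<dots> \<le> real s * mF + mF"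
    using IH(3) loss_bounds(2)[of v "V \<times> V" h'] tuples_maps v(1) by (intro add_mono) auto
  finally show ?case
    using strip_graphs[OF IH(1)] strip_sub[of h' v] IH(2) v(2) by (simp add: algebra_simps)
qed

lemma set_chain_sub: "g \<in> graphs n \<Longrightarrow> set_pmf (chain g s) \<subseteq> graphs n"
  using chain_support by blast

lemma finite_set_chain: "g \<in> graphs n \<Longrightarrow> finite (set_pmf (chain g s))"
  using set_chain_sub finite_graphs by (rule finite_subset)

lemma expectation_bind_graphs:
  assumes "set_pmf p \<subseteq> graphs n" "\<And>h. h \<in> graphs n \<Longrightarrow> finite (set_pmf (q h))"
  shows "measure_pmf.expectation (bind_pmf p q) f =
    (\<Sum>h\<in>graphs n. pmf p h * measure_pmf.expectation (q h) (f :: graph \<Rightarrow> real))"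
  using pmf_expectation_bind[of "graphs n" q p f] assms by simp

lemma expectation_graphs:
  assumes "set_pmf p \<subseteq> graphs n"
  shows "measure_pmf.expectation p f = (\<Sum>h\<in>graphs n. pmf p h * (f h :: real))"
  using integral_measure_pmf[of "graphs n" p f] assms by (auto simp: subset_iff)

text \<open>Deleting edges changes all entries in the same direction, so the lost mass bounds every
  rectangle sum.\<close>

lemma cut_bound_subgraph:
  assumes "h \<subseteq> g" "(\<Sum>(x, y)\<in>V \<times> V. adj g x y - adj h x y) \<le> c"
  shows "cut_bound V V (\<lambda>x y. adj h x y - adj g x y) c"
proof (rule cut_bound_sum_abs)
  have "\<bar>adj h x y - adj g x y\<bar> = adj g x y - adj h x y" for x y
    using assms(1) by (auto simp: adj_def)
  then show "(\<Sum>x\<in>V. \<Sum>y\<in>V. \<bar>adj h x y - adj g x y\<bar>) \<le> c"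
    using assms(2) by (simp add: sum.cartesian_product)
qed simp_all

text \<open>The first term accounts for non-injective maps, the second for the motion of the graph during
  \<open>B\<close> steps.\<close>

definition drift_error :: "nat \<Rightarrow> real" where
  "drift_error B = mF * ((real k)\<^sup>2 / real n) + mF * eF * (real B * mF / (real n)\<^sup>2)"

text \<open>Freezing the rate at the starting graph g makes the compensator a fixed number per step;
  \<open>rate_cut_lipschitz\<close> bounds its distance from the true rate during the block.
  Conditioning on the graph before the last step then multiplies the moment by one step
  factor.\<close>

lemma chain_mgf:
  assumes g: "g \<in> graphs n" and AB: "A \<subseteq> V" "C \<subseteq> V" and l: "\<bar>l\<bar> * mF \<le> 1" and s: "s \<le> B"
  shows "measure_pmf.expectation (chain g s) (\<lambda>h. exp (l * ((\<Sum>(x, y)\<in>A \<times> C. adj h x y - adj g x y) +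
      real s * ((\<Sum>(x, y)\<in>A \<times> C. rate (adj g) x y) / (real n)\<^sup>2)))) \<le>
    exp (real s * (\<bar>l\<bar> * drift_error B + l\<^sup>2 * mF\<^sup>2))"
  using s
proof (induction s)
  case 0
  then show ?case by simp
next
  case (Suc s)
  let ?Z = "A \<times> C"
  have Z: "?Z \<subseteq> V \<times> V" using AB by auto
  define r where "r h = (\<Sum>(x, y)\<in>?Z. rate (adj h) x y) / (real n)\<^sup>2" for h
  define D where "D h h' = (\<Sum>(x, y)\<in>?Z. adj h x y - adj h' x y)" for h h'
  define c where "c = \<bar>l\<bar> * drift_error B + l\<^sup>2 * mF\<^sup>2"
  let ?f = "\<lambda>s h. exp (l * (D h g + real s * r g))"
  have stepb: "measure_pmf.expectation (K h) (?f (Suc s)) \<le> exp c * ?f s h" if h: "h \<in> set_pmf (chain g s)" for h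
  proof -
    have hg: "h \<in> graphs n" "h \<subseteq> g" "(\<Sum>(x, y)\<in>V \<times> V. adj g x y - adj h x y) \<le> real s * mF"
      using chain_support[OF g h] by blast+
    have "real s * mF \<le> real B * mF" using Suc.prems by (intro mult_right_mono) auto
    then have "cut_bound V V (\<lambda>x y. adj h x y - adj g x y) (real B * mF / (real n)\<^sup>2 * (real n)\<^sup>2)"
      using n hg by (intro cut_bound_subgraph) auto
    from rate_cut_lipschitz[OF unit_on_adj unit_on_adj this]
    have "\<bar>\<Sum>x\<in>A. \<Sum>y\<in>C. rate (adj h) x y - rate (adj g) x y\<bar> \<le> mF * eF * (real B * mF / (real n)\<^sup>2) * (real n)\<^sup>2"
      using AB unfolding cut_bound_def by blast
    then have "\<bar>(\<Sum>x\<in>A. \<Sum>y\<in>C. rate (adj h) x y - rate (adj g) x y) / (real n)\<^sup>2\<bar> \<le> mF * eF * (real B * mF / (real n)\<^sup>2)"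
      using n by (simp add: abs_divide pos_divide_le_eq)
    moreover have "(\<Sum>x\<in>A. \<Sum>y\<in>C. rate (adj h) x y - rate (adj g) x y) / (real n)\<^sup>2 = r h - r g"
      by (simp add: r_def sum.cartesian_product case_prod_beta sum_subtractf diff_divide_distrib)
    ultimately have rr: "\<bar>r h - r g\<bar> \<le> mF * eF * (real B * mF / (real n)\<^sup>2)" by simp
    have "measure_pmf.expectation (K h) (?f (Suc s)) =
        measure_pmf.expectation (K h) (\<lambda>h'. exp (l * r g) * ?f s h * exp (l * D h' h))"
    proof (rule Bochner_Integration.integral_cong[OF refl])
      fix h'
      have "D h' g = D h' h + D h g" by (simp add: D_def case_prod_beta sum_subtractf)
      then show "?f (Suc s) h' = exp (l * r g) * ?f s h * exp (l * D h' h)"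
        by (simp add: exp_add[symmetric] algebra_simps)
    qed
    also have "\<dots> = exp (l * r g) * ?f s h * measure_pmf.expectation (K h) (\<lambda>h'. exp (l * D h' h))"
      by simp
    also have "\<dots> \<le> exp (l * r g) * ?f s h * exp (- (l * r h) + \<bar>l\<bar> * (mF * ((real k)\<^sup>2 / real n)) + l\<^sup>2 * mF\<^sup>2)"
      unfolding D_def r_def by (intro mult_left_mono step_mgf hg Z l) simp
    also have "\<dots> = exp (l * r g - l * r h + \<bar>l\<bar> * (mF * ((real k)\<^sup>2 / real n)) + l\<^sup>2 * mF\<^sup>2) * ?f s h"
      by (simp add: exp_add[symmetric] algebra_simps)
    also have "\<dots> \<le> exp c * ?f s h"
    proof -
      have "l * r g - l * r h \<le> \<bar>l\<bar> * (mF * eF * (real B * mF / (real n)\<^sup>2))"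
      proof -
        have "l * r g - l * r h \<le> \<bar>l * (r h - r g)\<bar>" by (simp add: right_diff_distrib)
        also have "\<dots> \<le> \<bar>l\<bar> * (mF * eF * (real B * mF / (real n)\<^sup>2))"
          unfolding abs_mult using rr by (intro mult_left_mono) auto
        finally show ?thesis .
      qed
      then have "l * r g - l * r h + \<bar>l\<bar> * (mF * ((real k)\<^sup>2 / real n)) + l\<^sup>2 * mF\<^sup>2 \<le> c"
        by (simp add: c_def drift_error_def distrib_left)
      then show ?thesis by simp
    qed
    finally show ?thesis .
  qed
  have "measure_pmf.expectation (chain g (Suc s)) (?f (Suc s)) =
      (\<Sum>h\<in>graphs n. pmf (chain g s) h * measure_pmf.expectation (K h) (?f (Suc s)))"
    unfolding chain.simps
    by (rule expectation_bind_graphs[OF set_chain_sub[OF g]]) (simp add: set_K)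
  also have "\<dots> \<le> (\<Sum>h\<in>graphs n. pmf (chain g s) h * (exp c * ?f s h))"
  proof (rule sum_mono)
    fix h
    show "pmf (chain g s) h * measure_pmf.expectation (K h) (?f (Suc s)) \<le> pmf (chain g s) h * (exp c * ?f s h)"
    proof (cases "h \<in> set_pmf (chain g s)")
      case True
      then show ?thesis by (intro mult_left_mono stepb) auto
    qed (simp add: set_pmf_iff)
  qed
  also have "\<dots> = exp c * measure_pmf.expectation (chain g s) (?f s)"
    unfolding expectation_graphs[OF set_chain_sub[OF g]] by (simp add: sum_distrib_left mult_ac)
  also have "\<dots> \<le> exp c * exp (real s * c)"
    using Suc by (intro mult_left_mono) (auto simp: D_def r_def c_def)
  also have "\<dots> = exp (real (Suc s) * c)" by (simp add: exp_add[symmetric] algebra_simps)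
  finally show ?case by (simp add: D_def r_def c_def)
qed

text \<open>Markov's inequality for the exponential moments with parameters l and -l, for each of
  the 2^n times 2^n pairs of subsets of V.\<close>

lemma block_deviation:
  assumes g: "g \<in> graphs n" and l: "0 < l" "l * mF \<le> 1"
  shows "measure_pmf.prob (chain g B) {h. \<not> cut_bound V V (\<lambda>x y. adj h x y - adj g x y +
      real B / (real n)\<^sup>2 * rate (adj g) x y) \<beta>} \<le>
    4 ^ n * (2 * exp (real B * (l * drift_error B + l\<^sup>2 * mF\<^sup>2) - l * \<beta>))"
proof -
  let ?p = "chain g B"
  let ?b = "exp (real B * (l * drift_error B + l\<^sup>2 * mF\<^sup>2) - l * \<beta>)"
  define dev where "dev h = (\<lambda>(A, C). \<Sum>x\<in>A. \<Sum>y\<in>C. adj h x y - adj g x y + real B / (real n)\<^sup>2 * rate (adj g) x y)" for h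
  have tail: "measure_pmf.prob ?p {h. t * dev h q \<ge> l * \<beta>} \<le> ?b"
    if q: "q \<in> Pow V \<times> Pow V" and t: "\<bar>t\<bar> = l" for q t
  proof -
    obtain A C where AC: "q = (A, C)" "A \<subseteq> V" "C \<subseteq> V" using q by (cases q) auto
    have dev_eq: "dev h q = (\<Sum>(x, y)\<in>A \<times> C. adj h x y - adj g x y) +
      real B * ((\<Sum>(x, y)\<in>A \<times> C. rate (adj g) x y) / (real n)\<^sup>2)" for h
      by (simp add: dev_def AC sum.cartesian_product case_prod_beta sum.distrib sum_distrib_left sum_divide_distrib)
    have "measure_pmf.prob ?p {h. t * dev h q \<ge> l * \<beta>} \<le>
        measure_pmf.expectation ?p (\<lambda>h. exp (- (l * \<beta>)) * exp (t * dev h q))"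
      by (rule prob_le_expectation[OF finite_set_chain[OF g]]) (auto simp flip: exp_add)
    also have "\<dots> = exp (- (l * \<beta>)) * measure_pmf.expectation ?p (\<lambda>h. exp (t * dev h q))"
      by simp
    also have "\<dots> \<le> exp (- (l * \<beta>)) * exp (real B * (\<bar>t\<bar> * drift_error B + t\<^sup>2 * mF\<^sup>2))"
      unfolding dev_eq by (intro mult_left_mono chain_mgf g AC) (use t l in auto)
    also have "\<dots> = ?b"
    proof -
      have "t\<^sup>2 = l\<^sup>2" using t by (metis power2_abs)
      then show ?thesis using t by (simp add: exp_add[symmetric])
    qed
    finally show ?thesis .
  qed
  have "{h. \<not> cut_bound V V (\<lambda>x y. adj h x y - adj g x y + real B / (real n)\<^sup>2 * rate (adj g) x y) \<beta>} \<subseteq>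
      (\<Union>q\<in>Pow V \<times> Pow V. {h. l * dev h q \<ge> l * \<beta>} \<union> {h. - l * dev h q \<ge> l * \<beta>})"
  proof
    fix h assume "h \<in> {h. \<not> cut_bound V V (\<lambda>x y. adj h x y - adj g x y + real B / (real n)\<^sup>2 * rate (adj g) x y) \<beta>}"
    then obtain A C where AC: "A \<subseteq> V" "C \<subseteq> V" "\<beta> < \<bar>dev h (A, C)\<bar>"
      by (auto simp: cut_bound_def dev_def not_le)
    then have "\<beta> \<le> dev h (A, C) \<or> \<beta> \<le> - dev h (A, C)" by linarith
    then have "l * \<beta> \<le> l * dev h (A, C) \<or> l * \<beta> \<le> l * (- dev h (A, C))"
      using l(1) by (simp only: mult_le_cancel_left_pos)
    then show "h \<in> (\<Union>q\<in>Pow V \<times> Pow V. {h. l * dev h q \<ge> l * \<beta>} \<union> {h. - l * dev h q \<ge> l * \<beta>})"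
      using AC by (intro UN_I[of "(A, C)"]) auto
  qed
  then have "measure_pmf.prob ?p {h. \<not> cut_bound V V (\<lambda>x y. adj h x y - adj g x y + real B / (real n)\<^sup>2 * rate (adj g) x y) \<beta>} \<le>
      measure_pmf.prob ?p (\<Union>q\<in>Pow V \<times> Pow V. {h. l * dev h q \<ge> l * \<beta>} \<union> {h. - l * dev h q \<ge> l * \<beta>})"
    by (rule measure_pmf.finite_measure_mono) simp
  also have "\<dots> \<le> (\<Sum>q\<in>Pow V \<times> Pow V. measure_pmf.prob ?p ({h. l * dev h q \<ge> l * \<beta>} \<union> {h. - l * dev h q \<ge> l * \<beta>}))"
    by (rule measure_pmf.finite_measure_subadditive_finite) auto
  also have "\<dots> \<le> (\<Sum>q\<in>Pow V \<times> Pow V. 2 * ?b)"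
  proof (rule sum_mono)
    fix q assume q: "q \<in> Pow V \<times> Pow V"
    have "measure_pmf.prob ?p ({h. l * dev h q \<ge> l * \<beta>} \<union> {h. - l * dev h q \<ge> l * \<beta>}) \<le>
        measure_pmf.prob ?p {h. l * dev h q \<ge> l * \<beta>} + measure_pmf.prob ?p {h. - l * dev h q \<ge> l * \<beta>}"
      by (rule measure_Un_le) auto
    also have "\<dots> \<le> ?b + ?b" by (intro add_mono tail q) (use l in auto)
    finally show "measure_pmf.prob ?p ({h. l * dev h q \<ge> l * \<beta>} \<union> {h. - l * dev h q \<ge> l * \<beta>}) \<le> 2 * ?b" by simp
  qed
  also have "\<dots> = 4 ^ n * (2 * ?b)"
  proof -
    have "real (card (Pow V \<times> Pow V)) = 4 ^ n"
      by (simp add: card_cartesian_product card_Pow flip: power_mult_distrib)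
    then show ?thesis by simp
  qed
  finally show ?thesis .
qed

text \<open>Dominates the recursion of the tracking error: a block adds the fluctuation \<theta> and
  the Euler error, and multiplies the old error by \<open>1 + mF * eF * \<delta>\<close>.\<close>

definition block_error :: "real \<Rightarrow> real \<Rightarrow> nat \<Rightarrow> real" where
  "block_error \<theta> \<delta> j = real j * (\<theta> + mF * eF * mF * \<delta>\<^sup>2) * (1 + mF * eF * \<delta>) ^ j"

lemma block_error_Suc:
  assumes "0 \<le> \<theta>" "0 \<le> \<delta>"
  shows "\<theta> + block_error \<theta> \<delta> j + \<delta> * (mF * eF * block_error \<theta> \<delta> j) + mF * eF * mF * \<delta>\<^sup>2 \<le> block_error \<theta> \<delta> (Suc j)"
proof -
  define q where "q = 1 + mF * eF * \<delta>"
  define c where "c = \<theta> + mF * eF * mF * \<delta>\<^sup>2"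
  have q: "1 \<le> q" using assms by (simp add: q_def)
  have c: "0 \<le> c" using assms by (simp add: c_def)
  have "c * 1 \<le> c * q ^ Suc j" using c one_le_power[OF q, of "Suc j"] by (intro mult_left_mono) auto
  moreover have "\<theta> + block_error \<theta> \<delta> j + \<delta> * (mF * eF * block_error \<theta> \<delta> j) + mF * eF * mF * \<delta>\<^sup>2 = real j * c * q ^ Suc j + c"
    by (simp add: block_error_def q_def c_def algebra_simps)
  moreover have "block_error \<theta> \<delta> (Suc j) = real j * c * q ^ Suc j + c * q ^ Suc j"
    by (simp add: block_error_def q_def c_def algebra_simps)
  ultimately show ?thesis by simp
qed

text \<open>Each block is a noisy Euler step from the graph at its start. The failure bound p holds
  from every graph, so by the Markov property the failure probabilities of successive blocks simply
  add up.\<close>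

lemma flow_tracking:
  assumes w: "is_flow w" and w0: "\<And>x y. x \<in> V \<Longrightarrow> y \<in> V \<Longrightarrow> w 0 x y = adj G x y"
    and G: "G \<in> graphs n" and \<delta>: "\<delta> = real B / (real n)\<^sup>2" and \<theta>: "0 \<le> \<theta>"
    and p: "\<And>g. g \<in> graphs n \<Longrightarrow> measure_pmf.prob (chain g B) {h. \<not> cut_bound V V
      (\<lambda>x y. adj h x y - adj g x y + \<delta> * rate (adj g) x y) (\<theta> * (real n)\<^sup>2)} \<le> p"
  shows "measure_pmf.prob (chain G (j * B)) {h. \<not> cut_bound V V
      (\<lambda>x y. adj h x y - w (real j * \<delta>) x y) (block_error \<theta> \<delta> j * (real n)\<^sup>2)} \<le> real j * p"
proof (induction j)
  case 0
  have "cut_bound V V (\<lambda>x y. adj G x y - w (real 0 * \<delta>) x y) (block_error \<theta> \<delta> 0 * (real n)\<^sup>2)"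
  proof -
    have "cut_bound V V (\<lambda>x y. adj G x y - w (real 0 * \<delta>) x y) (block_error \<theta> \<delta> 0 * (real n)\<^sup>2) =
        cut_bound V V (\<lambda>_ _. 0) (block_error \<theta> \<delta> 0 * (real n)\<^sup>2)"
      by (rule cut_bound_cong) (use w0 in simp)
    then show ?thesis by (simp add: cut_bound_def block_error_def)
  qed
  then show ?case by simp
next
  case (Suc j)
  let ?bad = "\<lambda>j. {h. \<not> cut_bound V V (\<lambda>x y. adj h x y - w (real j * \<delta>) x y) (block_error \<theta> \<delta> j * (real n)\<^sup>2)}"
  let ?dev = "\<lambda>g. {h. \<not> cut_bound V V (\<lambda>x y. adj h x y - adj g x y + \<delta> * rate (adj g) x y) (\<theta> * (real n)\<^sup>2)}"
  have \<delta>0: "0 \<le> \<delta>" by (simp add: \<delta>)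
  have t0: "0 \<le> real j * \<delta>" using \<delta>0 by simp
  have p0: "0 \<le> p" using p[OF G] measure_nonneg order.trans by blast
  have incl: "?bad (Suc j) \<subseteq> ?dev g" if g: "g \<notin> ?bad j" for g
  proof
    fix h assume h: "h \<in> ?bad (Suc j)"
    show "h \<in> ?dev g"
    proof (rule ccontr)
      assume "h \<notin> ?dev g"
      then have 1: "cut_bound V V (\<lambda>x y. adj h x y - adj g x y + \<delta> * rate (adj g) x y) (\<theta> * (real n)\<^sup>2)" by simp
      have 2: "cut_bound V V (\<lambda>x y. adj g x y - w (real j * \<delta>) x y) (block_error \<theta> \<delta> j * (real n)\<^sup>2)" using g by simp
      have 3: "cut_bound V V (\<lambda>x y. \<delta> * - (rate (adj g) x y - rate (w (real j * \<delta>)) x y))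
          (\<delta> * (mF * eF * block_error \<theta> \<delta> j * (real n)\<^sup>2))"
        using rate_cut_lipschitz[OF unit_on_adj flow_unit[OF w t0] 2] \<delta>0
        by (intro cut_bound_scale) (simp_all only: cut_bound_uminus)
      define e where "e x y = - (w (real j * \<delta> + \<delta>) x y - w (real j * \<delta>) x y + \<delta> * rate (w (real j * \<delta>)) x y)" for x y
      have 4: "cut_bound V V e (mF * eF * mF * \<delta>\<^sup>2 * (real n)\<^sup>2)"
      proof (rule cut_bound_sum_abs)
        have "(\<Sum>x\<in>V. \<Sum>y\<in>V. \<bar>e x y\<bar>) \<le> (\<Sum>x\<in>V. \<Sum>y\<in>V. mF * eF * mF * \<delta>\<^sup>2)"
          unfolding e_def abs_minus_cancel by (intro sum_mono flow_euler[OF w t0 \<delta>0])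
        then show "(\<Sum>x\<in>V. \<Sum>y\<in>V. \<bar>e x y\<bar>) \<le> mF * eF * mF * \<delta>\<^sup>2 * (real n)\<^sup>2"
          by (simp add: power2_eq_square mult_ac)
      qed simp_all
      \<comment> \<open>Four errors: the fluctuation of the block, the inherited error, its effect
        on the rate, and the Euler error of the flow.\<close>
      have "cut_bound V V (\<lambda>x y. adj h x y - w (real (Suc j) * \<delta>) x y)
          (\<theta> * (real n)\<^sup>2 + block_error \<theta> \<delta> j * (real n)\<^sup>2 + \<delta> * (mF * eF * block_error \<theta> \<delta> j * (real n)\<^sup>2) +
           mF * eF * mF * \<delta>\<^sup>2 * (real n)\<^sup>2)"
        using cut_bound_add[OF cut_bound_add[OF cut_bound_add[OF 1 2] 3] 4]
        by (simp add: e_def algebra_simps)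
      then have "cut_bound V V (\<lambda>x y. adj h x y - w (real (Suc j) * \<delta>) x y) (block_error \<theta> \<delta> (Suc j) * (real n)\<^sup>2)"
      proof (rule cut_bound_mono)
        show "\<theta> * (real n)\<^sup>2 + block_error \<theta> \<delta> j * (real n)\<^sup>2 + \<delta> * (mF * eF * block_error \<theta> \<delta> j * (real n)\<^sup>2) +
           mF * eF * mF * \<delta>\<^sup>2 * (real n)\<^sup>2 \<le> block_error \<theta> \<delta> (Suc j) * (real n)\<^sup>2"
          using mult_right_mono[OF block_error_Suc[OF \<theta> \<delta>0, of j], of "(real n)\<^sup>2"]
          by (simp add: algebra_simps)
      qed
      then show False using h by simp
    qed
  qed
  have "measure_pmf.prob (chain G (Suc j * B)) (?bad (Suc j)) =
      measure_pmf.expectation (bind_pmf (chain G (j * B)) (\<lambda>h. chain h B)) (indicator (?bad (Suc j)))"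
    by (simp add: chain_add[symmetric] add.commute)
  also have "\<dots> = (\<Sum>g\<in>graphs n. pmf (chain G (j * B)) g * measure_pmf.prob (chain g B) (?bad (Suc j)))"
    by (subst expectation_bind_graphs) (auto simp: set_chain_sub[OF G] finite_set_chain)
  \<comment> \<open>From a bad start the trivial bound 1 is used, from a good one the failure bound
    p of a single block.\<close>
  also have "\<dots> \<le> (\<Sum>g\<in>graphs n. pmf (chain G (j * B)) g * (indicator (?bad j) g + p))"
  proof (intro sum_mono mult_left_mono)
    fix g assume g: "g \<in> graphs n"
    show "measure_pmf.prob (chain g B) (?bad (Suc j)) \<le> indicator (?bad j) g + p"
    proof (cases "g \<in> ?bad j")
      case True
      then have "indicator (?bad j) g = (1 :: real)" by (rule indicator_simps(1))
      then show ?thesis using p0 measure_pmf.prob_le_1[of "chain g B" "?bad (Suc j)"] by linarith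
    next
      case False
      then have "measure_pmf.prob (chain g B) (?bad (Suc j)) \<le> measure_pmf.prob (chain g B) (?dev g)"
        by (intro measure_pmf.finite_measure_mono incl) simp_all
      moreover have "indicator (?bad j) g = (0 :: real)" using False by (rule indicator_simps(2))
      ultimately show ?thesis using p[OF g] by linarith
    qed
  qed simp
  also have "\<dots> = measure_pmf.expectation (chain G (j * B)) (\<lambda>g. indicator (?bad j) g + p)"
    by (rule expectation_graphs[OF set_chain_sub[OF G], symmetric])
  also have "\<dots> = measure_pmf.prob (chain G (j * B)) (?bad j) + p"
    by (subst Bochner_Integration.integral_add)
       (auto intro!: integrable_measure_pmf_finite finite_set_chain[OF G])
  finally show ?case using Suc by (simp add: algebra_simps)
qed

section \<open>Sample paths of the removal process\<close>

context
  fixes P :: "'w measure" and G X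
  assumes FP: "flip_process P k (removal_rule F) n G X" and G: "G \<in> graphs n"
begin

interpretation P: prob_space P using FP by (simp add: flip_process_def)

lemma process_measurable: "X t \<in> P \<rightarrow>\<^sub>M count_space UNIV"
proof -
  have "X t \<in> P \<rightarrow>\<^sub>M count_space (graphs n)" using FP by (simp add: flip_process_def)
  from measurable_compose[OF this, of id "count_space UNIV"] show ?thesis by simp
qed

lemma process_in_graphs: "\<omega> \<in> space P \<Longrightarrow> X t \<omega> \<in> graphs n"
  using FP measurable_space[of "X t" P "count_space (graphs n)"] by (auto simp: flip_process_def)

lemma process_eq_pred: "Measurable.pred P (\<lambda>\<omega>. X t \<omega> = a)"
  using process_measurable[of t] by (rule pred_count_space_const1)

lemma path_prob:
  "measure P {\<omega> \<in> space P. \<forall>i\<le>t. X i \<omega> = g i} = of_bool (g 0 = G) * (\<Prod>i<t. pmf (K (g i)) (g (Suc i)))"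
  using FP by (simp add: flip_process_def)

lemma path_sets: "{\<omega> \<in> space P. \<forall>i\<le>t. X i \<omega> = g i} \<in> sets P"
proof -
  have "{\<omega> \<in> space P. \<forall>i\<in>{..t}. X i \<omega> = g i} \<in> sets P"
    by (rule sets.sets_Collect_finite_All) (simp_all add: process_eq_pred[unfolded pred_def])
  then show ?thesis by (simp only: Ball_def atMost_iff)
qed

text \<open>Only the joint distributions of initial segments are given, so both events are cut into
  the finitely many paths up to time m that end in a; one more step multiplies each path probability
  by the same factor.\<close>

lemma pair_prob:
  assumes a: "a \<in> graphs n"
  shows "measure P {\<omega> \<in> space P. X m \<omega> = a \<and> X (Suc m) \<omega> = b} =
    measure P {\<omega> \<in> space P. X m \<omega> = a} * pmf (K a) b"
proof -
  define \<Gamma> where "\<Gamma> = {g \<in> {..m} \<rightarrow>\<^sub>E graphs n. g m = a}"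
  have fin: "finite \<Gamma>" unfolding \<Gamma>_def by (rule finite_subset[of _ "{..m} \<rightarrow>\<^sub>E graphs n"]) (auto intro: finite_PiE)
  have ext: "g = g'" if "g \<in> \<Gamma>" "g' \<in> \<Gamma>" "\<And>i. i \<le> m \<Longrightarrow> g i = g' i" for g g'
    using that by (intro PiE_ext[of g "{..m}" "\<lambda>_. graphs n" g']) (auto simp: \<Gamma>_def)
  have pathin: "\<exists>g\<in>\<Gamma>. \<forall>i\<le>m. X i \<omega> = g i" if "\<omega> \<in> space P" "X m \<omega> = a" for \<omega>
  proof (rule bexI[of _ "restrict (\<lambda>i. X i \<omega>) {..m}"])
    show "restrict (\<lambda>i. X i \<omega>) {..m} \<in> \<Gamma>"
      using that(2) process_in_graphs[OF that(1)] by (simp add: \<Gamma>_def restrict_PiE_iff)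
  qed simp
  have "{\<omega> \<in> space P. X m \<omega> = a} = (\<Union>g\<in>\<Gamma>. {\<omega> \<in> space P. \<forall>i\<le>m. X i \<omega> = g i})"
    using pathin by (auto simp: \<Gamma>_def)
  also have "measure P \<dots> = (\<Sum>g\<in>\<Gamma>. measure P {\<omega> \<in> space P. \<forall>i\<le>m. X i \<omega> = g i})"
  proof (rule P.finite_measure_finite_Union[OF fin])
    show "disjoint_family_on (\<lambda>g. {\<omega> \<in> space P. \<forall>i\<le>m. X i \<omega> = g i}) \<Gamma>"
      unfolding disjoint_family_on_def
    proof (intro ballI impI)
      fix g g' assume g: "g \<in> \<Gamma>" "g' \<in> \<Gamma>" "g \<noteq> g'"
      then obtain i where "i \<le> m" "g i \<noteq> g' i" using ext by blast
      then show "{\<omega> \<in> space P. \<forall>i\<le>m. X i \<omega> = g i} \<inter> {\<omega> \<in> space P. \<forall>i\<le>m. X i \<omega> = g' i} = {}"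
        by fastforce
    qed
  qed (use path_sets in blast)
  finally have 1: "measure P {\<omega> \<in> space P. X m \<omega> = a} = (\<Sum>g\<in>\<Gamma>. measure P {\<omega> \<in> space P. \<forall>i\<le>m. X i \<omega> = g i})" .
  have le_Suc: "(\<forall>i\<le>Suc m. X i \<omega> = (g(Suc m := b)) i) \<longleftrightarrow> (\<forall>i\<le>m. X i \<omega> = g i) \<and> X (Suc m) \<omega> = b" for \<omega> g
    by (auto simp: le_Suc_eq)
  have "{\<omega> \<in> space P. X m \<omega> = a \<and> X (Suc m) \<omega> = b} = (\<Union>g\<in>\<Gamma>. {\<omega> \<in> space P. \<forall>i\<le>Suc m. X i \<omega> = (g(Suc m := b)) i})"
    unfolding le_Suc using pathin by (auto simp: \<Gamma>_def)
  also have "measure P \<dots> = (\<Sum>g\<in>\<Gamma>. measure P {\<omega> \<in> space P. \<forall>i\<le>Suc m. X i \<omega> = (g(Suc m := b)) i})"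
  proof (rule P.finite_measure_finite_Union[OF fin])
    show "disjoint_family_on (\<lambda>g. {\<omega> \<in> space P. \<forall>i\<le>Suc m. X i \<omega> = (g(Suc m := b)) i}) \<Gamma>"
      unfolding disjoint_family_on_def le_Suc
    proof (intro ballI impI)
      fix g g' assume g: "g \<in> \<Gamma>" "g' \<in> \<Gamma>" "g \<noteq> g'"
      then obtain i where "i \<le> m" "g i \<noteq> g' i" using ext by blast
      then show "{\<omega> \<in> space P. (\<forall>i\<le>m. X i \<omega> = g i) \<and> X (Suc m) \<omega> = b} \<inter>
          {\<omega> \<in> space P. (\<forall>i\<le>m. X i \<omega> = g' i) \<and> X (Suc m) \<omega> = b} = {}"
        by fastforce
    qed
  qed (use path_sets[of "Suc m"] in blast)
  also have "\<dots> = (\<Sum>g\<in>\<Gamma>. measure P {\<omega> \<in> space P. \<forall>i\<le>m. X i \<omega> = g i} * pmf (K a) b)"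
  proof (rule sum.cong[OF refl])
    fix g assume g: "g \<in> \<Gamma>"
    have "(\<Prod>i<m. pmf (K ((g(Suc m := b)) i)) ((g(Suc m := b)) (Suc i))) = (\<Prod>i<m. pmf (K (g i)) (g (Suc i)))"
      by (rule prod.cong[OF refl]) auto
    then show "measure P {\<omega> \<in> space P. \<forall>i\<le>Suc m. X i \<omega> = (g(Suc m := b)) i} =
        measure P {\<omega> \<in> space P. \<forall>i\<le>m. X i \<omega> = g i} * pmf (K a) b"
      unfolding path_prob using g by (simp add: \<Gamma>_def)
  qed
  finally show ?thesis unfolding 1 by (simp add: sum_distrib_right)
qed

lemma process_law:
  "b \<in> graphs n \<Longrightarrow> measure P {\<omega> \<in> space P. X m \<omega> = b} = pmf (chain G m) b"
proof (induction m arbitrary: b)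
  case 0
  show ?case using path_prob[of 0 "\<lambda>_. b"] by (auto simp: pmf_return)
next
  case (Suc m)
  have "{\<omega> \<in> space P. X (Suc m) \<omega> = b} = (\<Union>a\<in>graphs n. {\<omega> \<in> space P. X m \<omega> = a \<and> X (Suc m) \<omega> = b})"
    using process_in_graphs by auto
  also have "measure P \<dots> = (\<Sum>a\<in>graphs n. measure P {\<omega> \<in> space P. X m \<omega> = a \<and> X (Suc m) \<omega> = b})"
  proof (rule P.finite_measure_finite_Union[OF finite_graphs])
    have "{\<omega> \<in> space P. X m \<omega> = a \<and> X (Suc m) \<omega> = b} \<in> sets P" for a
      using process_eq_pred by (intro sets.sets_Collect_conj) (auto simp: pred_def)
    then show "(\<lambda>a. {\<omega> \<in> space P. X m \<omega> = a \<and> X (Suc m) \<omega> = b}) ` graphs n \<subseteq> sets P" by blast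
  qed (auto simp: disjoint_family_on_def)
  also have "\<dots> = (\<Sum>a\<in>graphs n. pmf (chain G m) a * pmf (K a) b)"
    by (rule sum.cong[OF refl]) (simp add: pair_prob Suc.IH)
  also have "\<dots> = pmf (chain G (Suc m)) b"
    by (simp add: pmf_bind expectation_graphs[OF set_chain_sub[OF G]])
  finally show ?case .
qed

text \<open>Carries tail bounds from the law of the chain over to the probability space on which the
  process lives.\<close>

lemma process_law_event: "measure P {\<omega> \<in> space P. X m \<omega> \<in> A} = measure_pmf.prob (chain G m) A"
proof -
  have "{\<omega> \<in> space P. X m \<omega> \<in> A} = (\<Union>a\<in>graphs n \<inter> A. {\<omega> \<in> space P. X m \<omega> = a})"
    using process_in_graphs by auto
  also have "measure P \<dots> = (\<Sum>a\<in>graphs n \<inter> A. measure P {\<omega> \<in> space P. X m \<omega> = a})"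
    by (rule P.finite_measure_finite_Union)
       (use process_eq_pred in \<open>auto simp: disjoint_family_on_def pred_def\<close>)
  also have "\<dots> = (\<Sum>a\<in>graphs n \<inter> A. pmf (chain G m) a)"
    by (rule sum.cong[OF refl]) (simp add: process_law)
  also have "\<dots> = measure_pmf.prob (chain G m) (graphs n \<inter> A)"
    by (rule measure_measure_pmf_finite[symmetric]) simp
  also have "\<dots> = measure_pmf.prob (chain G m) A"
    using set_chain_sub[OF G, of m] by (intro measure_prob_cong_0) (auto simp: set_pmf_iff subset_iff)
  finally show ?thesis .
qed

text \<open>Impossible transitions form a null event, as there are countably many times and finitely
  many graphs. What follows about the tail can then be proved path by path.\<close>

lemma process_steps_AE: "AE \<omega> in P. X 0 \<omega> = G \<and> (\<forall>m. X (Suc m) \<omega> \<in> set_pmf (K (X m \<omega>)))"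
proof -
  have "AE \<omega> in P. X (Suc m) \<omega> \<in> set_pmf (K (X m \<omega>))" for m
  proof -
    have "AE \<omega> in P. \<forall>q\<in>graphs n \<times> graphs n. X m \<omega> = fst q \<and> X (Suc m) \<omega> = snd q \<longrightarrow> snd q \<in> set_pmf (K (fst q))"
    proof (rule AE_finite_allI)
      fix q assume q: "q \<in> graphs n \<times> graphs n"
      show "AE \<omega> in P. X m \<omega> = fst q \<and> X (Suc m) \<omega> = snd q \<longrightarrow> snd q \<in> set_pmf (K (fst q))"
      proof (cases "snd q \<in> set_pmf (K (fst q))")
        case False
        let ?A = "{\<omega> \<in> space P. X m \<omega> = fst q \<and> X (Suc m) \<omega> = snd q}"
        have "?A \<in> sets P"
          using process_eq_pred by (intro sets.sets_Collect_conj) (auto simp: pred_def)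
        moreover have "measure P ?A = 0"
          using pair_prob[of "fst q" m "snd q"] q False by (auto simp: set_pmf_iff)
        ultimately have "AE \<omega> in P. \<omega> \<notin> ?A" using P.prob_eq_0 by blast
        then show ?thesis using AE_space by eventually_elim blast
      qed simp
    qed simp
    then show ?thesis using AE_space
    proof eventually_elim
      case (elim \<omega>)
      then show ?case using process_in_graphs[OF elim(2)] by force
    qed
  qed
  moreover have "AE \<omega> in P. X 0 \<omega> = G"
  proof -
    have "measure P {\<omega> \<in> space P. X 0 \<omega> = G} = 1" using process_law[OF G, of 0] by simp
    then have "AE \<omega> in P. \<omega> \<in> {\<omega> \<in> space P. X 0 \<omega> = G}"
      using process_eq_pred[of 0 G] by (subst P.prob_eq_1[symmetric]) (auto simp: pred_def)
    then show ?thesis by eventually_elim simp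
  qed
  ultimately show ?thesis by (simp add: AE_all_countable)
qed

text \<open>\<open>measure\<close> is 0 on sets that are not measurable, so the event of the theorem
  has to be measurable before a lower bound can be transferred to it.\<close>

lemma final_graph_measurable: "(\<lambda>\<omega>. final_graph (\<lambda>t. X t \<omega>)) \<in> P \<rightarrow>\<^sub>M count_space UNIV"
proof -
  have eq: "Measurable.pred P (\<lambda>\<omega>. X i \<omega> = X j \<omega>)" for i j
  proof -
    have "{\<omega> \<in> space P. X i \<omega> = X j \<omega>} = (\<Union>a\<in>graphs n. {\<omega> \<in> space P. X i \<omega> = a \<and> X j \<omega> = a})"
      using process_in_graphs by auto
    moreover have "{\<omega> \<in> space P. X i \<omega> = a \<and> X j \<omega> = a} \<in> sets P" for a
      using process_eq_pred by (intro sets.sets_Collect_conj) (auto simp: pred_def)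
    ultimately show ?thesis by (auto simp: pred_def)
  qed
  have st: "(\<lambda>\<omega>. stabilization_time (\<lambda>t. X t \<omega>)) \<in> P \<rightarrow>\<^sub>M count_space UNIV"
    unfolding stabilization_time_def
  proof (rule measurable_Least)
    fix l
    have "Measurable.pred P (\<lambda>\<omega>. l \<le> m \<longrightarrow> X m \<omega> = X l \<omega>)" for m
      by (cases "l \<le> m") (simp_all add: eq)
    then show "Measurable.pred P (\<lambda>\<omega>. \<forall>m\<ge>l. X m \<omega> = X l \<omega>)"
      by (rule pred_intros_countable)
  qed
  show ?thesis unfolding final_graph_def
    by (rule measurable_compose_countable[OF process_measurable st])
qed

end

text \<open>Discrete counterpart of \<open>sum_rate_hitting\<close>: a step that changes the graph
  removes at most \<open>mF\<close> ordered pairs, and at least one of them lies in Z.\<close>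

lemma loss_hitting:
  assumes v: "v \<in> tuples k n"
    and hit: "\<And>\<phi>. edge_pairs F \<noteq> {} \<Longrightarrow> \<phi> \<in> maps \<Longrightarrow> \<exists>e\<in>edge_pairs F. (\<phi> (fst e), \<phi> (snd e)) \<in> Z"
  shows "loss (V \<times> V) h v \<le> mF * loss Z h v"
proof (cases "edge_pairs F = {} \<or> \<not> (`) v ` F \<subseteq> h")
  case True
  have "arcs F = {}" if "edge_pairs F = {}"
  proof -
    have "F = {}" using that F_edge_pairs by blast
    then show ?thesis by (simp add: arcs_def)
  qed
  then show ?thesis using True by (auto simp: loss_def hom_weight_adj case_prod_beta)
next
  case False
  have vm: "v \<in> maps" using v tuples_maps by blast
  obtain e where e: "e \<in> edge_pairs F" "(v (fst e), v (snd e)) \<in> Z" using hit[OF _ vm] False by blast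
  have "of_bool ((v (fst e), v (snd e)) \<in> Z) * hom_weight F (adj h) v \<le> loss Z h v"
    unfolding loss_def case_prod_beta
    by (rule member_le_sum[where f = "\<lambda>p. of_bool ((v (fst p), v (snd p)) \<in> Z) * hom_weight F (adj h) v"])
       (use e edge_pairs_arcs in \<open>auto simp: hom_weight_adj\<close>)
  then have "1 \<le> loss Z h v" using e False by (simp add: hom_weight_adj)
  then have "mF * 1 \<le> mF * loss Z h v" by (intro mult_left_mono) auto
  then show ?thesis using loss_bounds(2)[OF vm, of "V \<times> V" h] by linarith
qed

context
  fixes g :: "nat \<Rightarrow> graph"
  assumes g0: "g 0 \<in> graphs n" and gs: "\<And>m. g (Suc m) \<in> set_pmf (K (g m))"
begin

lemma path_step: "g m \<in> graphs n \<and> (\<exists>v\<in>tuples k n. g (Suc m) = strip (g m) v)"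
proof (induction m)
  case 0
  show ?case using g0 gs[of 0] set_K[OF g0] by auto
next
  case (Suc m)
  then have "g (Suc m) \<in> graphs n" using strip_graphs by auto
  then show ?case using gs[of "Suc m"] set_K by auto
qed

lemma path_decreasing: "i \<le> j \<Longrightarrow> g j \<subseteq> g i"
  by (induction rule: dec_induct) (use path_step strip_sub in fastforce)+

lemma path_tail:
  assumes "i \<le> j" and Z: "Z \<subseteq> V \<times> V"
    and hit: "\<And>\<phi>. edge_pairs F \<noteq> {} \<Longrightarrow> \<phi> \<in> maps \<Longrightarrow> \<exists>e\<in>edge_pairs F. (\<phi> (fst e), \<phi> (snd e)) \<in> Z"
  shows "(\<Sum>(x, y)\<in>V \<times> V. adj (g i) x y - adj (g j) x y) \<le> mF * (\<Sum>(x, y)\<in>Z. adj (g i) x y - adj (g j) x y)"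
  using assms(1)
proof (induction j rule: dec_induct)
  case base
  then show ?case by simp
next
  case (step j)
  obtain v where v: "v \<in> tuples k n" "g (Suc j) = strip (g j) v" using path_step[of j] by blast
  have inc: "(\<Sum>(x, y)\<in>W. adj (g i) x y - adj (g (Suc j)) x y) =
      (\<Sum>(x, y)\<in>W. adj (g i) x y - adj (g j) x y) + loss W (g j) v" if "W \<subseteq> V \<times> V" for W
  proof -
    have "(\<Sum>(x, y)\<in>W. adj (g i) x y - adj (g (Suc j)) x y) =
      (\<Sum>(x, y)\<in>W. adj (g i) x y - adj (g j) x y) - (\<Sum>(x, y)\<in>W. adj (g (Suc j)) x y - adj (g j) x y)"
      by (simp add: case_prod_beta sum_subtractf)
    then show ?thesis using strip_sum[OF v(1) that, of "g j"] v(2) by simp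
  qed
  show ?case
    unfolding inc[OF order.refl] inc[OF Z] distrib_left
    by (intro add_mono step.IH loss_hitting[OF v(1) hit])
qed

text \<open>The graphs of a path decrease, so the path is constant from a graph with fewest edges
  on. The index is taken beyond i so that the final graph can be compared with
  \<open>g i\<close>.\<close>

lemma final_graph_reached: "\<exists>j\<ge>i. final_graph g = g j"
proof -
  have "\<exists>l. \<forall>m\<ge>l. g m = g l"
  proof -
    define l where "l = (ARG_MIN (\<lambda>m. card (g m)) m. True)"
    have "card (g l) \<le> card (g m)" for m
      unfolding l_def by (rule arg_min_nat_le) simp
    moreover have "finite (g m)" for m
      using path_step[of m] by (auto simp: graphs_def intro: finite_subset)
    ultimately have "g m = g l" if "l \<le> m" for m
      using path_decreasing[OF that] card_seteq by blast
    then show ?thesis by blast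
  qed
  then have "\<forall>m\<ge>stabilization_time g. g m = g (stabilization_time g)"
    unfolding stabilization_time_def by (rule LeastI_ex)
  then have "g (max i (stabilization_time g)) = g (stabilization_time g)"
    by (rule allE[of _ "max i (stabilization_time g)"]) (erule mp, rule max.cobounded2)
  then have "final_graph g = g (max i (stabilization_time g))" by (simp only: final_graph_def)
  then show ?thesis using max.cobounded1 by blast
qed

end

end

section \<open>Comparing the destination with the final graph\<close>

locale flip_graphon = vertex_space M k n F \<Omega> + removal_chain k n F
  for M :: "'a measure" and k n F \<Omega>
begin

text \<open>The destination, the flow at time T, the process at step m and the final graph are
  compared in turn. R is the conclusion of the removal lemma, used for the second and the third of
  them; each use gives a tail of at most \<open>mF * \<delta>\<close>. The middle comparison costs
  \<eta> outside an event of probability at most \<epsilon>.\<close>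

lemma prob_destination_near_final_graph:
  fixes P :: "'w measure"
  assumes FP: "flip_process P k (removal_rule F) n G X" and G: "G \<in> graphs n"
    and R: "\<And>w. unit_on V w \<Longrightarrow> (edge_pairs F \<noteq> {} \<Longrightarrow> hom_density w \<le> \<gamma>) \<Longrightarrow>
      \<exists>Z\<subseteq>V \<times> V. (\<Sum>(x, y)\<in>Z. w x y) \<le> \<delta> * (real n)\<^sup>2 \<and>
        (edge_pairs F \<noteq> {} \<longrightarrow> (\<forall>\<phi>\<in>maps. \<exists>e\<in>edge_pairs F. (\<phi> (fst e), \<phi> (snd e)) \<in> Z))"
    and T: "0 < \<gamma>" "2 / \<gamma> \<le> T" and \<eta>: "eF * \<eta> \<le> \<gamma> / 2" and \<epsilon>: "2 * mF * \<delta> + \<eta> < \<epsilon>"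
    and bad: "\<And>w. is_flow w \<Longrightarrow> (\<And>x y. x \<in> V \<Longrightarrow> y \<in> V \<Longrightarrow> w 0 x y = adj G x y) \<Longrightarrow>
      measure_pmf.prob (chain G m) {h. \<not> cut_bound V V (\<lambda>x y. adj h x y - w T x y) (\<eta> * (real n)\<^sup>2)} \<le> \<epsilon>"
  shows "1 - \<epsilon> \<le> measure P {\<omega> \<in> space P. cut_dist M (dest M k (removal_rule F) (graph_kernel \<Omega> G))
    (graph_kernel \<Omega> (final_graph (\<lambda>t. X t \<omega>))) < \<epsilon>}"
proof -
  interpret P: prob_space P using FP by (simp add: flip_process_def)
  obtain w where w: "is_flow w" and w0: "\<And>x y. x \<in> V \<Longrightarrow> y \<in> V \<Longrightarrow> w 0 x y = adj G x y"
    using flow_exists[OF unit_on_adj adj_sym, of G] by auto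
  obtain l where l: "unit_on V l" "\<And>u v. u \<in> V \<Longrightarrow> v \<in> V \<Longrightarrow> l u v = l v u"
    "\<And>u v. u \<in> V \<Longrightarrow> v \<in> V \<Longrightarrow> ((\<lambda>t. w t u v) \<longlongrightarrow> l u v) at_top"
    using flow_limit[OF w] by blast
  have T0: "0 < T" using T by (meson divide_pos_pos less_le_trans zero_less_numeral)
  have W: "graph_kernel \<Omega> G x y = step (w 0) x y" if "x \<in> space M" "y \<in> space M" for x y
    using graph_kernel_step[OF G that] w0[OF col_in col_in] that by (simp add: step_def)
  have dest: "is_destination M k (removal_rule F) (graph_kernel \<Omega> G) (dest M k (removal_rule F) (graph_kernel \<Omega> G))"
  proof -
    have "is_destination M k (removal_rule F) (graph_kernel \<Omega> G) (step l)"
      by (rule destination_exists[OF w W l])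
    then show ?thesis unfolding dest_def
      by (rule someI[of "is_destination M k (removal_rule F) (graph_kernel \<Omega> G)"])
  qed
  \<comment> \<open>Decay gives density at most \<open>1 / T\<close>, half of the threshold
    \<gamma>; the other half is reserved for the cut-norm error at step m.\<close>
  have hd_T: "edge_pairs F \<noteq> {} \<Longrightarrow> hom_density (w T) \<le> \<gamma> / 2"
  proof -
    assume "edge_pairs F \<noteq> {}"
    then have "arcs F \<noteq> {}" using edge_pairs_arcs by blast
    then have mF1: "1 \<le> mF" by (simp add: Suc_le_eq card_gt_0_iff)
    have hd0: "0 \<le> hom_density (w T)" by (rule hom_density_unit[OF flow_unit[OF w]]) (use T0 in simp)
    have "T * hom_density (w T) \<le> T * (mF * hom_density (w T))"
      using mF1 hd0 T0 mult_right_mono[OF mF1 hd0] by (intro mult_left_mono) auto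
    also have "\<dots> \<le> 1" by (rule flow_density_decay[OF w]) (use T0 in simp)
    finally have *: "T * hom_density (w T) \<le> 1" .
    have "2 / \<gamma> * hom_density (w T) \<le> T * hom_density (w T)" by (rule mult_right_mono[OF T(2) hd0])
    with * have "2 / \<gamma> * hom_density (w T) \<le> 1" by linarith
    then show "hom_density (w T) \<le> \<gamma> / 2" using T(1) by (simp add: field_simps)
  qed
  have wT: "unit_on V (w T)" by (rule flow_unit[OF w]) (use T0 in simp)
  obtain Z where Z: "Z \<subseteq> V \<times> V" "(\<Sum>(x, y)\<in>Z. w T x y) \<le> \<delta> * (real n)\<^sup>2"
    "edge_pairs F \<noteq> {} \<longrightarrow> (\<forall>\<phi>\<in>maps. \<exists>e\<in>edge_pairs F. (\<phi> (fst e), \<phi> (snd e)) \<in> Z)"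
    using R[OF wT] hd_T T(1) by fastforce
  have tail_w: "(\<Sum>(x, y)\<in>V \<times> V. w T x y - l x y) \<le> mF * (\<delta> * (real n)\<^sup>2)"
  proof (rule tendsto_upperbound)
    show "((\<lambda>t. \<Sum>(x, y)\<in>V \<times> V. w T x y - w t x y) \<longlongrightarrow> (\<Sum>(x, y)\<in>V \<times> V. w T x y - l x y)) at_top"
      unfolding case_prod_beta by (intro tendsto_sum tendsto_diff tendsto_const l) auto
    show "\<forall>\<^sub>F t in at_top. (\<Sum>(x, y)\<in>V \<times> V. w T x y - w t x y) \<le> mF * (\<delta> * (real n)\<^sup>2)"
      using eventually_ge_at_top[of T]
    proof eventually_elim
      case (elim t)
      have "(\<Sum>(x, y)\<in>V \<times> V. w T x y - w t x y) \<le> mF * (\<Sum>(x, y)\<in>Z. w T x y)"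
        by (rule flow_tail[OF w _ elim Z(1)]) (use T0 Z(3) in auto)
      also have "\<dots> \<le> mF * (\<delta> * (real n)\<^sup>2)" using Z(2) by (intro mult_left_mono) auto
      finally show ?case .
    qed
  qed simp
  have l_le: "l x y \<le> w T x y" if "x \<in> V" "y \<in> V" for x y
  proof (rule tendsto_upperbound[OF l(3)[OF that]])
    show "\<forall>\<^sub>F t in at_top. w t x y \<le> w T x y"
      using eventually_ge_at_top[of T] by eventually_elim (use flow_antimono[OF w _ _ that] T0 in auto)
  qed simp
  have c1: "cut_bound V V (\<lambda>x y. l x y - w T x y) (mF * (\<delta> * (real n)\<^sup>2))"
  proof (rule cut_bound_sum_abs)
    have "(\<Sum>x\<in>V. \<Sum>y\<in>V. \<bar>l x y - w T x y\<bar>) = (\<Sum>x\<in>V. \<Sum>y\<in>V. w T x y - l x y)"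
      by (intro sum.cong refl) (use l_le in auto)
    then show "(\<Sum>x\<in>V. \<Sum>y\<in>V. \<bar>l x y - w T x y\<bar>) \<le> mF * (\<delta> * (real n)\<^sup>2)"
      using tail_w by (simp add: sum.cartesian_product)
  qed simp_all
  let ?Good = "{h. cut_bound V V (\<lambda>x y. adj h x y - w T x y) (\<eta> * (real n)\<^sup>2)}"
  let ?C = "\<lambda>h. cut_dist M (dest M k (removal_rule F) (graph_kernel \<Omega> G)) (graph_kernel \<Omega> h)"
  \<comment> \<open>A deterministic statement about every path with admissible steps; probability
    enters only through closeness to the flow at step m.\<close>
  have main: "?C (final_graph g) < \<epsilon>"
    if g: "g 0 = G" "\<And>i. g (Suc i) \<in> set_pmf (K (g i))" and good: "g m \<in> ?Good" for g
  proof -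
    have g0: "g 0 \<in> graphs n" using g(1) G by simp
    note path = path_step[of g, OF g0 g(2)]
    have c2: "cut_bound V V (\<lambda>x y. adj (g m) x y - w T x y) (\<eta> * (real n)\<^sup>2)" using good by simp
    have "hom_density (adj (g m)) \<le> \<gamma>" if "edge_pairs F \<noteq> {}"
      using hom_density_cut_lipschitz[OF unit_on_adj wT c2] hd_T[OF that] \<eta> by linarith
    then obtain Z' where Z': "Z' \<subseteq> V \<times> V" "(\<Sum>(x, y)\<in>Z'. adj (g m) x y) \<le> \<delta> * (real n)\<^sup>2"
      "edge_pairs F \<noteq> {} \<longrightarrow> (\<forall>\<phi>\<in>maps. \<exists>e\<in>edge_pairs F. (\<phi> (fst e), \<phi> (snd e)) \<in> Z')"
      using R[OF unit_on_adj[of V "g m"]] by blast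
    obtain j where j: "m \<le> j" "final_graph g = g j" using final_graph_reached[of g m, OF g0 g(2)] by blast
    have "(\<Sum>(x, y)\<in>V \<times> V. adj (g m) x y - adj (g j) x y) \<le> mF * (\<Sum>(x, y)\<in>Z'. adj (g m) x y - adj (g j) x y)"
      by (rule path_tail[of g, OF g0 g(2) j(1) Z'(1)]) (use Z'(3) in auto)
    also have "\<dots> \<le> mF * (\<delta> * (real n)\<^sup>2)"
    proof (rule mult_left_mono)
      have "(\<Sum>(x, y)\<in>Z'. adj (g m) x y - adj (g j) x y) \<le> (\<Sum>(x, y)\<in>Z'. adj (g m) x y)"
        by (intro sum_mono) (auto simp: adj_def)
      then show "(\<Sum>(x, y)\<in>Z'. adj (g m) x y - adj (g j) x y) \<le> \<delta> * (real n)\<^sup>2" using Z'(2) by linarith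
    qed simp
    finally have "cut_bound V V (\<lambda>x y. adj (g j) x y - adj (g m) x y) (mF * (\<delta> * (real n)\<^sup>2))"
      by (rule cut_bound_subgraph[OF path_decreasing[of g, OF g0 g(2) j(1)]])
    then have c3: "cut_bound V V (\<lambda>x y. - (adj (g j) x y - adj (g m) x y)) (mF * (\<delta> * (real n)\<^sup>2))"
      by (simp only: cut_bound_uminus)
    have c2': "cut_bound V V (\<lambda>x y. - (adj (g m) x y - w T x y)) (\<eta> * (real n)\<^sup>2)"
      using c2 by (simp only: cut_bound_uminus)
    have fin: "final_graph g \<in> graphs n" using path[of j] j(2) by simp
    have "cut_bound V V (\<lambda>x y. l x y - adj (final_graph g) x y) ((2 * mF * \<delta> + \<eta>) * (real n)\<^sup>2)"
      using cut_bound_add[OF cut_bound_add[OF c1 c2'] c3] j(2) by (simp add: algebra_simps)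
    then have "?C (final_graph g) \<le> 2 * mF * \<delta> + \<eta>"
    proof (rule cut_dist_destination[OF dest w W l(2,3) adj_sym _ graph_kernel_step[OF fin], rotated -1])
      have "kernel M (step (adj (final_graph g)))" by (rule kernel_step[OF adj_sym])
      moreover have "(\<lambda>p. graph_kernel \<Omega> (final_graph g) (fst p) (snd p)) \<in> borel_measurable (M \<Otimes>\<^sub>M M)"
        using measurable_step[of "adj (final_graph g)"] graph_kernel_step[OF fin]
        by (subst measurable_cong[of _ _ "\<lambda>p. step (adj (final_graph g)) (fst p) (snd p)"]) (auto simp: space_pair_measure)
      ultimately show "kernel M (graph_kernel \<Omega> (final_graph g))"
        using graph_kernel_step[OF fin] by (simp add: kernel_def case_prod_unfold)
    qed auto
    then show ?thesis using \<epsilon> by linarith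
  qed
  have "1 - \<epsilon> \<le> 1 - measure_pmf.prob (chain G m) (- ?Good)"
    using bad[OF w w0] by (simp add: Compl_eq)
  also have "\<dots> = measure_pmf.prob (chain G m) ?Good"
    using measure_pmf.prob_compl[of ?Good "chain G m"] by (simp add: Compl_eq_Diff_UNIV)
  also have "\<dots> = measure P {\<omega> \<in> space P. X m \<omega> \<in> ?Good}"
    by (rule process_law_event[OF FP G, symmetric])
  also have "\<dots> \<le> measure P {\<omega> \<in> space P. ?C (final_graph (\<lambda>t. X t \<omega>)) < \<epsilon>}"
  proof (rule P.finite_measure_mono_AE)
    show "AE \<omega> in P. \<omega> \<in> {\<omega> \<in> space P. X m \<omega> \<in> ?Good} \<longrightarrow> \<omega> \<in> {\<omega> \<in> space P. ?C (final_graph (\<lambda>t. X t \<omega>)) < \<epsilon>}"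
      using process_steps_AE[OF FP G]
    proof eventually_elim
      case (elim \<omega>)
      then show ?case using main[of "\<lambda>t. X t \<omega>"] by auto
    qed
    show "{\<omega> \<in> space P. ?C (final_graph (\<lambda>t. X t \<omega>)) < \<epsilon>} \<in> sets P"
      using measurable_sets[OF final_graph_measurable[OF FP G], of "{h. ?C h < \<epsilon>}"]
      by (simp add: vimage_def Int_def conj_commute)
  qed
  finally show ?thesis .
qed

end

text \<open>\<open>4 \<le> exp 2\<close>, and the threshold on n makes the quadratic exponent at
  least 3 n, which leaves exp (-n).\<close>

lemma exp_bound_four:
  fixes c :: real
  assumes c: "3 / c \<le> real n" "0 < c" and n: "0 < n"
  shows "4 ^ n * exp (- (c * (real n)\<^sup>2)) \<le> 1 / real n"
proof -
  have "(4 :: real) \<le> exp 2"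
    using power_mono[OF exp_ge_add_one_self[of "1 :: real"], of 2] by (simp flip: exp_of_nat_mult)
  then have "(4 :: real) ^ n \<le> exp (2 * real n)"
    using power_mono[of 4 "exp (2 :: real)" n] by (simp add: exp_of_nat_mult[symmetric] mult.commute)
  then have "4 ^ n * exp (- (c * (real n)\<^sup>2)) \<le> exp (2 * real n) * exp (- (c * (real n)\<^sup>2))"
    by (intro mult_right_mono) auto
  also have "\<dots> = exp (2 * real n - c * (real n)\<^sup>2)" by (simp add: exp_add[symmetric])
  also have "\<dots> \<le> exp (- real n)"
  proof -
    have "3 \<le> c * real n" using c by (simp add: field_simps)
    then have "3 * real n \<le> c * real n * real n" by (intro mult_right_mono) auto
    then show ?thesis by (simp add: power2_eq_square)
  qed
  also have "\<dots> = 1 / exp (real n)" by (simp add: exp_minus field_simps)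
  also have "\<dots> \<le> 1 / real n"
  proof -
    have "real n \<le> exp (real n)" using exp_ge_add_one_self[of "real n"] by linarith
    then show ?thesis using n by (intro divide_left_mono) simp_all
  qed
  finally show ?thesis .
qed

section \<open>Block length, exponent and accumulated error\<close>

context removal_chain
begin

text \<open>With a = \<open>mF * eF * mF\<close>, the allowed error per unit of time is d (2 + a).
  The drift error takes at most d (1 + a) of it, and the variance term at most d / 2 by the choice
  of l. The remaining d / 2 gives an exponent of order n^2.\<close>

lemma block_deviation_small:
  assumes g: "g \<in> graphs n" and d: "0 < d" "d \<le> 1" and kd: "mF * ((real k)\<^sup>2 / real n) \<le> d"
    and \<delta>: "\<delta> = real B / (real n)\<^sup>2" "d / 2 \<le> \<delta>" "\<delta> \<le> d"
    and l: "l = d / (2 * (mF + 1)\<^sup>2)"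
  shows "measure_pmf.prob (chain g B) {h. \<not> cut_bound V V (\<lambda>x y. adj h x y - adj g x y + \<delta> * rate (adj g) x y)
      (\<delta> * d * (2 + mF * eF * mF) * (real n)\<^sup>2)} \<le> 4 ^ n * (2 * exp (- (l * d\<^sup>2 / 4 * (real n)\<^sup>2)))"
proof -
  let ?a = "mF * eF * mF"
  have l0: "0 < l" using d by (simp add: l zero_less_mult_iff add_nonneg_pos)
  have m1: "mF \<le> (mF + 1)\<^sup>2" "mF\<^sup>2 \<le> (mF + 1)\<^sup>2" "1 \<le> (mF + 1)\<^sup>2" by (simp_all add: power2_eq_square algebra_simps)
  have l1: "l * mF \<le> 1"
  proof -
    have "d * mF \<le> 1 * (2 * (mF + 1)\<^sup>2)" using d m1 by (intro mult_mono) auto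
    then show ?thesis using m1 by (simp add: l pos_divide_le_eq)
  qed
  have l2: "l * mF\<^sup>2 \<le> d / 2"
  proof -
    have "d * mF\<^sup>2 \<le> d * (mF + 1)\<^sup>2" using d m1 by (intro mult_left_mono) auto
    then show ?thesis using m1 by (simp add: l field_simps)
  qed
  have n2: "0 < (real n)\<^sup>2" using n by simp
  have B: "real B = \<delta> * (real n)\<^sup>2" using n by (simp add: \<delta>(1))
  have drift: "drift_error B \<le> d * (1 + ?a)"
  proof -
    have "drift_error B = mF * ((real k)\<^sup>2 / real n) + ?a * \<delta>"
      using n by (simp add: drift_error_def B mult_ac)
    also have "\<dots> \<le> d + ?a * d" using kd \<delta>(3) by (intro add_mono mult_left_mono) auto
    finally show ?thesis by (simp add: algebra_simps)
  qed
  have "real B * (l * drift_error B + l\<^sup>2 * mF\<^sup>2) - l * (\<delta> * d * (2 + ?a) * (real n)\<^sup>2) =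
      (\<delta> * (real n)\<^sup>2 * l) * (drift_error B + l * mF\<^sup>2 - d * (2 + ?a))"
    unfolding B by (simp add: power2_eq_square algebra_simps)
  also have "\<dots> \<le> (\<delta> * (real n)\<^sup>2 * l) * (- (d / 2))"
    using drift l2 l0 \<delta>(2) d by (intro mult_left_mono) (auto simp: algebra_simps)
  also have "\<dots> \<le> (d / 2 * (real n)\<^sup>2 * l) * (- (d / 2))"
    using \<delta>(2) d l0 by (intro mult_right_mono_neg mult_right_mono) auto
  also have "\<dots> = - (l * d\<^sup>2 / 4 * (real n)\<^sup>2)" by (simp add: power2_eq_square)
  finally have e: "exp (real B * (l * drift_error B + l\<^sup>2 * mF\<^sup>2) - l * (\<delta> * d * (2 + ?a) * (real n)\<^sup>2)) \<le>
      exp (- (l * d\<^sup>2 / 4 * (real n)\<^sup>2))" by simp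
  show ?thesis
    unfolding \<delta>(1)
    by (rule order.trans[OF block_deviation[OF g l0 l1]]) (use e in \<open>simp add: \<delta>(1)\<close>)
qed

text \<open>The j blocks cover a bounded time, so local errors of order \<open>\<delta> * d\<close>
  add up to order d, and the amplification stays below an exponential that involves neither d nor
  n.\<close>

lemma block_error_small:
  assumes d: "0 < d" and \<delta>: "0 \<le> \<delta>" "\<delta> \<le> d" and \<tau>: "real j * \<delta> \<le> \<tau>"
  shows "block_error (\<delta> * d * (2 + mF * eF * mF)) \<delta> j \<le> \<tau> * (d * (2 + 2 * (mF * eF * mF))) * exp (mF * eF * \<tau>)"
proof -
  let ?a = "mF * eF * mF"
  have "block_error (\<delta> * d * (2 + ?a)) \<delta> j = (real j * \<delta>) * (d * (2 + ?a) + ?a * \<delta>) * (1 + mF * eF * \<delta>) ^ j"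
    by (simp add: block_error_def power2_eq_square algebra_simps)
  also have "\<dots> \<le> \<tau> * (d * (2 + 2 * ?a)) * exp (mF * eF * \<tau>)"
  proof (intro mult_mono \<tau>)
    have "?a * \<delta> \<le> ?a * d" using \<delta> by (intro mult_left_mono) auto
    then show "d * (2 + ?a) + ?a * \<delta> \<le> d * (2 + 2 * ?a)" by (simp add: algebra_simps)
    have "(1 + mF * eF * \<delta>) ^ j \<le> exp (mF * eF * \<delta>) ^ j"
      using \<delta> by (intro power_mono exp_ge_add_one_self) auto
    also have "\<dots> = exp (mF * eF * (real j * \<delta>))" by (simp add: exp_of_nat_mult[symmetric] mult_ac)
    also have "\<dots> \<le> exp (mF * eF * \<tau>)" using \<tau> by (simp add: mult_left_mono)
    finally show "(1 + mF * eF * \<delta>) ^ j \<le> exp (mF * eF * \<tau>)" .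
    have "0 \<le> real j * \<delta>" using \<delta> by simp
    then show "0 \<le> \<tau>" using \<tau> by linarith
    then show "0 \<le> \<tau> * (d * (2 + 2 * ?a))" using d by simp
  qed (use d \<delta> in auto)
  finally show ?thesis .
qed

end

theorem theorem10p14:
  fixes M :: "'a measure" and k :: nat and F :: graph
  assumes "prob_space M" and "atomless M" and "separable_sigma_algebra M"
    and "F \<in> graphs k"
  shows "\<forall>\<epsilon>::real. \<epsilon> > 0 \<longrightarrow> (\<exists>n\<^sub>0::nat. \<forall>n\<ge>n\<^sub>0.
    \<forall>G\<in>graphs n. \<forall>\<Omega> :: nat \<Rightarrow> 'a set. vertex_partition M n \<Omega> \<longrightarrow>
    (\<forall>(P :: 'w measure) X. flip_process P k (removal_rule F) n G X \<longrightarrow>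
       measure P {\<omega> \<in> space P.
         cut_dist M (dest M k (removal_rule F) (graph_kernel \<Omega> G))
           (graph_kernel \<Omega> (final_graph (\<lambda>t. X t \<omega>))) < \<epsilon>}
       \<ge> 1 - \<epsilon>))"
proof (intro allI impI)
  fix \<epsilon> :: real assume \<epsilon>: "\<epsilon> > 0"
  define m where "m = real (card (arcs F))"
  define e where "e = real (card (edge_pairs F))"
  define a where "a = m * e * m"
  have me: "0 \<le> m" "0 \<le> e" "0 \<le> a" by (simp_all add: m_def e_def a_def)
  \<comment> \<open>Makes the two tails together at most \<epsilon> / 4.\<close>
  define \<delta>1 where "\<delta>1 = \<epsilon> / (8 * (m + 1))"
  have \<delta>1: "0 < \<delta>1" using \<epsilon> me by (simp add: \<delta>1_def)
  \<comment> \<open>Only facts about the edges of F are taken from this interpretation; they do not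
    involve the number of vertices, and 1 is an arbitrary value.\<close>
  interpret F1: removal_flow k 1 F using assms(4) by unfold_locales simp_all
  obtain \<gamma> where "0 < \<gamma> \<and> (\<forall>(V :: nat set) w. finite V \<longrightarrow> V \<noteq> {} \<longrightarrow>
     (\<forall>x\<in>V. \<forall>y\<in>V. 0 \<le> w x y \<and> w x y \<le> 1) \<longrightarrow>
     (\<Sum>\<phi>\<in>{1..k} \<rightarrow>\<^sub>E V. \<Prod>e\<in>edge_pairs F. w (\<phi> (fst e)) (\<phi> (snd e))) \<le> \<gamma> * real (card V) ^ card {1..k} \<longrightarrow>
     (\<exists>Z\<subseteq>V \<times> V. (\<Sum>(x, y)\<in>Z. w x y) \<le> \<delta>1 * (real (card V))\<^sup>2 \<and>
        (\<forall>\<phi>\<in>{1..k} \<rightarrow>\<^sub>E V. \<exists>e\<in>edge_pairs F. (\<phi> (fst e), \<phi> (snd e)) \<in> Z)))"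
    by (rule exE[OF removal_lemma[OF finite_atLeastAtMost F1.edge_pairs_sub F1.edge_pairs_asym \<delta>1, where 'v = nat]])
  then have \<gamma>: "0 < \<gamma>" and removal: "\<forall>(V :: nat set) w. finite V \<longrightarrow> V \<noteq> {} \<longrightarrow>
     (\<forall>x\<in>V. \<forall>y\<in>V. 0 \<le> w x y \<and> w x y \<le> 1) \<longrightarrow>
     (\<Sum>\<phi>\<in>{1..k} \<rightarrow>\<^sub>E V. \<Prod>e\<in>edge_pairs F. w (\<phi> (fst e)) (\<phi> (snd e))) \<le> \<gamma> * real (card V) ^ card {1..k} \<longrightarrow>
     (\<exists>Z\<subseteq>V \<times> V. (\<Sum>(x, y)\<in>Z. w x y) \<le> \<delta>1 * (real (card V))\<^sup>2 \<and>
        (\<forall>\<phi>\<in>{1..k} \<rightarrow>\<^sub>E V. \<exists>e\<in>edge_pairs F. (\<phi> (fst e), \<phi> (snd e)) \<in> Z))"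
    by (rule conjunct1, rule conjunct2)
  \<comment> \<open>The second entry keeps the density error \<open>e * \<eta>\<close> within
    \<gamma> / 2.\<close>
  define \<eta> where "\<eta> = min (\<epsilon> / 4) (\<gamma> / (2 * (e + 1)))"
  have \<eta>: "0 < \<eta>" using \<epsilon> \<gamma> me by (simp add: \<eta>_def)
  have e\<eta>: "e * \<eta> \<le> \<gamma> / 2"
  proof -
    have "e * \<eta> \<le> (e + 1) * (\<gamma> / (2 * (e + 1)))" using me \<eta> by (intro mult_mono) (auto simp: \<eta>_def)
    also have "\<dots> = \<gamma> / 2" using me by (simp add: field_simps)
    finally show ?thesis .
  qed
  have total: "2 * m * \<delta>1 + \<eta> < \<epsilon>"
  proof -
    have "2 * m * \<delta>1 = \<epsilon> / 4 * (m / (m + 1))" using me by (simp add: \<delta>1_def field_simps)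
    also have "\<dots> \<le> \<epsilon> / 4 * 1" using me \<epsilon> by (intro mult_left_mono) auto
    finally show ?thesis using \<epsilon> by (simp add: \<eta>_def)
  qed
  define T where "T = 2 / \<gamma>"
  \<comment> \<open>Bounds the total time \<open>real J * \<delta>\<close> of all blocks, uniformly
    in n.\<close>
  define \<tau> where "\<tau> = 2 * T + 1"
  \<comment> \<open>The time step is small enough for the error accumulated up to time \<tau> to
    stay within \<eta>.\<close>
  define d where "d = min 1 (\<eta> / (\<tau> * (2 + 2 * a) * exp (m * e * \<tau>)))"
  \<comment> \<open>Rounding may shorten a block to d / 2, so J is doubled to make sure that time T
    is reached.\<close>
  define J where "J = nat \<lceil>2 * T / d\<rceil>"
  define l where "l = d / (2 * (m + 1)\<^sup>2)"
  define c where "c = l * d\<^sup>2 / 4"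
  have T: "0 < T" using \<gamma> by (simp add: T_def)
  have \<tau>: "0 < \<tau>" using T by (simp add: \<tau>_def)
  have d: "0 < d" "d \<le> 1" using \<eta> \<tau> me by (auto simp: d_def)
  have d\<eta>: "\<tau> * (d * (2 + 2 * a)) * exp (m * e * \<tau>) \<le> \<eta>"
  proof -
    have pos: "0 < \<tau> * (2 + 2 * a) * exp (m * e * \<tau>)" using \<tau> me by simp
    have "d \<le> \<eta> / (\<tau> * (2 + 2 * a) * exp (m * e * \<tau>))" by (simp add: d_def)
    then show ?thesis using pos by (simp add: pos_le_divide_eq mult_ac)
  qed
  have J: "2 * T / d \<le> real J" "real J < 2 * T / d + 1"
  proof -
    have "0 \<le> 2 * T / d" using T d by simp
    then have J': "real J = of_int \<lceil>2 * T / d\<rceil>" by (simp add: J_def)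
    show "2 * T / d \<le> real J" "real J < 2 * T / d + 1"
      unfolding J' using ceiling_correct[of "2 * T / d"] by simp_all
  qed
  have c: "0 < c" using d me by (simp add: c_def l_def zero_less_mult_iff add_nonneg_pos)
  \<comment> \<open>Lower bounds on n for, in turn, the rounding of the block length, the bias of
    non-injective maps, the union bound over rectangles, and the sum of the failure probabilities 2
    / n of the J blocks.\<close>
  obtain q1 q2 q3 q4 :: nat where q: "2 / d \<le> real q1" "m * (real k)\<^sup>2 / d \<le> real q2"
    "3 / c \<le> real q3" "2 * real J / \<epsilon> \<le> real q4"
    using real_arch_simple[of "2 / d"] real_arch_simple[of "m * (real k)\<^sup>2 / d"]
      real_arch_simple[of "3 / c"] real_arch_simple[of "2 * real J / \<epsilon>"] by (elim exE)
  define n\<^sub>0 where "n\<^sub>0 = Suc k + q1 + q2 + q3 + q4"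
  show "\<exists>n\<^sub>0::nat. \<forall>n\<ge>n\<^sub>0. \<forall>G\<in>graphs n. \<forall>\<Omega> :: nat \<Rightarrow> 'a set. vertex_partition M n \<Omega> \<longrightarrow>
    (\<forall>(P :: 'w measure) X. flip_process P k (removal_rule F) n G X \<longrightarrow>
       measure P {\<omega> \<in> space P. cut_dist M (dest M k (removal_rule F) (graph_kernel \<Omega> G))
           (graph_kernel \<Omega> (final_graph (\<lambda>t. X t \<omega>))) < \<epsilon>} \<ge> 1 - \<epsilon>)"
  proof (intro exI[of _ n\<^sub>0] allI ballI impI)
    fix n :: nat and G and \<Omega> :: "nat \<Rightarrow> 'a set" and P :: "'w measure" and X
    assume n: "n\<^sub>0 \<le> n" and G: "G \<in> graphs n" and \<Omega>: "vertex_partition M n \<Omega>"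
      and FP: "flip_process P k (removal_rule F) n G X"
    have kle: "k \<le> n" "0 < n" using n by (simp_all add: n\<^sub>0_def)
    have qn: "real q1 \<le> real n" "real q2 \<le> real n" "real q3 \<le> real n" "real q4 \<le> real n"
      using n by (simp_all add: n\<^sub>0_def)
    note n1 = order.trans[OF q(1) qn(1)] order.trans[OF q(2) qn(2)]
      order.trans[OF q(3) qn(3)] order.trans[OF q(4) qn(4)]
    interpret flip_graphon M k n F \<Omega>
    proof -
      interpret prob_space M by (rule assms(1))
      show "flip_graphon M k n F \<Omega>"
        by unfold_locales (rule assms(4) kle \<Omega>)+
    qed
    \<comment> \<open>One step moves a rectangle sum by about the rate divided by n^2, so these B
      steps make up a time step close to d.\<close>
    define B where "B = nat \<lfloor>d * (real n)\<^sup>2\<rfloor>"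
    define \<delta> where "\<delta> = real B / (real n)\<^sup>2"
    have n2: "0 < (real n)\<^sup>2" using kle by simp
    have big: "2 \<le> d * (real n)\<^sup>2"
    proof -
      have "2 \<le> d * real n" using n1(1) d by (simp add: pos_divide_le_eq mult.commute)
      also have "\<dots> \<le> d * (real n)\<^sup>2" using d kle by (intro mult_left_mono) (auto simp: power2_eq_square)
      finally show ?thesis .
    qed
    have Bb: "real B \<le> d * (real n)\<^sup>2" "d * (real n)\<^sup>2 - 1 \<le> real B"
    proof -
      have B': "real B = of_int \<lfloor>d * (real n)\<^sup>2\<rfloor>" using d by (simp add: B_def)
      show "real B \<le> d * (real n)\<^sup>2" unfolding B' by (rule of_int_floor_le)
      show "d * (real n)\<^sup>2 - 1 \<le> real B"
        unfolding B' using real_of_int_floor_add_one_gt[of "d * (real n)\<^sup>2"] by linarith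
    qed
    have \<delta>: "d / 2 \<le> \<delta>" "\<delta> \<le> d"
      using Bb big n2 by (simp_all add: \<delta>_def pos_divide_le_eq pos_le_divide_eq)
    have J\<delta>: "real J * \<delta> \<le> \<tau>"
    proof -
      have "real J * \<delta> \<le> real J * d" using \<delta> by (intro mult_left_mono) auto
      also have "\<dots> \<le> (2 * T / d + 1) * d" using J d by (intro mult_right_mono) auto
      also have "\<dots> \<le> \<tau>" using d by (simp add: \<tau>_def field_simps)
      finally show ?thesis .
    qed
    have T\<delta>: "T \<le> real J * \<delta>"
    proof -
      have "T = 2 * T / d * (d / 2)" using d by simp
      also have "\<dots> \<le> real J * \<delta>" using J \<delta> d by (intro mult_mono) auto
      finally show ?thesis .
    qed
    have kd: "m * ((real k)\<^sup>2 / real n) \<le> d"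
      using n1(2) d kle by (simp add: field_simps)
    have R: "\<exists>Z\<subseteq>V \<times> V. (\<Sum>(x, y)\<in>Z. w x y) \<le> \<delta>1 * (real n)\<^sup>2 \<and>
        (edge_pairs F \<noteq> {} \<longrightarrow> (\<forall>\<phi>\<in>maps. \<exists>e\<in>edge_pairs F. (\<phi> (fst e), \<phi> (snd e)) \<in> Z))"
      if w: "unit_on V w" and hd: "edge_pairs F \<noteq> {} \<Longrightarrow> hom_density w \<le> \<gamma>" for w
    \<comment> \<open>Without edges the hitting condition is dropped and the empty set will
      do.\<close>
    proof (cases "edge_pairs F = {}")
      case True
      then show ?thesis using \<delta>1 by (intro exI[of _ "{}"]) simp
    next
      case False
      have "(\<Sum>\<phi>\<in>maps. hom_weight F w \<phi>) \<le> \<gamma> * nk"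
        using hd[OF False] nk_pos by (simp add: hom_density_def pos_divide_le_eq)
      then have "(\<Sum>\<phi>\<in>maps. \<Prod>e\<in>edge_pairs F. w (\<phi> (fst e)) (\<phi> (snd e))) \<le> \<gamma> * real (card V) ^ card {1..k}"
        by (simp add: hom_weight_def)
      then show ?thesis
        using removal[rule_format, of V w] w kle(2) False by (simp add: unit_on_def)
    qed
    \<comment> \<open>The comparison time is \<open>real J * \<delta>\<close>; it depends on n but
      lies between T and \<tau>.\<close>
    have bad: "measure_pmf.prob (chain G (J * B)) {h. \<not> cut_bound V V (\<lambda>x y. adj h x y - w (real J * \<delta>) x y) (\<eta> * (real n)\<^sup>2)} \<le> \<epsilon>"
      if w: "is_flow w" "\<And>x y. x \<in> V \<Longrightarrow> y \<in> V \<Longrightarrow> w 0 x y = adj G x y" for w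
    proof -
      let ?\<theta> = "\<delta> * d * (2 + a)"
      let ?p = "4 ^ n * (2 * exp (- (c * (real n)\<^sup>2)))"
      have \<theta>: "0 \<le> ?\<theta>" using \<delta> d me by simp
      have be: "block_error ?\<theta> \<delta> J \<le> \<eta>"
        using block_error_small[OF d(1) _ \<delta>(2) J\<delta>] \<delta> d d\<eta> by (simp add: m_def e_def a_def)
      have "measure_pmf.prob (chain G (J * B)) {h. \<not> cut_bound V V (\<lambda>x y. adj h x y - w (real J * \<delta>) x y) (\<eta> * (real n)\<^sup>2)} \<le>
          measure_pmf.prob (chain G (J * B)) {h. \<not> cut_bound V V (\<lambda>x y. adj h x y - w (real J * \<delta>) x y) (block_error ?\<theta> \<delta> J * (real n)\<^sup>2)}"
      proof (rule measure_pmf.finite_measure_mono)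
        have "block_error ?\<theta> \<delta> J * (real n)\<^sup>2 \<le> \<eta> * (real n)\<^sup>2" using be by (intro mult_right_mono) auto
        then show "{h. \<not> cut_bound V V (\<lambda>x y. adj h x y - w (real J * \<delta>) x y) (\<eta> * (real n)\<^sup>2)} \<subseteq>
          {h. \<not> cut_bound V V (\<lambda>x y. adj h x y - w (real J * \<delta>) x y) (block_error ?\<theta> \<delta> J * (real n)\<^sup>2)}"
          using cut_bound_mono by blast
      qed simp
      also have "\<dots> \<le> real J * ?p"
      proof (rule flow_tracking[OF w G \<delta>_def \<theta>])
        fix g assume g: "g \<in> graphs n"
        show "measure_pmf.prob (chain g B) {h. \<not> cut_bound V V
            (\<lambda>x y. adj h x y - adj g x y + \<delta> * rate (adj g) x y) (?\<theta> * (real n)\<^sup>2)} \<le> ?p"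
          using block_deviation_small[OF g d _ \<delta>_def \<delta> l_def[unfolded m_def]] kd
          by (simp add: m_def e_def a_def c_def)
      qed
      also have "\<dots> \<le> \<epsilon>"
      proof -
        have "4 ^ n * exp (- (c * (real n)\<^sup>2)) \<le> 1 / real n" by (rule exp_bound_four[OF n1(3) c kle(2)])
        then have "2 * real J * (4 ^ n * exp (- (c * (real n)\<^sup>2))) \<le> 2 * real J * (1 / real n)"
          by (intro mult_left_mono) auto
        also have "\<dots> \<le> \<epsilon>" using n1(4) \<epsilon> kle by (simp add: field_simps)
        finally show ?thesis by (simp add: mult_ac)
      qed
      finally show ?thesis .
    qed
    show "1 - \<epsilon> \<le> measure P {\<omega> \<in> space P. cut_dist M (dest M k (removal_rule F) (graph_kernel \<Omega> G))
           (graph_kernel \<Omega> (final_graph (\<lambda>t. X t \<omega>))) < \<epsilon>}"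
      by (rule prob_destination_near_final_graph[OF FP G R \<gamma> _ _ _ bad])
         (use T\<delta> e\<eta> total in \<open>simp_all add: T_def m_def e_def\<close>)
  qed
qed

end
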